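(* Let $\mathcal{A}$ be a set of $d$ distinct lines of $\mathbb{P}^2$. Assume the lines in $\mathcal{A}$ are not concurrent. Let $\ell$ be a general linear form and let $r_{\mathcal{A}}$ be the general residual of $\mathcal{A}$ with respect to $\ell$. For each point $P\in S(\mathcal{A})$, consider the ideal $$\mathfrak{a}_P=(\ell_P,I_P^{t_P-2})\cap\bigcap_{P'\in S(\mathcal{A})\setminus\{P\}}(\ell_{P'},I_{P'}^{t_{P'}-1}).$$ Define the ideal $I=r_{\mathcal{A}}\cap I_{\ell^\vee}$. The following conditions are equivalent (where $a,b$ are the same integers in (a) and (b)): (a) The line arrangement determined by $\mathcal{A}$ is free with exponents $a-1$ and $b-1$ for some integers $a,b$. (b) The ideal $I$ is generated by two forms of degree $a$ and $b$ with $a+b=d+1$ and $a,b\ge2$. (c) The $h$-vector of $S/I$ is symmetric, i.e., for any integer $j$, the Hilbert function of $S/I$ satisfies $$h_{S/I}(d-2-j)=\deg I-h_{S/I}(j),$$ and, for any point $P\in S(\mathcal{A})$, one has $$h_{S/(\mathfrak{a}_P\cap I_{\ell^\vee})}(d-2)=\deg I-1.$$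
   Context: $K$ is a field of characteristic zero, $S=K[x_0,x_1,x_2]$ with the standard grading. $f_{\mathcal{A}}$ is the product of the linear forms defining the lines in $\mathcal{A}$, and $\mathrm{Jac}(f_{\mathcal{A}})$ is the ideal generated by its first partial derivatives. $\mathcal{A}$ is free if $\mathrm{Jac}(f_{\mathcal{A}})$ is saturated; it is free with exponents $e_1,e_2$ if the syzygy module of $\mathrm{Jac}(f_{\mathcal{A}})$ is a free $S$-module with two generators of degrees $d-1+e_1$ and $d-1+e_2$. $S(\mathcal{A})$ is the set of intersection points of pairs of distinct lines of $\mathcal{A}$; for $P\in S(\mathcal{A})$, $t_P$ is the number of lines of $\mathcal{A}$ containing $P$ and $I_P$ is the homogeneous ideal of $P$ ($I_P^0=S$). For $\ell=\sum a_ix_i$, put $\frac{\partial f}{\partial\ell}=\sum_i a_i\frac{\partial f}{\partial x_i}$ and $\ell^\vee=(a_0:a_1:a_2)\in\mathbb{P}^2$ with homogeneous ideal $I_{\ell^\vee}$; $\ell_P$ is a linear form defining the line through $P$ and $\ell^\vee$. "General $\ell$" means $\ell$ in a suitable nonempty Zariski-open subset of $[S]_1$ depending on $\mathcal{A}$. The general residual is $r_{\mathcal{A}}=(f_{\mathcal{A}},\frac{\partial f_{\mathcal{A}}}{\partial\ell}):\mathrm{Jac}(f_{\mathcal{A}})$. $h_M(j)=\dim_K[M]_j$ and $\deg I$ is the degree of the zero-dimensional scheme defined by $I$. *)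

theory Defs
  imports "HOL-Analysis.Analysis" "HOL-Library.Poly_Mapping"
begin

section \<open>The graded polynomial ring $S = K[x_0, x_1, x_2]$\<close>

text \<open>A monomial is its exponent vector, indexed by the three-element type \<^typ>\<open>3\<close>.\<close>

type_synonym 'a poly3 = "(3 \<Rightarrow>\<^sub>0 nat) \<Rightarrow>\<^sub>0 'a"

definition const :: "'a::field \<Rightarrow> 'a poly3" where
  "const c = Poly_Mapping.single 0 c"

definition X :: "3 \<Rightarrow> 'a::field poly3" where
  "X i = Poly_Mapping.single (Poly_Mapping.single i 1) 1"

definition eval :: "'a::field poly3 \<Rightarrow> 'a ^ 3 \<Rightarrow> 'a" where
  "eval p v = (\<Sum>m\<in>Poly_Mapping.keys p.
     Poly_Mapping.lookup p m * (\<Prod>i\<in>UNIV. (v $ i) ^ Poly_Mapping.lookup m i))"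

text \<open>The graded piece $[S]_j$. The index is an integer; $[S]_j = 0$ for $j < 0$.\<close>

definition forms :: "int \<Rightarrow> 'a::field poly3 set" where
  "forms j = {p. \<forall>m\<in>Poly_Mapping.keys p. int (\<Sum>i\<in>UNIV. Poly_Mapping.lookup m i) = j}"

text \<open>If $x_i$ does not occur in the monomial \<open>m\<close>, the truncated subtraction of exponents is
  harmless because the coefficient \<open>of_nat 0\<close> annihilates the term.\<close>

definition pdiff :: "3 \<Rightarrow> 'a::field poly3 \<Rightarrow> 'a poly3" where
  "pdiff i p = (\<Sum>m\<in>Poly_Mapping.keys p.
     Poly_Mapping.single (m - Poly_Mapping.single i 1)
       (of_nat (Poly_Mapping.lookup m i) * Poly_Mapping.lookup p m))"

definition lin_coeffs :: "'a::field poly3 \<Rightarrow> 'a ^ 3" where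
  "lin_coeffs l = (\<chi> i. Poly_Mapping.lookup l (Poly_Mapping.single i 1))"

definition pdiff_along :: "'a::field poly3 \<Rightarrow> 'a poly3 \<Rightarrow> 'a poly3" where
  "pdiff_along l f = (\<Sum>i\<in>UNIV. const (lin_coeffs l $ i) * pdiff i f)"

text \<open>$[S]_1$ is identified with $K^3$ through the coefficients; a Zariski-open set is the
  complement of the common zero locus of a set \<open>G\<close> of polynomials in these coefficients.\<close>

definition zariski_open_linear_forms :: "'a::field poly3 set \<Rightarrow> bool" where
  "zariski_open_linear_forms U \<longleftrightarrow>
     (\<exists>G :: 'a poly3 set. U = {l \<in> forms 1. \<exists>g\<in>G. eval g (lin_coeffs l) \<noteq> 0})"


section \<open>Ideals and free modules\<close>

global_interpretation ideal: module "(*) :: 'a::field poly3 \<Rightarrow> 'a poly3 \<Rightarrow> 'a poly3"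
  by unfold_locales (simp_all add: algebra_simps)

global_interpretation S3: module "(*s) :: 'a::field poly3 \<Rightarrow> 'a poly3 ^ 3 \<Rightarrow> 'a poly3 ^ 3"
  by unfold_locales (simp_all add: vec_eq_iff algebra_simps)

definition colon :: "'a::field poly3 set \<Rightarrow> 'a poly3 set \<Rightarrow> 'a poly3 set" where
  "colon I J = {g. \<forall>h\<in>J. g * h \<in> I}"

fun ideal_power :: "'a::field poly3 set \<Rightarrow> nat \<Rightarrow> 'a poly3 set" where
  "ideal_power I 0 = UNIV"
| "ideal_power I (Suc k) = ideal.span {g * h | g h. g \<in> I \<and> h \<in> ideal_power I k}"

definition irrelevant :: "'a::field poly3 set" where
  "irrelevant = ideal.span (range X)"

definition saturated :: "'a::field poly3 set \<Rightarrow> bool" where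
  "saturated I \<longleftrightarrow> (\<Union>k. colon I (ideal_power irrelevant k)) = I"


section \<open>Hilbert functions and degrees\<close>

text \<open>The dimension of the quotient space $V/W$: the size of a finite subset of $V$ whose
  residue classes form a $K$-basis of $V/W$.\<close>

definition quotient_dim :: "'a::field poly3 set \<Rightarrow> 'a poly3 set \<Rightarrow> nat" where
  "quotient_dim V W = (THE n. \<exists>B. B \<subseteq> V \<and> finite B \<and> card B = n \<and>
     (\<forall>v\<in>V. \<exists>c. v - (\<Sum>b\<in>B. const (c b) * b) \<in> W) \<and>
     (\<forall>c. (\<Sum>b\<in>B. const (c b) * b) \<in> W \<longrightarrow> (\<forall>b\<in>B. c b = 0)))"

text \<open>$h_{S/I}(j) = \dim_K [S/I]_j$ for a homogeneous ideal $I$.\<close>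

definition hilb :: "'a::field poly3 set \<Rightarrow> int \<Rightarrow> int" where
  "hilb I j = int (quotient_dim (forms j) (I \<inter> forms j))"

text \<open>The degree of the zero-dimensional scheme defined by $I$ is the constant Hilbert
  polynomial of $S/I$, that is, the eventual value of the Hilbert function.\<close>

definition scheme_degree :: "'a::field poly3 set \<Rightarrow> int" where
  "scheme_degree I = (THE n. \<exists>j0. \<forall>j\<ge>j0. hilb I j = n)"


section \<open>The projective plane\<close>

text \<open>A point of $\mathbb{P}^2$ is a one-dimensional subspace of $K^3$; a line is a set of points.\<close>

definition proj_point :: "'a::field ^ 3 \<Rightarrow> ('a ^ 3) set" where
  "proj_point v = vec.span {v}"

definition P2 :: "('a::field ^ 3) set set" where
  "P2 = {proj_point v | v. v \<noteq> 0}"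

definition line_of :: "'a::field poly3 \<Rightarrow> ('a ^ 3) set set" where
  "line_of l = {P \<in> P2. \<forall>v\<in>P. eval l v = 0}"

definition is_line :: "('a::field ^ 3) set set \<Rightarrow> bool" where
  "is_line L \<longleftrightarrow> (\<exists>l\<in>forms 1. l \<noteq> 0 \<and> L = line_of l)"

text \<open>A defining linear form of a line is unique up to a nonzero scalar; none of the notions
  below depends on this scalar.\<close>

definition defining_form :: "('a::field ^ 3) set set \<Rightarrow> 'a poly3" where
  "defining_form L = (SOME l. l \<in> forms 1 \<and> l \<noteq> 0 \<and> L = line_of l)"

definition point_ideal :: "('a::field ^ 3) set \<Rightarrow> 'a poly3 set" where
  "point_ideal P = ideal.span {f. (\<exists>j. f \<in> forms j) \<and> (\<forall>v\<in>P. eval f v = 0)}"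

definition dual_point :: "'a::field poly3 \<Rightarrow> ('a ^ 3) set" where
  "dual_point l = proj_point (lin_coeffs l)"

text \<open>A linear form defining the line through \<open>P\<close> and \<open>Q\<close>; meaningful for \<open>P \<noteq> Q\<close>.\<close>

definition join_form :: "('a::field ^ 3) set \<Rightarrow> ('a ^ 3) set \<Rightarrow> 'a poly3" where
  "join_form P Q = (SOME l. l \<in> forms 1 \<and> l \<noteq> 0 \<and> P \<in> line_of l \<and> Q \<in> line_of l)"


section \<open>Line arrangements\<close>

definition concurrent :: "('a::field ^ 3) set set set \<Rightarrow> bool" where
  "concurrent A \<longleftrightarrow> (\<exists>P\<in>P2. \<forall>L\<in>A. P \<in> L)"

definition arr_poly :: "('a::field ^ 3) set set set \<Rightarrow> 'a poly3" where
  "arr_poly A = (\<Prod>L\<in>A. defining_form L)"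

definition jac :: "'a::field poly3 \<Rightarrow> 'a poly3 set" where
  "jac f = ideal.span (range (\<lambda>i. pdiff i f))"

definition syz :: "'a::field poly3 \<Rightarrow> ('a poly3 ^ 3) set" where
  "syz f = {s. (\<Sum>i\<in>UNIV. s $ i * pdiff i f) = 0}"

definition free_arr :: "('a::field ^ 3) set set set \<Rightarrow> bool" where
  "free_arr A \<longleftrightarrow> saturated (jac (arr_poly A))"

text \<open>The syzygy module is a graded submodule of $S(-(d-1))^3$, the partial derivatives being
  forms of degree $d-1$. So its generators of degree $d-1+e$ are the syzygies whose entries are
  forms of degree $e$.\<close>

definition free_with_exponents :: "('a::field ^ 3) set set set \<Rightarrow> int \<Rightarrow> int \<Rightarrow> bool" where
  "free_with_exponents A e1 e2 \<longleftrightarrow> free_arr A \<and>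
     (\<exists>s t. (\<forall>i. s $ i \<in> forms e1) \<and> (\<forall>i. t $ i \<in> forms e2) \<and> s \<noteq> t \<and>
        \<not> S3.dependent {s, t} \<and> S3.span {s, t} = syz (arr_poly A))"

definition sing_points :: "('a::field ^ 3) set set set \<Rightarrow> ('a ^ 3) set set" where
  "sing_points A = {P. \<exists>L\<in>A. \<exists>L'\<in>A. L \<noteq> L' \<and> P \<in> L \<inter> L'}"

definition mult_at :: "('a::field ^ 3) set set set \<Rightarrow> ('a ^ 3) set \<Rightarrow> nat" where
  "mult_at A P = card {L \<in> A. P \<in> L}"

definition residual :: "('a::field ^ 3) set set set \<Rightarrow> 'a poly3 \<Rightarrow> 'a poly3 set" where
  "residual A l =
     colon (ideal.span {arr_poly A, pdiff_along l (arr_poly A)}) (jac (arr_poly A))"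

definition fat_on_join ::
    "('a::field ^ 3) set \<Rightarrow> ('a ^ 3) set \<Rightarrow> nat \<Rightarrow> 'a poly3 set" where
  "fat_on_join P Q k = ideal.span (insert (join_form P Q) (ideal_power (point_ideal P) k))"

text \<open>The ideal $\mathfrak{a}_P$. Every point \<open>P\<close> of \<open>sing_points A\<close> lies on at least two lines,
  so the subtractions below do not truncate.\<close>

definition ideal_a ::
    "('a::field ^ 3) set set set \<Rightarrow> 'a poly3 \<Rightarrow> ('a ^ 3) set \<Rightarrow> 'a poly3 set" where
  "ideal_a A l P = fat_on_join P (dual_point l) (mult_at A P - 2) \<inter>
     (\<Inter>P'\<in>sing_points A - {P}. fat_on_join P' (dual_point l) (mult_at A P' - 1))"

end

theory Submission
  imports Defs "Berlekamp_Zassenhaus.Unique_Factorization_Poly"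
begin

no_notation Matrix.vec_index (infixl "$" 100)
hide_fact (open) Matrix.vec_eq_iff
alias lookup = Poly_Mapping.lookup
alias single = Poly_Mapping.single
alias keys = Poly_Mapping.keys

text \<open>
  Let \<open>v\<close> be the point dual to the general linear form, and view the syzygies of the Jacobian ideal as
  derivations killing \<open>f\<close>. The determinant \<open>phi\<close> of a derivation with the Euler derivation \<open>E\<close> and
  \<open>v\<close> maps these syzygies onto \<open>I\<close>, and its kernel is generated by \<open>theta0 = f1 E - d f v\<close>, where
  \<open>f1\<close> is the derivative of \<open>f\<close> along \<open>v\<close>. Hence \<open>phi t * s - phi s * t\<close> is a multiple of \<open>theta0\<close> for
  all syzygies \<open>s\<close> and \<open>t\<close>, and \<open>s\<close>, \<open>t\<close> form a basis exactly when the factor is a nonzero constant;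
  comparing degrees gives \<open>a + b = d + 1\<close>. A basis makes the Jacobian ideal saturated by
  exactness of the Koszul complex.

  If the h-vector is symmetric and \<open>a\<close> is the least degree of a nonzero form \<open>F\<close> in \<open>I\<close>, counting dimensions
  yields a form of degree at most \<open>d + 1 - a\<close> in \<open>I\<close> that is not a multiple of \<open>F\<close>. By unique factorization
  and minimality of \<open>a\<close>, the two corresponding syzygies are independent, hence a basis.

  Conversely, a complete intersection has a symmetric h-vector. Moreover \<open>I\<close> is the intersection of the
  ideal of \<open>v\<close> with all \<open>(\<ell>_P, I_P^(t_P - 1))\<close>. So \<open>I_P\<close> multiplies the ideal in the second half of (c) into
  \<open>I\<close>, and since the socle of a complete intersection of type \<open>(a, b)\<close> sits in degree \<open>a + b - 2 = d - 1\<close> on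
  each point, the two ideals agree in degree \<open>d - 2\<close>.
\<close>

text \<open>The genericity used is that \<open>v\<close> lies on no line, that is,
  \<open>f(v) \<noteq> 0\<close>. It has two effects. No line divides \<open>f1\<close>, so
  \<open>f\<close> and \<open>f1\<close> are coprime; and Euler's formula at \<open>v\<close> gives
  \<open>f1(v) = d * f(v)\<close>, which is nonzero in characteristic zero. Coprimality makes the
  kernel of \<open>phi\<close> cyclic. Both effects enter when a member of the residual is lifted to
  a syzygy, and the lift uses that the member vanishes at \<open>v\<close>. Since every value of
  \<open>phi\<close> vanishes at \<open>v\<close>, the ideal of \<open>v\<close> has to be part of
  \<open>I\<close>. The multiplier of \<open>theta0\<close> takes the place of the determinant in
  Saito's criterion. It is forced to be a unit because \<open>I\<close> has codimension two: it
  contains all products of the coprime pair \<open>lf y\<close>, \<open>lf z\<close> with the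
  coprime pair \<open>f\<close>, \<open>f1\<close>. Local conditions are treated without
  localization. The ideal at \<open>P\<close> becomes \<open>(lf w, lf n ^ k)\<close>, where
  \<open>w\<close> is the line joining \<open>P\<close> to \<open>v\<close>, and membership is
  divisibility by a prime power after restriction to \<open>w\<close>. All lines through
  \<open>P\<close> have the same restriction to \<open>w\<close> up to scalars, which is where the
  exponent comes from.\<close>

declare ideal.scale_scale [simp del]

subsection \<open>Polynomials in three variables\<close>

lemma const_simps [simp]:
  "const 0 = 0" "const 1 = 1"
  by (simp_all add: const_def)

lemma const_add: "const (a + b) = const a + const b"
  by (simp add: const_def single_add)

lemma const_mult: "const (a * b) = const a * const b"
  by (simp add: const_def mult_single)

lemma const_uminus: "const (- a) = - const a"
  by (simp add: const_def single_uminus)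

lemma const_diff: "const (a - b) = const a - const b"
  by (simp add: const_def single_diff)

lemma const_eq_iff [simp]: "const a = const b \<longleftrightarrow> a = b"
  by (metis const_def lookup_single_eq)

lemma const_eq_0_iff [simp]: "const a = 0 \<longleftrightarrow> a = 0"
  by (metis const_eq_iff const_simps(1))

lemma const_of_nat: "const (of_nat n) = of_nat n"
  by (induction n) (simp_all add: const_add)

lemma const_sum: "const (sum f A) = (\<Sum>x\<in>A. const (f x))"
  by (induction A rule: infinite_finite_induct) (simp_all add: const_add)

lemma const_inverse_left: "c \<noteq> 0 \<Longrightarrow> const (inverse c) * const c = 1"
  by (simp flip: const_mult)

lemma const_inverse_right: "c \<noteq> 0 \<Longrightarrow> const c * const (inverse c) = 1"
  by (simp flip: const_mult)

lemma const_mult_inverse: "c \<noteq> 0 \<Longrightarrow> const c * (const (inverse c) * p) = p"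
  by (subst mult.assoc[symmetric]) (simp add: const_inverse_right)

lemma const_inverse_mult: "c \<noteq> 0 \<Longrightarrow> const (inverse c) * (const c * p) = p"
  by (subst mult.assoc[symmetric]) (simp add: const_inverse_left)

lemma const_dvd [simp]: "c \<noteq> 0 \<Longrightarrow> const c dvd p"
  by (metis const_mult_inverse dvd_triv_left)

lemma dvd_const_mult_iff: "c \<noteq> 0 \<Longrightarrow> p dvd const c * q \<longleftrightarrow> p dvd q"
  using dvd_mult[of p "const c * q" "const (inverse c)"] dvd_mult[of p q "const c"]
  by (metis const_inverse_mult)

abbreviation mono3 :: "(3 \<Rightarrow>\<^sub>0 nat) \<Rightarrow> (3 \<Rightarrow> 'b::comm_monoid_mult) \<Rightarrow> 'b" where
  "mono3 m h \<equiv> (\<Prod>i\<in>UNIV. h i ^ lookup m i)"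

lemma mono3_add: "mono3 (m + n) h = mono3 m h * mono3 n h"
  by (simp add: lookup_add power_add prod.distrib)

lemma mono3_single: "mono3 (single i 1) h = h i"
proof -
  have "mono3 (single i 1) h = (\<Prod>j\<in>UNIV. if j = i then h i else 1)"
    by (intro prod.cong) (auto simp: lookup_single when_def)
  then show ?thesis by simp
qed

lemma sum_single: "(\<Sum>m\<in>keys p. single m (lookup p m)) = p"
  by (rule poly_mapping_eqI) (auto simp: lookup_sum lookup_single when_def in_keys_iff)

lemma X_power: "X i ^ n = single (single i n) 1"
  by (induction n) (simp_all add: X_def mult_single flip: single_add)

lemma prod_single_one:
  "finite A \<Longrightarrow> (\<Prod>i\<in>A. single (f i) (1::'a::field))
    = (single (\<Sum>i\<in>A. f i) 1 :: 'a poly3)"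
  by (induction A rule: finite_induct) (simp_all add: mult_single)

lemma mono3_X: "mono3 m X = single m (1::'a::field)"
proof -
  have "(\<Sum>i\<in>UNIV. single i (lookup m i)) = m"
    by (rule poly_mapping_eqI) (simp add: lookup_sum lookup_single when_def)
  then show ?thesis by (simp add: X_power prod_single_one)
qed

lemma single_eq: "single m c = const c * mono3 m X"
  by (simp only: mono3_X) (simp add: const_def mult_single)

lemma poly3_induct [case_names const X add mult]:
  assumes "\<And>c. P (const c)" "\<And>i. P (X i)"
    "\<And>p q. P p \<Longrightarrow> P q \<Longrightarrow> P (p + q)" "\<And>p q. P p \<Longrightarrow> P q \<Longrightarrow> P (p * q)"
  shows "P p"
proof -
  have P1: "P 1" using assms(1)[of 1] by simp
  have pow: "P (X i ^ n)" for i n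
    by (induction n) (use P1 assms(2,4) in auto)
  have "P (\<Prod>i\<in>A. X i ^ f i)" if "finite A" for A and f :: "3 \<Rightarrow> nat"
    using that by (induction A) (use P1 pow assms(4) in auto)
  then have single: "P (single m c)" for m c
    unfolding single_eq by (intro assms(1,4)) auto
  have "P (\<Sum>m\<in>A. single m (f m))" if "finite A" for A f
    using that by (induction A) (use assms(1)[of 0] assms(3) single in auto)
  from this[of "keys p" "lookup p"] show ?thesis
    by (simp add: sum_single)
qed

lemma poly3_monomial_induct [case_names single add]:
  assumes "\<And>m c. P (single m c)" "\<And>p q. P p \<Longrightarrow> P q \<Longrightarrow> P (p + q)"
  shows "P (p :: 'a::field poly3)"
proof -
  have "P (\<Sum>m\<in>A. single m (f m))" if "finite A" for A f
    using that by (induction A) (use assms(1)[of 0 0] assms(2) assms(1) in auto)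
  from this[of "keys p" "lookup p"] show ?thesis
    by (simp add: sum_single)
qed

text \<open>One construction serves three homomorphisms: evaluation at a point (\<open>c\<close> the
  identity), endomorphisms of S (\<open>c = const\<close>), and the isomorphism with iterated
  univariate polynomials (\<open>c = poly_const\<close>).\<close>

definition insertion :: "('a::field \<Rightarrow> 'b::comm_ring_1) \<Rightarrow> (3 \<Rightarrow> 'b) \<Rightarrow> 'a poly3 \<Rightarrow> 'b" where
  "insertion c h p = (\<Sum>m\<in>keys p. c (lookup p m) * mono3 m h)"

locale coeff_hom =
  fixes c :: "'a::field \<Rightarrow> 'b::comm_ring_1"
  assumes c0: "c 0 = 0" and c1: "c 1 = 1"
    and cadd: "c (x + y) = c x + c y" and cmult: "c (x * y) = c x * c y"
begin

lemma insertion_superset: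
  assumes "finite A" "keys p \<subseteq> A"
  shows "insertion c h p = (\<Sum>m\<in>A. c (lookup p m) * mono3 m h)"
  unfolding insertion_def using assms
  by (intro sum.mono_neutral_left) (auto simp: in_keys_iff c0)

lemma insertion_add: "insertion c h (p + q) = insertion c h p + insertion c h q"
proof -
  let ?A = "keys p \<union> keys q"
  have "keys (p + q) \<subseteq> ?A" by (rule keys_add)
  then show ?thesis
    by (simp add: insertion_superset[of ?A] lookup_add cadd c0 distrib_right sum.distrib)
qed

lemma insertion_single: "insertion c h (single m a) = c a * mono3 m h"
  by (subst insertion_superset[of "{m}"]) (auto simp: c0)

lemma insertion_mult: "insertion c h (p * q) = insertion c h p * insertion c h q"
proof (induction p rule: poly3_monomial_induct)
  case (single m a)
  show ?case
  proof (induction q rule: poly3_monomial_induct)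
    case (single n b)
    show ?case by (simp add: mult_single insertion_single cmult mono3_add mult_ac)
  next
    case (add p q)
    then show ?case by (simp add: insertion_add distrib_left)
  qed
next
  case (add p q)
  then show ?case by (simp add: insertion_add distrib_right)
qed

lemma insertion_const [simp]: "insertion c h (const a) = c a"
  by (simp add: const_def insertion_single)

lemma insertion_0 [simp]: "insertion c h 0 = 0"
  by (simp add: insertion_def)

lemma insertion_1 [simp]: "insertion c h 1 = 1"
  using insertion_const[of h 1] by (simp add: c1)

lemma insertion_X [simp]: "insertion c h (X i) = h i"
  by (simp only: X_def insertion_single mono3_single) (simp add: c1)

lemma insertion_uminus: "insertion c h (- p) = - insertion c h p"
  using insertion_add[of h p "- p"] by (simp add: eq_neg_iff_add_eq_0 add.commute)

lemma insertion_diff: "insertion c h (p - q) = insertion c h p - insertion c h q"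
  using insertion_add[of h p "- q"] by (simp add: insertion_uminus)

lemma insertion_power: "insertion c h (p ^ n) = insertion c h p ^ n"
  by (induction n) (simp_all add: insertion_mult)

lemma insertion_sum: "insertion c h (sum f A) = (\<Sum>x\<in>A. insertion c h (f x))"
  by (induction A rule: infinite_finite_induct) (simp_all add: insertion_add)

lemma insertion_prod: "insertion c h (prod f A) = (\<Prod>x\<in>A. insertion c h (f x))"
  by (induction A rule: infinite_finite_induct) (simp_all add: insertion_mult)

lemmas insertion_hom = insertion_add insertion_mult insertion_uminus insertion_diff
  insertion_power insertion_sum insertion_prod

end

global_interpretation const_hom: coeff_hom const
  by unfold_locales (simp_all add: const_add const_mult)

global_interpretation id_hom: coeff_hom "\<lambda>x. x"
  by unfold_locales simp_all

lemma eval_eq_insertion: "eval p v = insertion (\<lambda>x. x) (($) v) p"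
  by (simp add: eval_def insertion_def)

lemma eval_simps [simp]:
  "eval (const a) v = a" "eval 0 v = 0" "eval 1 v = 1" "eval (X i) v = v $ i"
  "eval (p + q) v = eval p v + eval q v" "eval (p * q) v = eval p v * eval q v"
  "eval (- p) v = - eval p v" "eval (p - q) v = eval p v - eval q v"
  by (simp_all only: eval_eq_insertion id_hom.insertion_add id_hom.insertion_mult id_hom.insertion_uminus
      id_hom.insertion_diff id_hom.insertion_const id_hom.insertion_0 id_hom.insertion_1 id_hom.insertion_X)

lemma eval_sum: "eval (sum f A) v = (\<Sum>x\<in>A. eval (f x) v)"
  by (simp only: eval_eq_insertion id_hom.insertion_sum)

lemma eval_prod: "eval (prod f A) v = (\<Prod>x\<in>A. eval (f x) v)"
  by (simp only: eval_eq_insertion id_hom.insertion_prod)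

abbreviation sub :: "(3 \<Rightarrow> 'a::field poly3) \<Rightarrow> 'a poly3 \<Rightarrow> 'a poly3" where
  "sub \<equiv> insertion const"

text \<open>Modulo the ideal, the identity and \<open>sub h\<close> are both algebra homomorphisms,
  so agreement on the variables suffices. Polynomials are reduced in this way to a line
  (\<open>dvd_diff_kill\<close>) or to a point (\<open>point_ideal_eq\<close>).\<close>

lemma diff_sub_in_ideal:
  assumes "\<And>i. X i - sub h (X i) \<in> ideal.span B"
  shows "p - sub h p \<in> ideal.span B"
proof (induction p rule: poly3_induct)
  case (const c)
  show ?case by (simp add: ideal.span_zero)
next
  case (X i)
  show ?case by (rule assms)
next
  case (add p q)
  then have "(p - sub h p) + (q - sub h q) \<in> ideal.span B" by (rule ideal.span_add)
  then show ?case by (simp add: const_hom.insertion_add algebra_simps)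
next
  case (mult p q)
  then have "q * (p - sub h p) + sub h p * (q - sub h q) \<in> ideal.span B"
    by (intro ideal.span_add ideal.span_scale)
  then show ?case by (simp add: const_hom.insertion_mult algebra_simps)
qed

subsection \<open>The grading\<close>

abbreviation mdeg :: "(3 \<Rightarrow>\<^sub>0 nat) \<Rightarrow> int" where
  "mdeg m \<equiv> int (\<Sum>i\<in>UNIV. lookup m i)"

lemma mdeg_add: "mdeg (m + n) = mdeg m + mdeg n"
  by (simp add: lookup_add sum.distrib)

lemma forms_iff: "p \<in> forms j \<longleftrightarrow> (\<forall>m. lookup p m \<noteq> 0 \<longrightarrow> mdeg m = j)"
  unfolding forms_def by (simp only: mem_Collect_eq Ball_def in_keys_iff)

lemma forms_0 [simp]: "0 \<in> forms j"
  by (simp add: forms_iff)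

lemma forms_add: "p \<in> forms j \<Longrightarrow> q \<in> forms j \<Longrightarrow> p + q \<in> forms j"
  unfolding forms_iff by (metis add.right_neutral lookup_add)

lemma forms_uminus: "p \<in> forms j \<Longrightarrow> - p \<in> forms j"
  by (simp add: forms_iff)

lemma forms_diff: "p \<in> forms j \<Longrightarrow> q \<in> forms j \<Longrightarrow> p - q \<in> forms j"
  using forms_add[of p j "- q"] by (simp add: forms_uminus)

lemma forms_sum: "(\<And>x. x \<in> A \<Longrightarrow> f x \<in> forms j) \<Longrightarrow> sum f A \<in> forms j"
  by (induction A rule: infinite_finite_induct) (auto intro: forms_add)

lemma single_in_forms: "mdeg m = j \<Longrightarrow> single m c \<in> forms j"
  by (simp add: forms_iff lookup_single when_def)

lemma forms_mult: "p \<in> forms i \<Longrightarrow> q \<in> forms j \<Longrightarrow> p * q \<in> forms (i + j)"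
  unfolding forms_def using keys_mult[of p q] by (fastforce simp: mdeg_add simp del: of_nat_sum)

lemma const_in_forms [simp]: "const c \<in> forms 0"
  by (auto simp: const_def intro: single_in_forms)

lemma X_in_forms [simp]: "X i \<in> forms 1"
  unfolding X_def by (rule single_in_forms) (simp add: lookup_single when_def)

lemma forms_const_mult: "p \<in> forms j \<Longrightarrow> const c * p \<in> forms j"
  using forms_mult[OF const_in_forms, of p j c] by simp

lemma one_in_forms [simp]: "1 \<in> forms 0"
  using const_in_forms[of 1] by simp

lemma forms_prod: "finite A \<Longrightarrow> (\<And>x. x \<in> A \<Longrightarrow> f x \<in> forms 1) \<Longrightarrow> prod f A \<in> forms (int (card A))"
proof (induction A rule: finite_induct)
  case (insert x A)
  then show ?case using forms_mult[of "f x" 1 "prod f A" "int (card A)"] by simp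
qed simp

lemma forms_neg: "j < 0 \<Longrightarrow> forms j = {0}"
proof -
  assume j: "j < 0"
  have "p = 0" if p: "p \<in> forms j" for p :: "'a::field poly3"
  proof (rule poly_mapping_eqI, rule ccontr)
    fix m
    assume "lookup p m \<noteq> lookup 0 m"
    then have "mdeg m = j" using p unfolding forms_iff by simp
    with j show False using of_nat_less_0_iff by blast
  qed
  then show ?thesis by auto
qed

lemma forms_degree_0:
  assumes "p \<in> forms 0"
  shows "\<exists>c. p = const c"
proof
  have "m = 0" if "mdeg m = 0" for m
    using that by (intro poly_mapping_eqI) (simp del: of_nat_sum)
  then have "lookup p m = 0" if "m \<noteq> 0" for m
    using assms that by (metis forms_iff)
  then show "p = const (lookup p 0)"
    by (intro poly_mapping_eqI) (auto simp: const_def lookup_single when_def)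
qed

definition hcomp :: "int \<Rightarrow> 'a::field poly3 \<Rightarrow> 'a poly3" where
  "hcomp j p = (\<Sum>m\<in>{m\<in>keys p. mdeg m = j}. single m (lookup p m))"

lemma lookup_hcomp: "lookup (hcomp j p) m = (if mdeg m = j then lookup p m else 0)"
  by (auto simp: hcomp_def lookup_sum lookup_single when_def in_keys_iff simp del: of_nat_sum)

lemma hcomp_add: "hcomp j (p + q) = hcomp j p + hcomp j q"
  by (rule poly_mapping_eqI) (simp add: lookup_hcomp lookup_add)

lemma hcomp_0 [simp]: "hcomp j 0 = 0"
  by (rule poly_mapping_eqI) (simp add: lookup_hcomp)

lemma hcomp_diff: "hcomp j (p - q) = hcomp j p - hcomp j q"
  by (rule poly_mapping_eqI) (simp add: lookup_hcomp lookup_minus)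

lemma hcomp_sum: "hcomp j (sum f A) = (\<Sum>x\<in>A. hcomp j (f x))"
  by (induction A rule: infinite_finite_induct) (simp_all add: hcomp_add)

lemma hcomp_in_forms [simp]: "hcomp j p \<in> forms j"
  by (simp add: forms_iff lookup_hcomp)

lemma hcomp_forms: "p \<in> forms i \<Longrightarrow> hcomp j p = (if j = i then p else 0)"
  by (rule poly_mapping_eqI) (auto simp: lookup_hcomp forms_iff)

lemma hcomp_mult:
  assumes "q \<in> forms e"
  shows "hcomp j (p * q) = hcomp (j - e) p * q"
proof (induction p rule: poly3_monomial_induct)
  case (single m a)
  have "single m a * q \<in> forms (mdeg m + e)"
    by (intro forms_mult single_in_forms assms refl)
  then show ?case
    by (simp add: hcomp_forms[OF single_in_forms[OF refl]] hcomp_forms del: of_nat_sum)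
next
  case (add p q)
  then show ?case by (simp add: hcomp_add distrib_right)
qed

lemma hcomp_const_mult: "hcomp j (const c * p) = const c * hcomp j p"
  using hcomp_mult[OF const_in_forms, of j p c] by (simp add: mult.commute)

lemma hcomp_nonzero: "p \<noteq> 0 \<Longrightarrow> \<exists>j\<ge>0. hcomp j p \<noteq> 0"
proof -
  assume "p \<noteq> 0"
  then obtain m where "lookup p m \<noteq> 0" by (metis lookup_zero poly_mapping_eqI)
  then have "lookup (hcomp (mdeg m) p) m \<noteq> 0" by (simp only: lookup_hcomp) simp
  then show ?thesis by (metis lookup_zero of_nat_0_le_iff)
qed

subsection \<open>Derivations\<close>

lemma pdiff_superset:
  assumes "finite A" "keys p \<subseteq> A"
  shows "pdiff i p = (\<Sum>m\<in>A. single (m - single i 1)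
     (of_nat (lookup m i) * lookup p m))"
  unfolding pdiff_def using assms
  by (intro sum.mono_neutral_left) (auto simp: in_keys_iff)

lemma pdiff_add: "pdiff i (p + q) = pdiff i p + pdiff i q"
proof -
  let ?A = "keys p \<union> keys q"
  have "keys (p + q) \<subseteq> ?A" by (rule keys_add)
  then show ?thesis
    by (simp add: pdiff_superset[of ?A] lookup_add single_add distrib_left sum.distrib)
qed

lemma pdiff_single: "pdiff i (single m c)
    = single (m - single i 1) (of_nat (lookup m i) * c)"
  by (subst pdiff_superset[of "{m}"]) auto

text \<open>For a positive exponent the truncated subtraction commutes with adding \<open>n\<close>;
  for exponent zero both coefficients vanish.\<close>

lemma pdiff_single_mult_single:
  fixes a b :: "'a::field" and m n :: "3 \<Rightarrow>\<^sub>0 nat"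
  shows "single (m - single i 1) (of_nat (lookup m i) * a) * single n b
    = single (m + n - single i 1) (of_nat (lookup m i) * (a * b))"
proof (cases "lookup m i = 0")
  case False
  then have "m - single i 1 + n = m + n - single i 1"
    by (intro poly_mapping_eqI) (auto simp: lookup_add lookup_minus lookup_single when_def)
  then show ?thesis by (simp add: mult_single mult.assoc)
qed simp

lemma pdiff_mult: "pdiff i (p * q) = pdiff i p * q + p * pdiff i q"
proof (induction p rule: poly3_monomial_induct)
  case (single m a)
  show ?case
  proof (induction q rule: poly3_monomial_induct)
    case (single n b)
    have 1: "single m a * pdiff i (single n b) =
      single (m + n - single i 1) (of_nat (lookup n i) * (a * b))"
      using pdiff_single_mult_single[of n i b m a]
      by (simp only: pdiff_single mult.commute add.commute mult.left_commute)
    have "pdiff i (single m a * single n b) =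
       single (m + n - single i 1) (of_nat (lookup m i) * (a * b)) +
       single (m + n - single i 1) (of_nat (lookup n i) * (a * b))"
      by (simp only: mult_single pdiff_single lookup_add of_nat_add distrib_right single_add)
    then show ?case
      by (simp only: 1) (simp only: pdiff_single pdiff_single_mult_single)
  next
    case (add p q)
    then show ?case by (simp add: pdiff_add distrib_left)
  qed
next
  case (add p q)
  then show ?case by (simp add: pdiff_add distrib_right)
qed

lemma pdiff_0: "pdiff i 0 = 0"
  by (simp add: pdiff_def)

lemma pdiff_const [simp]: "pdiff i (const c) = 0"
  by (simp add: const_def pdiff_single)

lemma pdiff_1 [simp]: "pdiff i 1 = 0"
  using pdiff_const[of i 1] by simp

lemma pdiff_X [simp]: "pdiff i (X j) = (if i = j then 1 else 0)"
  by (auto simp: X_def pdiff_single lookup_single when_def)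

lemma pdiff_sum: "pdiff i (sum f A) = (\<Sum>x\<in>A. pdiff i (f x))"
  by (induction A rule: infinite_finite_induct) (simp_all add: pdiff_add pdiff_0)

lemma pdiff_forms: "p \<in> forms j \<Longrightarrow> pdiff i p \<in> forms (j - 1)"
proof -
  assume p: "p \<in> forms j"
  have "single (m - single i 1)
      (of_nat (lookup m i) * lookup p m) \<in> forms (j - 1)" if "m \<in> keys p" for m
  proof (cases "lookup m i = 0")
    case False
    then have "m - single i 1 + single i 1 = m"
      by (intro poly_mapping_eqI) (auto simp: lookup_add lookup_minus lookup_single when_def)
    then have "mdeg m = mdeg (m - single i 1) + 1"
      using mdeg_add[of "m - single i 1" "single i 1"]
      by (simp add: lookup_single when_def)
    moreover have "mdeg m = j" using p that by (simp add: forms_def)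
    ultimately show ?thesis by (intro single_in_forms) simp
  qed simp
  then show ?thesis unfolding pdiff_def by (intro forms_sum) auto
qed

subsection \<open>Linear forms\<close>

definition lf :: "'a::field ^ 3 \<Rightarrow> 'a poly3" where
  "lf m = (\<Sum>i\<in>UNIV. const (m $ i) * X i)"

lemma lf_in_forms [simp]: "lf m \<in> forms 1"
  unfolding lf_def by (intro forms_sum forms_const_mult X_in_forms)

lemma eval_lf: "eval (lf m) v = (\<Sum>i\<in>UNIV. m $ i * v $ i)"
  by (simp add: lf_def eval_sum)

lemma sub_lf: "sub h (lf m) = (\<Sum>i\<in>UNIV. const (m $ i) * h i)"
  by (simp add: lf_def const_hom.insertion_hom)

lemma pdiff_lf [simp]: "pdiff i (lf m) = const (m $ i)"
proof -
  have "pdiff i (lf m) = (\<Sum>j\<in>UNIV. if j = i then const (m $ i) else 0)"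
    unfolding lf_def pdiff_sum by (rule sum.cong) (auto simp: pdiff_mult)
  then show ?thesis by simp
qed

lemma single_nat_inj: "single i (1::nat) = single j 1 \<longleftrightarrow> i = j"
proof
  assume "single i (1::nat) = single j 1"
  then have "lookup (single i (1::nat)) j = 1" by simp
  then show "i = j" by (auto simp: lookup_single when_def split: if_splits)
qed simp

lemma lin_coeffs_lf [simp]: "lin_coeffs (lf m) = m"
proof -
  have "lookup (lf m) (single i 1) = (\<Sum>j\<in>UNIV. if j = i then m $ i else 0)" for i
    unfolding lf_def lookup_sum
    by (rule sum.cong) (auto simp: X_def const_def mult_single lookup_single single_nat_inj[simplified])
  then show ?thesis by (simp add: lin_coeffs_def vec_eq_iff)
qed

lemma lf_eq_iff [simp]: "lf m = lf n \<longleftrightarrow> m = n"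
  by (metis lin_coeffs_lf)

lemma lf_0 [simp]: "lf 0 = 0"
  by (simp add: lf_def)

lemma lf_eq_0_iff [simp]: "lf m = 0 \<longleftrightarrow> m = 0"
  by (metis lf_0 lf_eq_iff)

lemma lf_add: "lf (m + n) = lf m + lf n"
  by (simp add: lf_def const_add distrib_right sum.distrib)

lemma lf_diff: "lf (m - n) = lf m - lf n"
  by (simp add: lf_def const_diff left_diff_distrib sum_subtractf)

lemma lf_scale: "lf (c *s m) = const c * lf m"
  unfolding lf_def sum_distrib_left
  by (rule sum.cong) (simp_all only: vector_smult_component const_mult mult.assoc)

lemma lf_axis: "lf (axis i 1) = X i"
proof -
  have "lf (axis i 1) = (\<Sum>j\<in>UNIV. if j = i then X i else 0)"
    unfolding lf_def by (rule sum.cong) (auto simp: axis_def)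
  then show ?thesis by simp
qed

lemma mdeg_1:
  assumes "mdeg m = 1"
  shows "\<exists>i. m = single i 1"
proof -
  from assms have s: "(\<Sum>i\<in>UNIV. lookup m i) = 1" by linarith
  then obtain i where "lookup m i = 1" "\<forall>j\<in>UNIV. j \<noteq> i \<longrightarrow> lookup m j = 0"
    by (subst (asm) sum_eq_1_iff) auto
  then have "m = single i 1"
    by (intro poly_mapping_eqI) (auto simp: lookup_single when_def)
  then show ?thesis ..
qed

lemma lf_lin_coeffs: "l \<in> forms 1 \<Longrightarrow> lf (lin_coeffs l) = l"
proof (rule poly_mapping_eqI)
  fix m
  assume l: "l \<in> forms 1"
  show "lookup (lf (lin_coeffs l)) m = lookup l m"
  proof (cases "mdeg m = 1")
    case True
    then obtain i where "m = single i 1" using mdeg_1 by blast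
    moreover have "lin_coeffs (lf (lin_coeffs l)) $ i = lin_coeffs l $ i" by simp
    ultimately show ?thesis by (simp add: lin_coeffs_def)
  next
    case False
    then show ?thesis using l lf_in_forms[of "lin_coeffs l"] unfolding forms_iff by metis
  qed
qed

lemma forms_1_iff: "l \<in> forms 1 \<longleftrightarrow> (\<exists>m. l = lf m)"
  by (metis lf_in_forms lf_lin_coeffs)

subsection \<open>Unique factorization\<close>

text \<open>\<open>H\<close> is a gcd. Coprimality of the cofactors is recorded as a cancellation
  law, a form that can be transported to \<open>'a poly3\<close> and is directly the one used
  later.\<close>

lemma ufd_split_ring:
  fixes F G :: "'b::ufd"
  assumes "F \<noteq> 0"
  obtains H F' G' where "F = H * F'" "G = H * G'" "\<And>w. F' dvd G' * w \<Longrightarrow> F' dvd w"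
proof -
  define H where "H = some_gcd F G"
  have "H dvd F" unfolding H_def by (rule some_gcd.gcd_dvd1)
  then obtain F' where F': "F = H * F'" by (rule dvdE)
  have "H dvd G" unfolding H_def by (rule some_gcd.gcd_dvd2)
  then obtain G' where G': "G = H * G'" by (rule dvdE)
  have "H \<noteq> 0" using assms F' by auto
  define K where "K = some_gcd F' G'"
  have "K dvd F'" "K dvd G'" unfolding K_def by (rule some_gcd.gcd_dvd1, rule some_gcd.gcd_dvd2)
  then have "H * K dvd F" "H * K dvd G" unfolding F' G' by (simp_all add: mult_dvd_mono)
  \<comment> \<open>\<open>H * K\<close> is a common divisor of \<open>F\<close> and
    \<open>G\<close>, so it divides the gcd \<open>H\<close>; hence \<open>K\<close> is a
    unit.\<close>
  then have "H * K dvd H * 1" unfolding H_def mult_1_right by (rule some_gcd.gcd_greatest)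
  then have K: "K dvd 1" using \<open>H \<noteq> 0\<close> by (simp only: dvd_mult_cancel_left) simp
  have "F' dvd w" if "F' dvd G' * w" for w
  proof -
    have "F' dvd K * w" unfolding K_def by (rule some_gcd.gcd_greatest_mult) (use that in auto)
    also have "K * w dvd 1 * w" using K by (rule mult_dvd_mono) simp
    finally show ?thesis by simp
  qed
  then show thesis using that[OF F' G'] by blast
qed

section \<open>The isomorphism of S with iterated univariate polynomials\<close>

definition poly_const :: "'a::field \<Rightarrow> 'a poly poly poly" where
  "poly_const c = [:[:[:c:]:]:]"

text \<open>The nesting is K[x3][x2][x1]: index 1 is the outermost variable, and the remaining index
  3 (equal to 0 in the type) the innermost.\<close>

definition poly_var :: "3 \<Rightarrow> 'a::field poly poly poly" where
  "poly_var i = (if i = 1 then [:0, 1:] else if i = 2 then [:[:0, 1:]:] else [:[:[:0, 1:]:]:])"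

global_interpretation poly_hom: coeff_hom poly_const
  by unfold_locales (simp_all add: poly_const_def)

definition to_poly :: "'a::field poly3 \<Rightarrow> 'a poly poly poly" where
  "to_poly = insertion poly_const poly_var"

lemma to_poly_hom: "to_poly (p + q) = to_poly p + to_poly q" "to_poly (p * q) = to_poly p * to_poly q"
  "to_poly (const c) = poly_const c" "to_poly (X i) = poly_var i" "to_poly 0 = 0"
  by (simp_all add: to_poly_def poly_hom.insertion_add poly_hom.insertion_mult)

lemma const_pCons_power: "[:p:] ^ n = [:p ^ n:]"
  by (induction n) (simp_all add: mult.commute)

lemma to_poly_single: "to_poly (single m c)
    = monom (monom (monom c (lookup m 3)) (lookup m 2)) (lookup m 1)"
proof -
  have *: "mono3 m poly_var = monom (monom (monom 1 (lookup m 3)) (lookup m 2)) (lookup m 1)"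
    unfolding UNIV_3 by (simp add: poly_var_def const_pCons_power monom_altdef)
  show ?thesis
    unfolding to_poly_def poly_hom.insertion_single * by (simp add: poly_const_def smult_monom)
qed

lemma coeff_to_poly: "coeff (coeff (coeff (to_poly p) (lookup m 1)) (lookup m 2)) (lookup m 3)
    = lookup p m"
proof (induction p rule: poly3_monomial_induct)
  case (single m' c)
  have "m' = m \<longleftrightarrow> (\<forall>i. lookup m' i = lookup m i)"
    by (metis poly_mapping_eqI)
  then have "m' = m \<longleftrightarrow> lookup m' 1 = lookup m 1 \<and>
      lookup m' 2 = lookup m 2 \<and> lookup m' 3 = lookup m 3"
    by (simp only: forall_3)
  then show ?case by (auto simp: to_poly_single lookup_single when_def)
next
  case (add p q)
  then show ?case by (simp add: to_poly_hom lookup_add)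
qed

lemma to_poly_inj: "to_poly p = to_poly q \<Longrightarrow> p = q"
  using coeff_to_poly by (metis poly_mapping_eqI)

lemma to_poly_surj: "\<exists>p :: 'a::field poly3. P = to_poly p"
proof -
  let ?S = "range (to_poly :: 'a poly3 \<Rightarrow> _)"
  have add: "P + Q \<in> ?S" if PQ: "P \<in> ?S" "Q \<in> ?S" for P Q
  proof -
    obtain p q :: "'a poly3" where "P = to_poly p" "Q = to_poly q" using PQ by blast
    then show ?thesis by (intro range_eqI[of _ _ "p + q"]) (simp only: to_poly_hom)
  qed
  have mult: "P * Q \<in> ?S" if PQ: "P \<in> ?S" "Q \<in> ?S" for P Q
  proof -
    obtain p q :: "'a poly3" where "P = to_poly p" "Q = to_poly q" using PQ by blast
    then show ?thesis by (intro range_eqI[of _ _ "p * q"]) (simp only: to_poly_hom)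
  qed
  have const: "poly_const c \<in> ?S" for c by (rule range_eqI[of _ _ "const c"]) (simp only: to_poly_hom)
  have var: "poly_var i \<in> ?S" for i by (rule range_eqI[of _ _ "X i"]) (simp only: to_poly_hom)
  have zero: "0 \<in> ?S" by (rule range_eqI[of _ _ 0]) (simp only: to_poly_hom)
  have three: "[:[:r:]:] \<in> ?S" for r :: "'a poly"
  proof (induction r)
    case (pCons a r)
    have eq: "[:[:pCons a r:]:] = poly_const a + poly_var 3 * [:[:r:]:]"
      by (simp add: poly_const_def poly_var_def)
    show ?case unfolding eq by (intro add mult const var pCons.IH)
  qed (simp add: zero)
  have two: "[:q:] \<in> ?S" for q :: "'a poly poly"
  proof (induction q)
    case (pCons r q)
    have eq: "[:pCons r q:] = [:[:r:]:] + poly_var 2 * [:q:]"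
      by (simp add: poly_var_def)
    show ?case unfolding eq by (intro add mult three var pCons.IH)
  qed (simp add: zero)
  have "P \<in> ?S"
  proof (induction P)
    case (pCons q P)
    have eq: "pCons q P = [:q:] + poly_var 1 * P" by (simp add: poly_var_def)
    show ?case unfolding eq by (intro add mult two var pCons.IH)
  qed (simp add: zero)
  then show ?thesis by blast
qed

lemma to_poly_dvd: "to_poly p dvd to_poly q \<longleftrightarrow> p dvd q"
proof
  assume "to_poly p dvd to_poly q"
  then obtain R where "to_poly q = to_poly p * R" by (rule dvdE)
  moreover obtain r where "R = to_poly r" using to_poly_surj by blast
  ultimately have "to_poly q = to_poly (p * r)" by (simp only: to_poly_hom)
  then have "q = p * r" by (rule to_poly_inj)
  then show "p dvd q" by simp
next
  assume "p dvd q"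
  then obtain r where "q = p * r" by (rule dvdE)
  then show "to_poly p dvd to_poly q" by (simp add: to_poly_hom)
qed

lemma ufd_split:
  fixes F G :: "'a::field poly3"
  assumes "F \<noteq> 0"
  obtains H F' G' where "F = H * F'" "G = H * G'" "\<And>w. F' dvd G' * w \<Longrightarrow> F' dvd w"
proof -
  have "to_poly F \<noteq> 0" using to_poly_inj[of F 0] assms by (auto simp: to_poly_hom)
  then obtain H F' G' where P: "to_poly F = H * F'" "to_poly G = H * G'" "\<And>w. F' dvd G' * w \<Longrightarrow> F' dvd w"
    using ufd_split_ring[of "to_poly F" "to_poly G"] by blast
  obtain h f' g' where e: "H = to_poly h" "F' = to_poly f'" "G' = to_poly g'" using to_poly_surj by metis
  show thesis
  proof (rule that)
    show "F = h * f'" "G = h * g'" by (rule to_poly_inj, simp only: P e to_poly_hom)+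
    fix w assume "f' dvd g' * w"
    then have "to_poly f' dvd to_poly (g' * w)" by (simp only: to_poly_dvd)
    then have "F' dvd G' * to_poly w" by (simp only: e to_poly_hom)
    then have "F' dvd to_poly w" by (rule P(3))
    then show "f' dvd w" by (simp only: e to_poly_dvd)
  qed
qed

subsection \<open>Dimensions of quotient spaces\<close>

global_interpretation vs: vector_space "\<lambda>c p. const c * p :: 'a::field poly3"
  by unfold_locales (simp_all add: const_add const_mult algebra_simps)

declare vs.scale_scale [simp del]

text \<open>The witness condition inside \<open>quotient_dim\<close> without the cardinality. Since
  \<open>quotient_dim\<close> is a definite description, every dimension is computed by exhibiting
  such a basis and applying \<open>quotient_dim_eq\<close>.\<close>

definition quotient_basis :: "'a::field poly3 set \<Rightarrow> 'a poly3 set \<Rightarrow> 'a poly3 set \<Rightarrow> bool" where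
  "quotient_basis V W B \<longleftrightarrow> B \<subseteq> V \<and> finite B \<and>
     (\<forall>v\<in>V. \<exists>c. v - (\<Sum>b\<in>B. const (c b) * b) \<in> W) \<and>
     (\<forall>c. (\<Sum>b\<in>B. const (c b) * b) \<in> W \<longrightarrow> (\<forall>b\<in>B. c b = 0))"

text \<open>Each \<open>b\<close> is congruent modulo \<open>W\<close> to a combination
  \<open>g b\<close> of \<open>B'\<close>. Independence modulo \<open>W\<close> makes
  \<open>g\<close> injective with linearly independent image in the span of \<open>B'\<close>, so
  the exchange lemma bounds its size.\<close>

lemma quotient_card_le:
  assumes W: "vs.subspace W" and B: "quotient_basis V W B" and B': "quotient_basis V W B'"
  shows "card B \<le> card B'"
proof -
  have fin: "finite B" "finite B'" and "B \<subseteq> V"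
    and ind: "\<And>c. (\<Sum>b\<in>B. const (c b) * b) \<in> W \<Longrightarrow> \<forall>b\<in>B. c b = 0"
    using B B' by (auto simp: quotient_basis_def)
  then have "\<forall>b\<in>B. \<exists>c. b - (\<Sum>b'\<in>B'. const (c b') * b') \<in> W"
    using B' unfolding quotient_basis_def by blast
  from bchoice[OF this] obtain c where c: "\<And>b. b \<in> B \<Longrightarrow> b - (\<Sum>b'\<in>B'. const (c b b') * b') \<in> W"
    by blast
  define g where "g b = (\<Sum>b'\<in>B'. const (c b b') * b')" for b
  have gind: "\<forall>b\<in>B. a b = 0" if "(\<Sum>b\<in>B. const (a b) * g b) = 0" for a
  proof (rule ind)
    have "(\<Sum>b\<in>B. const (a b) * b) = (\<Sum>b\<in>B. const (a b) * (b - g b))"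
      using that by (simp add: right_diff_distrib sum_subtractf)
    also have "\<dots> \<in> W" using c unfolding g_def
      by (intro vs.subspace_sum[OF W] vs.subspace_scale[OF W]) auto
    finally show "(\<Sum>b\<in>B. const (a b) * b) \<in> W" .
  qed
  have inj: "inj_on g B"
  proof (rule inj_onI, rule ccontr)
    fix x y assume xy: "x \<in> B" "y \<in> B" "g x = g y" "x \<noteq> y"
    let ?a = "\<lambda>b. if b = x then 1 else if b = y then - 1 else (0::'a)"
    have "(\<Sum>b\<in>B. const (?a b) * g b) = (\<Sum>b\<in>{x,y}. const (?a b) * g b)"
      using fin xy by (intro sum.mono_neutral_right) auto
    also have "\<dots> = 0" using xy by (simp add: const_uminus)
    finally show False using gind[of ?a] xy by fastforce
  qed
  have "vs.independent (g ` B)"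
  proof (rule vs.independent_if_scalars_zero)
    fix f x assume "(\<Sum>x\<in>g ` B. const (f x) * x) = 0" "x \<in> g ` B"
    then show "f x = 0"
      using gind[of "f \<circ> g"] by (auto simp: sum.reindex[OF inj])
  qed (use fin in simp)
  moreover have "g ` B \<subseteq> vs.span B'"
    unfolding g_def by (intro image_subsetI vs.span_sum vs.span_scale) (rule vs.span_base)
  ultimately have "card (g ` B) \<le> card B'"
    using vs.independent_span_bound fin by blast
  then show ?thesis by (simp add: card_image[OF inj])
qed

lemma quotient_dim_alt: "quotient_dim V W = (THE n. \<exists>B. quotient_basis V W B \<and> card B = n)"
  unfolding quotient_dim_def quotient_basis_def
  by (intro arg_cong[of _ _ The] ext ex_cong1) (simp only: conj_ac)

lemma quotient_dim_eq:
  assumes "vs.subspace W" "quotient_basis V W B"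
  shows "quotient_dim V W = card B"
  unfolding quotient_dim_alt
proof (rule the_equality)
  show "\<exists>B'. quotient_basis V W B' \<and> card B' = card B" using assms(2) by blast
next
  fix n
  assume "\<exists>B'. quotient_basis V W B' \<and> card B' = n"
  then obtain B' where B': "quotient_basis V W B'" "card B' = n" by blast
  show "n = card B"
    using quotient_card_le[OF assms(1) assms(2) B'(1)] quotient_card_le[OF assms(1) B'(1) assms(2)] B'(2)
    by linarith
qed

text \<open>A basis \<open>B1\<close> of \<open>W\<close> extends to a basis \<open>B2\<close> of
  \<open>V\<close>, and the added vectors represent the quotient. The set \<open>T\<close> makes
  \<open>B2\<close> finite.\<close>

lemma quotient_basis_exists:
  assumes V: "vs.subspace V" and W: "vs.subspace W" and WV: "W \<subseteq> V"
    and T: "finite T" "V \<subseteq> vs.span T"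
  shows "\<exists>B. quotient_basis V W B"
proof -
  obtain B1 where B1: "B1 \<subseteq> W" "vs.independent B1" "W \<subseteq> vs.span B1"
    using vs.maximal_independent_subset by blast
  obtain B2 where B2: "B1 \<subseteq> B2" "B2 \<subseteq> V" "vs.independent B2" "V \<subseteq> vs.span B2"
    using vs.maximal_independent_subset_extend[of B1 V] B1 WV by blast
  have fin: "finite B2" using vs.independent_span_bound[OF T(1) B2(3)] B2(2) T(2) by blast
  have fin1: "finite B1" using fin B2(1) finite_subset by blast
  have W': "W = vs.span B1"
    using B1 W by (simp add: vs.span_minimal subset_antisym)
  have split: "sum f B2 = sum f B1 + sum f (B2 - B1)" for f :: "'a poly3 \<Rightarrow> 'a poly3"
    using sum.subset_diff[OF B2(1) fin, of f] by (simp add: add.commute)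
  show ?thesis
  proof (intro exI[of _ "B2 - B1"], unfold quotient_basis_def, intro conjI ballI allI impI)
    show "B2 - B1 \<subseteq> V" using B2 by blast
    show "finite (B2 - B1)" using fin by simp
  next
    fix v assume "v \<in> V"
    then have "v \<in> vs.span B2" using B2 by blast
    then obtain c where "v = (\<Sum>b\<in>B2. const (c b) * b)"
      using vs.span_finite[OF fin] by auto
    then have "v - (\<Sum>b\<in>B2 - B1. const (c b) * b) = (\<Sum>b\<in>B1. const (c b) * b)"
      by (simp add: split)
    also have "\<dots> \<in> vs.span B1" by (intro vs.span_sum vs.span_scale vs.span_base)
    finally show "\<exists>c. v - (\<Sum>b\<in>B2 - B1. const (c b) * b) \<in> W" using W' by auto
  next
    fix c b
    assume a: "(\<Sum>b\<in>B2 - B1. const (c b) * b) \<in> W" "b \<in> B2 - B1"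
    then obtain e where e: "(\<Sum>b\<in>B2 - B1. const (c b) * b) = (\<Sum>b\<in>B1. const (e b) * b)"
      using vs.span_finite[OF fin1] W' by auto
    let ?h = "\<lambda>b. if b \<in> B1 then - e b else c b"
    have "(\<Sum>b\<in>B2. const (?h b) * b) = - (\<Sum>b\<in>B1. const (e b) * b) + (\<Sum>b\<in>B2 - B1. const (c b) * b)"
      unfolding split by (simp add: const_uminus sum_negf)
    then have "(\<Sum>b\<in>B2. const (?h b) * b) = 0" using e by simp
    then have "?h b = 0"
      using vs.independentD[OF B2(3) fin subset_refl, of ?h b] a by blast
    then show "c b = 0" using a by auto
  qed
qed

text \<open>Additivity of dimension along a chain of subspaces. The bases are disjoint because a
  common element would lie in \<open>U\<close>, against independence modulo
  \<open>U\<close>.\<close>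

lemma quotient_basis_trans:
  assumes U: "vs.subspace U" and UV: "U \<subseteq> V" and WU: "W \<subseteq> U"
    and B1: "quotient_basis V U B1" and B2: "quotient_basis U W B2"
  shows "quotient_basis V W (B1 \<union> B2) \<and> card (B1 \<union> B2) = card B1 + card B2"
proof -
  have fin: "finite B1" "finite B2" and sub: "B1 \<subseteq> V" "B2 \<subseteq> U"
    and ind1: "\<And>c. (\<Sum>b\<in>B1. const (c b) * b) \<in> U \<Longrightarrow> \<forall>b\<in>B1. c b = 0"
    and ind2: "\<And>c. (\<Sum>b\<in>B2. const (c b) * b) \<in> W \<Longrightarrow> \<forall>b\<in>B2. c b = 0"
    using B1 B2 by (auto simp: quotient_basis_def)
  have disj: "B1 \<inter> B2 = {}"
  proof (rule ccontr)
    assume "B1 \<inter> B2 \<noteq> {}"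
    then obtain x where x: "x \<in> B1" "x \<in> B2" by blast
    have "(\<Sum>b\<in>B1. const (if b = x then 1 else 0) * b) = (\<Sum>b\<in>{x}. const (if b = x then 1 else 0) * b)"
      using fin x by (intro sum.mono_neutral_right) auto
    then have "(\<Sum>b\<in>B1. const (if b = x then 1 else 0) * b) \<in> U" using x sub by auto
    from ind1[OF this] x show False by auto
  qed
  have inU: "(\<Sum>b\<in>B2. const (c b) * b) \<in> U" for c
    using sub by (intro vs.subspace_sum[OF U] vs.subspace_scale[OF U]) auto
  have "quotient_basis V W (B1 \<union> B2)"
    unfolding quotient_basis_def
  proof (intro conjI ballI allI impI)
    show "B1 \<union> B2 \<subseteq> V" "finite (B1 \<union> B2)" using sub UV fin by auto
  next
    fix v assume "v \<in> V"
    then obtain c where "v - (\<Sum>b\<in>B1. const (c b) * b) \<in> U" using B1 by (auto simp: quotient_basis_def)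
    then obtain e where e: "v - (\<Sum>b\<in>B1. const (c b) * b) - (\<Sum>b\<in>B2. const (e b) * b) \<in> W"
      using B2 by (auto simp: quotient_basis_def)
    let ?h = "\<lambda>b. if b \<in> B1 then c b else e b"
    have "(\<Sum>b\<in>B1 \<union> B2. const (?h b) * b) = (\<Sum>b\<in>B1. const (?h b) * b) + (\<Sum>b\<in>B2. const (?h b) * b)"
      by (rule sum.union_disjoint[OF fin disj])
    also have "(\<Sum>b\<in>B2. const (?h b) * b) = (\<Sum>b\<in>B2. const (e b) * b)"
      by (rule sum.cong) (use disj in auto)
    finally have "v - (\<Sum>b\<in>B1 \<union> B2. const (?h b) * b) \<in> W" using e by (simp add: algebra_simps)
    then show "\<exists>c. v - (\<Sum>b\<in>B1 \<union> B2. const (c b) * b) \<in> W" by (rule exI[of _ ?h])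
  next
    fix c b
    assume s: "(\<Sum>b\<in>B1 \<union> B2. const (c b) * b) \<in> W" and b: "b \<in> B1 \<union> B2"
    have s': "(\<Sum>b\<in>B1 \<union> B2. const (c b) * b) = (\<Sum>b\<in>B1. const (c b) * b) + (\<Sum>b\<in>B2. const (c b) * b)"
      by (rule sum.union_disjoint[OF fin disj])
    have "(\<Sum>b\<in>B1 \<union> B2. const (c b) * b) - (\<Sum>b\<in>B2. const (c b) * b) \<in> U"
      using s WU inU by (intro vs.subspace_diff[OF U]) auto
    then have c1: "\<forall>b\<in>B1. c b = 0" using ind1 s' by simp
    then have "(\<Sum>b\<in>B2. const (c b) * b) \<in> W" using s s' by simp
    then show "c b = 0" using ind2 c1 b by blast
  qed
  then show ?thesis using card_Un_disjoint[OF fin disj] by blast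
qed

text \<open>The hypotheses make \<open>T\<close> induce an isomorphism from \<open>V/W\<close> onto
  \<open>V'/W'\<close>. It is applied to multiplication by a form.\<close>

lemma quotient_basis_image:
  assumes B: "quotient_basis V W B" and V: "vs.subspace V" and W': "vs.subspace W'"
    and add: "\<And>p q. T (p + q) = T p + T q" and scale: "\<And>c p. T (const c * p) = const c * T p"
    and TV: "\<And>v. v \<in> V \<Longrightarrow> T v \<in> V'" and TW: "\<And>v. v \<in> V \<Longrightarrow> T v \<in> W' \<longleftrightarrow> v \<in> W"
    and surj: "\<And>v'. v' \<in> V' \<Longrightarrow> \<exists>v\<in>V. v' - T v \<in> W'"
  shows "quotient_basis V' W' (T ` B) \<and> card (T ` B) = card B"
proof -
  have fin: "finite B" and sub: "B \<subseteq> V"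
    and ind: "\<And>c. (\<Sum>b\<in>B. const (c b) * b) \<in> W \<Longrightarrow> \<forall>b\<in>B. c b = 0"
    using B by (auto simp: quotient_basis_def)
  have T0: "T 0 = 0" using scale[of 0 0] by simp
  have Tsum: "T (\<Sum>b\<in>C. const (c b) * b) = (\<Sum>b\<in>C. const (c b) * T b)" for c C
    by (induction C rule: infinite_finite_induct) (simp_all add: T0 add scale)
  have Tdiff: "T (p - q) = T p - T q" for p q
    using add[of "p - q" q] by simp
  have inV: "(\<Sum>b\<in>B. const (c b) * b) \<in> V" for c
    using sub by (intro vs.subspace_sum[OF V] vs.subspace_scale[OF V]) auto
  have ind': "\<forall>b\<in>B. c b = 0" if "(\<Sum>b\<in>B. const (c b) * T b) \<in> W'" for c
  proof -
    have "T (\<Sum>b\<in>B. const (c b) * b) \<in> W'" using that by (simp only: Tsum)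
    then show ?thesis using ind TW[OF inV] by blast
  qed
  have inj: "inj_on T B"
  proof (rule inj_onI, rule ccontr)
    fix x y assume xy: "x \<in> B" "y \<in> B" "T x = T y" "x \<noteq> y"
    let ?a = "\<lambda>b. if b = x then 1 else if b = y then - 1 else (0::'a)"
    have "(\<Sum>b\<in>B. const (?a b) * T b) = (\<Sum>b\<in>{x,y}. const (?a b) * T b)"
      using fin xy by (intro sum.mono_neutral_right) auto
    also have "\<dots> = 0" using xy by (simp add: const_uminus)
    finally show False using ind'[of ?a] xy vs.subspace_0[OF W'] by fastforce
  qed
  have "quotient_basis V' W' (T ` B)"
    unfolding quotient_basis_def
  proof (intro conjI ballI allI impI)
    show "T ` B \<subseteq> V'" "finite (T ` B)" using TV sub fin by auto
  next
    fix v' assume "v' \<in> V'"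
    then obtain v where v: "v \<in> V" "v' - T v \<in> W'" using surj by blast
    then obtain c where c: "v - (\<Sum>b\<in>B. const (c b) * b) \<in> W" using B by (auto simp: quotient_basis_def)
    have "T (v - (\<Sum>b\<in>B. const (c b) * b)) \<in> W'"
      using c v inV by (subst TW) (auto intro: vs.subspace_diff[OF V])
    then have "(v' - T v) + (T v - (\<Sum>b\<in>B. const (c b) * T b)) \<in> W'"
      using v by (intro vs.subspace_add[OF W']) (simp_all add: Tdiff Tsum)
    then have "v' - (\<Sum>b\<in>T ` B. const (c (inv_into B T b)) * b) \<in> W'"
      by (simp add: sum.reindex[OF inj] inj)
    then show "\<exists>c. v' - (\<Sum>b\<in>T ` B. const (c b) * b) \<in> W'"
      by (intro exI[of _ "\<lambda>b. c (inv_into B T b)"])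
  next
    fix c b'
    assume "(\<Sum>b\<in>T ` B. const (c b) * b) \<in> W'" "b' \<in> T ` B"
    then show "c b' = 0" using ind'[of "c \<circ> T"] by (auto simp: sum.reindex[OF inj])
  qed
  then show ?thesis using card_image[OF inj] by blast
qed

section \<open>Dimensions of the graded pieces\<close>

lemma subspace_forms: "vs.subspace (forms j)"
  by (auto simp: vs.subspace_def forms_add forms_const_mult)

lemma subspace_ideal: "ideal.subspace I \<Longrightarrow> vs.subspace I"
  by (auto simp: vs.subspace_def ideal.subspace_def)

lemma subspace_ideal_forms: "ideal.subspace I \<Longrightarrow> vs.subspace (I \<inter> forms j)"
  by (intro vs.subspace_inter subspace_ideal subspace_forms)

text \<open>The dimension of \<open>[S]_j\<close>. The polynomial vanishes at -1 and -2 by itself,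
  so the case distinction corrects it only from -3 downwards.\<close>

definition sdim :: "int \<Rightarrow> int" where
  "sdim j = (if j < 0 then 0 else (j + 1) * (j + 2) div 2)"

lemma sdim_double: "2 * sdim j = (if j < 0 then 0 else (j + 1) * (j + 2))"
  by (simp add: sdim_def)

lemma mdeg_3: "mdeg m = int (lookup m 1 + lookup m 2 + lookup m 3)"
  by (simp add: sum_3)

lemma card_monomials:
  "finite {m. mdeg m = int n} \<and> int (card {m. mdeg m = int n}) = sdim (int n)"
proof -
  let ?S = "SIGMA a:{..n}. {..n - a}"
  let ?f = "\<lambda>(a, b). single (1::3) a + single 2 b + single 3 (n - a - b)"
  have bij: "bij_betw ?f ?S {m. mdeg m = int n}"
  proof (rule bij_betw_byWitness[where f' = "\<lambda>m. (lookup m 1, lookup m 2)"])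
    show "\<forall>a\<in>?S. (\<lambda>m. (lookup m 1, lookup m 2)) (?f a) = a"
      by (auto simp: lookup_add lookup_single when_def)
    show "\<forall>m\<in>{m. mdeg m = int n}. ?f (lookup m 1, lookup m 2) = m"
    proof
      fix m assume "m \<in> {m. mdeg m = int n}"
      then have n: "n = lookup m 1 + lookup m 2 + lookup m 3"
        unfolding mdeg_3 by simp
      show "?f (lookup m 1, lookup m 2) = m"
      proof (rule poly_mapping_eqI)
        fix k :: 3
        show "lookup (?f (lookup m 1, lookup m 2)) k = lookup m k"
          using exhaust_3[of k] by (auto simp: n lookup_add lookup_single when_def)
      qed
    qed
    show "?f ` ?S \<subseteq> {m. mdeg m = int n}"
      unfolding mdeg_3 by (auto simp: lookup_add lookup_single when_def)
    show "(\<lambda>m. (lookup m 1, lookup m 2)) ` {m. mdeg m = int n} \<subseteq> ?S"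
      unfolding mdeg_3 by auto
  qed
  have "card ?S = (\<Sum>a\<le>n. n - a + 1)" by simp
  also have "\<dots> = (\<Sum>a\<le>n. a + 1)"
    by (rule sum.reindex_bij_witness[of _ "\<lambda>a. n - a" "\<lambda>a. n - a"]) auto
  finally have "card ?S = (\<Sum>a\<le>n. a + 1)" .
  moreover have "2 * (\<Sum>a\<le>n. a + 1) = (n + 1) * (n + 2)"
    by (induction n) simp_all
  ultimately have "2 * card ?S = (n + 1) * (n + 2)" by simp
  from arg_cong[OF this, of int] have "2 * int (card ?S) = (int n + 1) * (int n + 2)"
    by (simp only: of_nat_mult of_nat_add of_nat_1 of_nat_numeral)
  then have "int (card ?S) = sdim (int n)"
    using sdim_double[of "int n"] by (simp only: of_nat_less_0_iff if_False)
  moreover have "finite ?S" by simp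
  ultimately show ?thesis
    using bij_betw_same_card[OF bij] bij_betw_finite[OF bij] by (simp only: simp_thms)
qed

lemma quotient_basis_forms: "\<exists>B. quotient_basis (forms j) {0} B \<and> int (card B) = sdim j"
proof (cases "j < 0")
  case True
  then show ?thesis by (intro exI[of _ "{}"]) (simp add: quotient_basis_def forms_neg sdim_def)
next
  case False
  then obtain n where n: "j = int n" by (metis nonneg_int_cases not_less)
  let ?M = "{m. mdeg m = int n}" and ?s = "\<lambda>m. single m (1::'a)"
  have M: "finite ?M" "int (card ?M) = sdim j" using card_monomials[of n] n by auto
  have inj: "inj_on ?s ?M"
  proof (rule inj_onI)
    fix m m' assume "?s m = ?s m'"
    then have "lookup (?s m) m' = 1" by simp
    then show "m = m'" by (auto simp: lookup_single when_def split: if_splits)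
  qed
  have look: "lookup (\<Sum>b\<in>?s ` ?M. const (c b) * b) m = (if m \<in> ?M then c (?s m) else 0)" for c m
  proof -
    have "(\<Sum>b\<in>?s ` ?M. const (c b) * b) = (\<Sum>m\<in>?M. single m (c (?s m)))"
      unfolding sum.reindex[OF inj] by (rule sum.cong) (simp_all add: const_def mult_single)
    then show ?thesis
      using M(1) by (simp add: lookup_sum lookup_single when_def del: of_nat_sum)
  qed
  have "quotient_basis (forms j) {0} (?s ` ?M)"
    unfolding quotient_basis_def
  proof (intro conjI ballI allI impI)
    show "?s ` ?M \<subseteq> forms j" using n by (auto intro: single_in_forms simp del: of_nat_sum)
    show "finite (?s ` ?M)" using M by simp
  next
    fix v :: "'a poly3" assume v: "v \<in> forms j"
    let ?c = "\<lambda>b. lookup v (inv_into ?M ?s b)"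
    have "v = (\<Sum>b\<in>?s ` ?M. const (?c b) * b)"
    proof (rule poly_mapping_eqI)
      fix m
      have "(if m \<in> ?M then ?c (?s m) else 0) = lookup v m"
      proof (cases "m \<in> ?M")
        case True
        then show ?thesis by (simp only: if_True inv_into_f_f[OF inj])
      next
        case False
        then have "lookup v m = 0" using v n unfolding forms_iff by blast
        then show ?thesis using False by (simp only: if_False)
      qed
      then show "lookup v m = lookup (\<Sum>b\<in>?s ` ?M. const (?c b) * b) m"
        using look[of ?c m] by (simp only:)
    qed
    then have "v - (\<Sum>b\<in>?s ` ?M. const (?c b) * b) \<in> {0}" by simp
    then show "\<exists>c. v - (\<Sum>b\<in>?s ` ?M. const (c b) * b) \<in> {0}" by (rule exI[of _ ?c])
  next
    fix c b assume "(\<Sum>b\<in>?s ` ?M. const (c b) * b) \<in> {0}" "b \<in> ?s ` ?M"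
    then obtain m where "m \<in> ?M" "b = ?s m" "lookup (\<Sum>b\<in>?s ` ?M. const (c b) * b) m = 0"
      by auto
    then show "c b = 0" using look[of c m] by simp
  qed
  then show ?thesis using M card_image[OF inj] by metis
qed

lemma quotient_basis_forms_exists:
  assumes V: "vs.subspace V" "V \<subseteq> forms j" and W: "vs.subspace W" "W \<subseteq> V"
  shows "\<exists>B. quotient_basis V W B"
proof -
  obtain T :: "'a poly3 set" where T: "quotient_basis (forms j) {0} T" using quotient_basis_forms by blast
  then have "finite T" by (simp add: quotient_basis_def)
  have "V \<subseteq> vs.span T"
  proof
    fix v assume "v \<in> V"
    then have "v \<in> forms j" using V(2) by blast
    moreover have "\<forall>v\<in>forms j. \<exists>c. v - (\<Sum>b\<in>T. const (c b) * b) \<in> {0}"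
      using T by (simp add: quotient_basis_def)
    ultimately have "\<exists>c. v - (\<Sum>b\<in>T. const (c b) * b) \<in> {0}" by (intro bspec[where x = v])
    then obtain c where "v - (\<Sum>b\<in>T. const (c b) * b) \<in> {0}" ..
    then have v: "v = (\<Sum>b\<in>T. const (c b) * b)" by simp
    show "v \<in> vs.span T"
      unfolding v by (intro vs.span_sum vs.span_scale) (rule vs.span_base)
  qed
  then show ?thesis using quotient_basis_exists V W \<open>finite T\<close> by blast
qed

subsection \<open>Hilbert functions\<close>

lemma subspace_0: "vs.subspace {0}"
  by (auto simp: vs.subspace_def)

lemma hilb_eq:
  assumes "vs.subspace W" "I \<inter> forms j = W" "quotient_basis (forms j) W B"
  shows "hilb I j = int (card B)"
  using quotient_dim_eq[OF assms(1,3)] assms(2) by (simp add: hilb_def)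

lemma hilb_trivial: "I \<inter> forms j = {0} \<Longrightarrow> hilb I j = sdim j"
  using quotient_basis_forms hilb_eq[OF subspace_0] by metis

abbreviation mult_image :: "'a::field poly3 \<Rightarrow> int \<Rightarrow> 'a poly3 set" where
  "mult_image F j \<equiv> (\<lambda>p. p * F) ` forms j"

lemma mult_image_subset: "F \<in> forms a \<Longrightarrow> mult_image F (j - a) \<subseteq> forms j"
  using forms_mult[of _ "j - a" F a] by auto

lemma subspace_mult_image: "vs.subspace (mult_image F j)"
  unfolding vs.subspace_def
proof (intro conjI ballI allI)
  show "0 \<in> mult_image F j" by (rule image_eqI[of _ _ 0]) simp_all
next
  fix x y assume "x \<in> mult_image F j" "y \<in> mult_image F j"
  then obtain p q where "p \<in> forms j" "q \<in> forms j" "x = p * F" "y = q * F" by blast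
  then show "x + y \<in> mult_image F j"
    by (intro image_eqI[of _ _ "p + q"]) (simp_all add: forms_add distrib_right)
next
  fix c x assume "x \<in> mult_image F j"
  then obtain p where "p \<in> forms j" "x = p * F" by blast
  then show "const c * x \<in> mult_image F j"
    by (intro image_eqI[of _ _ "const c * p"]) (simp_all add: forms_const_mult mult.assoc)
qed

text \<open>Multiplication by \<open>F\<close> is injective, so the multiples of \<open>F\<close> in
  degree \<open>j\<close> have dimension \<open>sdim (j - a)\<close>; the rest is
  additivity.\<close>

lemma quotient_basis_principal:
  assumes F: "F \<in> forms a" "F \<noteq> 0"
  shows "\<exists>B. quotient_basis (forms j) (mult_image F (j - a)) B \<and> int (card B) = sdim j - sdim (j - a)"
proof -
  obtain B0 :: "'a poly3 set" where B0: "quotient_basis (forms (j - a)) {0} B0" "int (card B0) = sdim (j - a)"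
    using quotient_basis_forms by blast
  have B1: "quotient_basis (mult_image F (j - a)) {0} ((\<lambda>p. p * F) ` B0) \<and> card ((\<lambda>p. p * F) ` B0) = card B0"
    by (rule quotient_basis_image[OF B0(1) subspace_forms subspace_0])
      (use F in \<open>auto simp: distrib_right mult.assoc\<close>)
  obtain B where B: "quotient_basis (forms j) (mult_image F (j - a)) B"
    using quotient_basis_forms_exists[OF subspace_forms subset_refl subspace_mult_image mult_image_subset] F by blast
  have "quotient_basis (forms j) {0} (B \<union> (\<lambda>p. p * F) ` B0)"
    "card (B \<union> (\<lambda>p. p * F) ` B0) = card B + card B0"
    using quotient_basis_trans[OF subspace_mult_image mult_image_subset[OF F(1)] _ B conjunct1[OF B1]] B1
      vs.subspace_0[OF subspace_mult_image] by auto
  moreover obtain B' :: "'a poly3 set" where "quotient_basis (forms j) {0} B'" "int (card B') = sdim j"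
    using quotient_basis_forms by blast
  ultimately have "int (card B) + int (card B0) = sdim j"
    using quotient_dim_eq[OF subspace_0] by (metis of_nat_add)
  then show ?thesis using B B0 by auto
qed

lemma hilb_principal:
  assumes "F \<in> forms a" "F \<noteq> 0" "I \<inter> forms j = mult_image F (j - a)"
  shows "hilb I j = sdim j - sdim (j - a)"
proof -
  obtain B where "quotient_basis (forms j) (mult_image F (j - a)) B" "int (card B) = sdim j - sdim (j - a)"
    using quotient_basis_principal[OF assms(1,2)] by blast
  then show ?thesis using hilb_eq[OF subspace_mult_image assms(3)] by simp
qed

text \<open>Multiplication by \<open>G\<close> induces an isomorphism from \<open>S/(F)\<close> in
  degree \<open>j - b\<close> onto \<open>I/(F)\<close> in degree \<open>j\<close>; its injectivity
  is the hypothesis \<open>coprime\<close>.\<close>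

lemma hilb_complete_intersection:
  assumes I: "ideal.subspace I" and F: "F \<in> forms a" "F \<noteq> 0" and G: "G \<in> forms b"
    and Ij: "I \<inter> forms j = {p * F + q * G | p q. p \<in> forms (j - a) \<and> q \<in> forms (j - b)}"
    and coprime: "\<And>p q. p * F = q * G \<Longrightarrow> F dvd q"
  shows "hilb I j = sdim j - sdim (j - a) - sdim (j - b) + sdim (j - a - b)"
proof -
  let ?V = "I \<inter> forms j" and ?W = "mult_image F (j - a)"
  obtain B0 where B0: "quotient_basis (forms (j - b)) (mult_image F (j - b - a)) B0"
    "int (card B0) = sdim (j - b) - sdim (j - b - a)"
    using quotient_basis_principal[OF F] by blast
  have WV: "?W \<subseteq> ?V"
  proof
    fix x assume "x \<in> ?W"
    then obtain p where "p \<in> forms (j - a)" "x = p * F + 0 * G" by auto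
    then show "x \<in> ?V" unfolding Ij by (intro CollectI exI[of _ p] exI[of _ 0]) simp
  qed
  have B1: "quotient_basis ?V ?W ((\<lambda>q. q * G) ` B0) \<and> card ((\<lambda>q. q * G) ` B0) = card B0"
  proof (rule quotient_basis_image[OF B0(1) subspace_forms subspace_mult_image])
    fix q :: "'a poly3"
    assume q: "q \<in> forms (j - b)"
    then show "q * G \<in> ?V" unfolding Ij by (intro CollectI exI[of _ 0] exI[of _ q]) simp
    show "q * G \<in> ?W \<longleftrightarrow> q \<in> mult_image F (j - b - a)"
    proof
      assume "q * G \<in> ?W"
      then obtain p where "p \<in> forms (j - a)" "p * F = q * G" by auto
      then obtain m where m: "q = F * m" using coprime by blast
      have "hcomp (j - b) q = hcomp (j - b - a) m * F"
        using hcomp_mult[OF F(1), of "j - b" m] m by (simp add: mult.commute)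
      then have "q = hcomp (j - b - a) m * F" using q by (simp add: hcomp_forms)
      then show "q \<in> mult_image F (j - b - a)" by auto
    next
      assume "q \<in> mult_image F (j - b - a)"
      then obtain m where m: "m \<in> forms (j - b - a)" "q = m * F" by blast
      have "m * G \<in> forms (j - b - a + b)" using m G by (intro forms_mult)
      then show "q * G \<in> ?W" using m by (intro image_eqI[of _ _ "m * G"]) (simp_all add: mult_ac diff_diff_eq2)
    qed
  next
    fix v assume "v \<in> ?V"
    then obtain p q where "p \<in> forms (j - a)" "q \<in> forms (j - b)" "v = p * F + q * G" unfolding Ij by blast
    then show "\<exists>q\<in>forms (j - b). v - q * G \<in> ?W" by (intro bexI[of _ q] image_eqI[of _ _ p]) simp_all
  qed (simp_all add: distrib_right mult.assoc)
  obtain B where B: "quotient_basis (forms j) ?V B"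
    using quotient_basis_forms_exists[OF subspace_forms subset_refl subspace_ideal_forms[OF I]] by blast
  have "quotient_basis (forms j) ?W (B \<union> (\<lambda>q. q * G) ` B0)"
    "card (B \<union> (\<lambda>q. q * G) ` B0) = card B + card B0"
    using quotient_basis_trans[OF subspace_ideal_forms[OF I] Int_lower2 WV B conjunct1[OF B1]] B1 by auto
  moreover obtain B' where "quotient_basis (forms j) ?W B'" "int (card B') = sdim j - sdim (j - a)"
    using quotient_basis_principal[OF F] by blast
  ultimately have "int (card B) + int (card B0) = sdim j - sdim (j - a)"
    using quotient_dim_eq[OF subspace_mult_image] by (metis of_nat_add)
  then show ?thesis
    using hilb_eq[OF subspace_ideal_forms[OF I] refl B] B0(2) by (simp add: diff_diff_eq add.commute)
qed

text \<open>The polynomial \<open>(i + 1) * (i + 2)\<close> is invariant under the reflection of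
  \<open>i\<close> to \<open>-3 - i\<close>. Hence \<open>sdim i + sdim (-3 - i)\<close> is half of
  it for every integer \<open>i\<close>, which is Serre duality on the plane. The mixed second
  difference of that polynomial with steps \<open>a\<close> and \<open>b\<close> is the constant
  \<open>2 * (a * b)\<close>.\<close>

lemma sdim_complete_intersection:
  fixes a b j :: int
  defines "h \<equiv> \<lambda>j. sdim j - sdim (j - a) - sdim (j - b) + sdim (j - a - b)"
  shows "h j + h (a + b - 3 - j) = a * b"
proof -
  have p: "2 * (sdim i + sdim (- 3 - i)) = (i + 1) * (i + 2)" for i
  proof -
    consider "i \<ge> 0" | "i = -1" | "i = -2" | "i \<le> -3" by linarith
    then show ?thesis
    proof cases
      case 1
      then have "sdim (- 3 - i) = 0" by (simp add: sdim_def)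
      then show ?thesis using 1 sdim_double[of i] by simp
    next
      case 4
      then have "sdim i = 0" by (simp add: sdim_def)
      moreover have "2 * sdim (- 3 - i) = (- 3 - i + 1) * (- 3 - i + 2)"
        using 4 sdim_double[of "- 3 - i"] by simp
      moreover have "- 3 - i + 1 = - (i + 2)" "- 3 - i + 2 = - (i + 1)" by simp_all
      then have "(- 3 - i + 1) * (- 3 - i + 2) = (i + 1) * (i + 2)"
        by (simp only: minus_mult_minus mult.commute)
      ultimately show ?thesis by simp
    qed (simp_all add: sdim_def)
  qed
  \<comment> \<open>Reflection turns the four arguments occurring in
    \<open>h (a + b - 3 - j)\<close> into those of \<open>h j\<close>, with matching signs.\<close>
  have e: "- 3 - (a + b - 3 - j) = j - a - b" "- 3 - (a + b - 3 - j - a) = j - b"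
    "- 3 - (a + b - 3 - j - b) = j - a" "- 3 - (a + b - 3 - j - a - b) = j" by simp_all
  have lin: "2 * (y4 - y3 - y2 + y1 + (x1 - x2 - x3 + x4)) = P1 - P2 - P3 + P4"
    if "2 * (x1 + y1) = P1" "2 * (x2 + y2) = P2" "2 * (x3 + y3) = P3" "2 * (x4 + y4) = P4"
    for x1 x2 x3 x4 y1 y2 y3 y4 P1 P2 P3 P4 :: int
    using that by simp
  have "2 * (h j + h (a + b - 3 - j)) =
      (a + b - 3 - j + 1) * (a + b - 3 - j + 2) - (a + b - 3 - j - a + 1) * (a + b - 3 - j - a + 2)
      - (a + b - 3 - j - b + 1) * (a + b - 3 - j - b + 2) + (a + b - 3 - j - a - b + 1) * (a + b - 3 - j - a - b + 2)"
    using p[of "a + b - 3 - j"] p[of "a + b - 3 - j - a"] p[of "a + b - 3 - j - b"] p[of "a + b - 3 - j - a - b"]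
    unfolding e h_def by (rule lin)
  also have "\<dots> = 2 * (a * b)" by (simp add: algebra_simps)
  finally show ?thesis by simp
qed

subsection \<open>Ideals generated by linear forms\<close>

lemma const_power: "const (a ^ n) = const a ^ n"
  by (induction n) (simp_all add: const_mult)

lemma const_prod: "const (prod f A) = (\<Prod>x\<in>A. const (f x))"
  by (induction A rule: infinite_finite_induct) (simp_all add: const_mult)

definition dot :: "'a::field ^ 3 \<Rightarrow> 'a ^ 3 \<Rightarrow> 'a" where
  "dot m v = (\<Sum>i\<in>UNIV. m $ i * v $ i)"

lemma eval_lf_dot [simp]: "eval (lf m) v = dot m v"
  by (simp add: eval_lf dot_def)

lemma dot_simps:
  "dot (m + n) v = dot m v + dot n v" "dot (m - n) v = dot m v - dot n v" "dot (c *s m) v = c * dot m v"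
  "dot m (c *s v) = c * dot m v" "dot 0 v = 0" "dot (axis i 1) v = v $ i"
proof -
  have "dot (axis i 1) v = (\<Sum>j\<in>UNIV. if j = i then v $ i else 0)"
    unfolding dot_def by (rule sum.cong) (auto simp: axis_def)
  then show "dot (axis i 1) v = v $ i" by simp
qed (simp_all add: dot_def algebra_simps sum.distrib sum_subtractf sum_distrib_left)

text \<open>The relation is not symmetric: \<open>0\<close> is proportional to every
  \<open>m\<close>. For \<open>m \<noteq> 0\<close> its negation says that \<open>m\<close> and
  \<open>n\<close> are linearly independent.\<close>

definition proportional :: "'a::field ^ 3 \<Rightarrow> 'a ^ 3 \<Rightarrow> bool" where
  "proportional m n \<longleftrightarrow> (\<exists>c. n = c *s m)"

lemma span_single: "p \<in> ideal.span {x} \<longleftrightarrow> x dvd p"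
  by (auto simp: ideal.span_singleton dvd_def mult.commute)

lemma span_pair: "p \<in> ideal.span {x, y} \<longleftrightarrow> (\<exists>a b. p = a * x + b * y)"
proof -
  have "p \<in> ideal.span {x, y} \<longleftrightarrow> (\<exists>a. y dvd p - a * x)"
    by (subst ideal.span_breakdown_eq) (simp only: span_single)
  also have "\<dots> \<longleftrightarrow> (\<exists>a b. p = a * x + b * y)"
    by (auto simp: dvd_def algebra_simps)
  finally show ?thesis .
qed

definition piv :: "'a::field ^ 3 \<Rightarrow> 3" where
  "piv m = (SOME i. m $ i \<noteq> 0)"

lemma piv: "m \<noteq> 0 \<Longrightarrow> m $ piv m \<noteq> 0"
  unfolding piv_def by (rule someI_ex) (auto simp: vec_eq_iff)

text \<open>Restriction to the line \<open>lf m = 0\<close>, realised as an endomorphism that eliminates a variable.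
  For \<open>m = 0\<close> the choice in \<open>piv\<close> is arbitrary.\<close>

definition kill :: "'a::field ^ 3 \<Rightarrow> 'a poly3 \<Rightarrow> 'a poly3" where
  "kill m = sub (\<lambda>i. if i = piv m then X i - const (inverse (m $ piv m)) * lf m else X i)"

lemmas kill_hom = const_hom.insertion_hom[where h = "\<lambda>i. if i = piv m then X i - const (inverse (m $ piv m)) * lf m else X i"
  for m, folded kill_def]

lemma kill_const [simp]: "kill m (const c) = const c" "kill m 0 = 0" "kill m 1 = 1"
  by (simp_all add: kill_def)

lemma kill_X: "kill m (X i) = (if i = piv m then X i - const (inverse (m $ piv m)) * lf m else X i)"
  by (simp add: kill_def)

lemma kill_lf: "kill m (lf n) = lf (n - (n $ piv m / m $ piv m) *s m)"
proof -
  have "kill m (lf n) = (\<Sum>i\<in>UNIV. const (n $ i) * (if i = piv m then X i - const (inverse (m $ piv m)) * lf m else X i))"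
    unfolding kill_def sub_lf ..
  also have "\<dots> = (\<Sum>i\<in>UNIV. const (n $ i) * X i - (if i = piv m then const (n $ piv m * inverse (m $ piv m)) * lf m else 0))"
    by (rule sum.cong) (auto simp: const_mult algebra_simps)
  also have "\<dots> = lf n - const (n $ piv m * inverse (m $ piv m)) * lf m"
    by (simp add: sum_subtractf lf_def)
  finally show ?thesis by (simp add: lf_diff lf_scale divide_inverse)
qed

lemma dvd_diff_kill: "lf m dvd p - kill m p"
proof -
  have "p - sub (\<lambda>i. if i = piv m then X i - const (inverse (m $ piv m)) * lf m else X i) p \<in> ideal.span {lf m}"
    by (rule diff_sub_in_ideal) (simp add: ideal.span_zero span_single)
  then show ?thesis by (simp add: kill_def span_single)
qed

lemma kill_self: "m \<noteq> 0 \<Longrightarrow> kill m (lf m) = 0"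
  using piv[of m] by (simp add: kill_lf)

lemma lf_dvd_iff: "m \<noteq> 0 \<Longrightarrow> lf m dvd p \<longleftrightarrow> kill m p = 0"
proof
  assume m: "m \<noteq> 0" and "lf m dvd p"
  then show "kill m p = 0" by (auto simp: dvd_def kill_hom kill_self)
next
  assume "kill m p = 0"
  then show "lf m dvd p" using dvd_diff_kill[of m p] by simp
qed

lemma lf_dvd_lf_iff: "m \<noteq> 0 \<Longrightarrow> lf m dvd lf n \<longleftrightarrow> proportional m n"
proof
  assume "m \<noteq> 0" "lf m dvd lf n"
  then show "proportional m n" by (auto simp: lf_dvd_iff kill_lf proportional_def)
next
  assume "proportional m n"
  then show "lf m dvd lf n" by (auto simp: proportional_def lf_scale)
qed

text \<open>\<open>kill m\<close> is a ring homomorphism into a domain whose kernel is generated by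
  \<open>lf m\<close>.\<close>

lemma prime_lf: "m \<noteq> 0 \<Longrightarrow> prime_elem (lf m)"
  unfolding prime_elem_def by (auto simp: lf_dvd_iff kill_hom)

text \<open>Coprimality as cancellation of \<open>z\<close>. The factors may be repeated or
  associated, which covers powers and also the restrictions of several concurrent lines to one
  line.\<close>

lemma prime_prod_strip:
  fixes z :: "'b::idom"
  assumes "finite A" "\<And>x. x \<in> A \<Longrightarrow> prime_elem (q x)" "\<And>x. x \<in> A \<Longrightarrow> \<not> q x dvd z"
    and "prod q A dvd z * w"
  shows "prod q A dvd w"
  using assms
proof (induction A arbitrary: w rule: finite_induct)
  case (insert x A)
  have "q x * prod q A dvd z * w" using insert.prems(3) insert.hyps by simp
  then have "prod q A dvd z * w" by (rule dvd_mult_right)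
  from insert.IH[OF insert.prems(1)[OF insertI2] insert.prems(2)[OF insertI2] this]
  obtain u where u: "w = prod q A * u" by (rule dvdE)
  have "q a \<noteq> 0" if "a \<in> A" for a
    using insert.prems(1)[OF insertI2[OF that]] by (simp add: prime_elem_def)
  then have nz: "prod q A \<noteq> 0" using insert.hyps(1) by simp
  have "q x * prod q A dvd (z * u) * prod q A"
    using \<open>q x * prod q A dvd z * w\<close> unfolding u by (simp only: mult_ac)
  then have "q x dvd z * u" using nz by (simp only: dvd_mult_cancel_right) simp
  then have "q x dvd u"
    using insert.prems(2)[OF insertI1] prime_elem_dvd_mult_iff[OF insert.prems(1)[OF insertI1]] by simp
  then show ?case using insert.hyps u by (simp add: mult_dvd_mono mult.commute)
qed simp

lemma prime_power_strip:
  fixes z :: "'b::idom"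
  assumes "prime_elem q" "\<not> q dvd z" "q ^ k dvd z * w"
  shows "q ^ k dvd w"
  using prime_prod_strip[of "{..<k}" "\<lambda>_. q" z w] assms by simp

lemma kill_nonzero: "m \<noteq> 0 \<Longrightarrow> \<not> proportional m n \<Longrightarrow> kill m (lf n) \<noteq> 0"
  using lf_dvd_iff lf_dvd_lf_iff by blast

lemma prime_kill: "m \<noteq> 0 \<Longrightarrow> \<not> proportional m n \<Longrightarrow> prime_elem (kill m (lf n))"
proof -
  assume "m \<noteq> 0" "\<not> proportional m n"
  then have "lf (n - (n $ piv m / m $ piv m) *s m) \<noteq> 0" unfolding kill_lf[symmetric] by (rule kill_nonzero)
  then show ?thesis unfolding kill_lf by (intro prime_lf) (simp only: lf_eq_0_iff simp_thms)
qed

text \<open>Modulo \<open>lf m\<close> the ideal becomes principal, so membership turns into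
  divisibility on the line \<open>lf m = 0\<close>.\<close>

lemma span_power_iff:
  assumes m: "m \<noteq> 0"
  shows "p \<in> ideal.span {lf m, lf n ^ k} \<longleftrightarrow> kill m (lf n) ^ k dvd kill m p"
proof
  assume "p \<in> ideal.span {lf m, lf n ^ k}"
  then obtain a b where "p = a * lf m + b * lf n ^ k" by (auto simp: span_pair)
  then show "kill m (lf n) ^ k dvd kill m p" using m by (simp add: kill_hom kill_self)
next
  assume "kill m (lf n) ^ k dvd kill m p"
  then obtain q where q: "kill m p = kill m (lf n) ^ k * q" by (auto simp: dvd_def)
  obtain a where a: "p - kill m p = lf m * a" using dvd_diff_kill[of m p] by (auto simp: dvd_def)
  obtain b where b: "lf n ^ k - kill m (lf n ^ k) = lf m * b"
    using dvd_diff_kill[of m "lf n ^ k"] by (auto simp: dvd_def)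
  have "p = (a - b * q) * lf m + q * lf n ^ k"
    using a b q by (simp add: kill_hom algebra_simps)
  then show "p \<in> ideal.span {lf m, lf n ^ k}" by (auto simp: span_pair)
qed

text \<open>On the line \<open>lf m = 0\<close> the second generator is a power of a prime. Thus the
  ideal is primary with radical \<open>(lf m, lf n)\<close>.\<close>

lemma span_power_colon:
  assumes m: "m \<noteq> 0" and ind: "\<not> proportional m n"
    and q: "q \<notin> ideal.span {lf m, lf n}" and qw: "q * w \<in> ideal.span {lf m, lf n ^ k}"
  shows "w \<in> ideal.span {lf m, lf n ^ k}"
proof -
  have 1: "\<not> kill m (lf n) dvd kill m q"
    using q span_power_iff[OF m, of q n 1] by simp
  have 2: "kill m (lf n) ^ k dvd kill m q * kill m w"
    using qw by (simp add: span_power_iff m kill_hom)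
  show ?thesis
    using prime_power_strip[OF prime_kill[OF m ind] 1 2] by (simp add: span_power_iff m)
qed

text \<open>In the standard basis, a vector whose coordinate in \<open>v\<close> is nonzero is
  replaced by \<open>v\<close>. Then \<open>v, e2, e3\<close> and \<open>t, y, z\<close> are dual
  bases, the first equation expands the identity matrix, and \<open>lf y\<close>,
  \<open>lf z\<close> cut out the point \<open>v\<close>.\<close>

lemma dual_basis:
  fixes v :: "'a::field ^ 3"
  assumes "v \<noteq> 0"
  obtains t y z e2 e3 :: "'a ^ 3" where
    "\<And>i r. (if i = r then 1 else 0) = v $ i * t $ r + e2 $ i * y $ r + e3 $ i * z $ r"
    "dot t v = 1" "dot y v = 0" "dot z v = 0" "dot t e2 = 0" "dot y e2 = 1" "dot z e2 = 0"
    "dot t e3 = 0" "dot y e3 = 0" "dot z e3 = 1"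
proof -
  have ax: "axis i c $ r = (if r = i then c else 0)" for i r :: 3 and c :: 'a by (simp add: axis_def)
  note outer = that
  have step: thesis if ijk: "v $ i \<noteq> 0" "i \<noteq> j" "j \<noteq> k" "i \<noteq> k" for i j k :: 3
  proof -
    have exh: "r = i \<or> r = j \<or> r = k" for r
      using ijk exhaust_3[of i] exhaust_3[of j] exhaust_3[of k] exhaust_3[of r] by auto
    have UN: "UNIV = {i, j, k}" using exh by auto
    have S: "sum g UNIV = g i + g j + g k" for g :: "3 \<Rightarrow> 'a"
      unfolding UN using ijk by (simp add: add.assoc)
    show thesis
    proof (rule outer[where t = "axis i (1 / v $ i)" and y = "axis j 1 - axis i (v $ j / v $ i)"
          and z = "axis k 1 - axis i (v $ k / v $ i)" and ?e2.0 = "axis j 1" and ?e3.0 = "axis k 1"])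
      fix s r
      show "(if s = r then 1 else 0) = v $ s * axis i (1 / v $ i) $ r + axis j 1 $ s * (axis j 1 - axis i (v $ j / v $ i)) $ r
          + axis k 1 $ s * (axis k 1 - axis i (v $ k / v $ i)) $ r"
        using exh[of s] exh[of r] ijk by (auto simp: ax)
    qed (use ijk in \<open>auto simp: dot_def S ax\<close>)
  qed
  obtain i where "v $ i \<noteq> 0" using assms by (auto simp: vec_eq_iff)
  then show thesis
    using step[of 1 2 3] step[of 2 1 3] step[of 3 1 2] exhaust_3[of i] by auto
qed

lemma perp_expand:
  assumes "\<And>i r. (if i = r then 1 else 0) = v $ i * t $ r + e2 $ i * y $ r + e3 $ i * z $ (r::3)"
  shows "w = dot w v *s t + dot w e2 *s y + dot w e3 *s z"
proof (rule iffD2[OF vec_eq_iff], rule allI)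
  fix r
  have "w $ r = (\<Sum>i\<in>UNIV. w $ i * (if i = r then 1 else 0))"
    by (simp add: if_distrib[of "\<lambda>x. w $ _ * x"] cong: if_cong)
  also have "\<dots> = (\<Sum>i\<in>UNIV. w $ i * v $ i * t $ r + w $ i * e2 $ i * y $ r + w $ i * e3 $ i * z $ r)"
    unfolding assms by (simp add: algebra_simps)
  finally show "w $ r = (dot w v *s t + dot w e2 *s y + dot w e3 *s z) $ r"
    by (simp add: dot_def sum.distrib sum_distrib_right)
qed

text \<open>In coordinates dual to \<open>p\<close>, vectors orthogonal to \<open>p\<close> have two
  free components, and Cramer's rule with determinant \<open>\<Delta>\<close> solves for the
  coefficients.\<close>

lemma perp_span:
  assumes p: "p \<noteq> 0" and m: "m \<noteq> 0" "dot m p = 0" and n: "\<not> proportional m n" "dot n p = 0"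
    and w: "dot w p = 0"
  obtains \<alpha> \<beta> where "w = \<alpha> *s m + \<beta> *s n"
proof -
  obtain t y z e2 e3 :: "'a ^ 3" where
    dual: "\<And>i r. (if i = r then 1 else 0) = p $ i * t $ r + e2 $ i * y $ r + e3 $ i * z $ r"
    using dual_basis[OF p] by metis
  have ex: "u = dot u e2 *s y + dot u e3 *s z" if "dot u p = 0" for u
    using perp_expand[OF dual, of u] that by simp
  define m1 m2 n1 n2 w1 w2 where "m1 = dot m e2" "m2 = dot m e3" "n1 = dot n e2" "n2 = dot n e3"
    "w1 = dot w e2" "w2 = dot w e3"
  note defs = this
  have em: "m = m1 *s y + m2 *s z" and en: "n = n1 *s y + n2 *s z" and ew: "w = w1 *s y + w2 *s z"
    unfolding defs using ex m n w by blast+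
  define \<Delta> where "\<Delta> = m1 * n2 - m2 * n1"
  have D: "\<Delta> \<noteq> 0"
  proof
    assume 0: "\<Delta> = 0"
    have "m1 \<noteq> 0 \<or> m2 \<noteq> 0" using m(1) em by auto
    then have "n = (if m1 \<noteq> 0 then n1 / m1 else n2 / m2) *s m"
      using 0 unfolding \<Delta>_def by (subst en, subst em) (auto simp: vec_eq_iff field_simps)
    then show False using n(1) unfolding proportional_def by blast
  qed
  have "\<Delta> *s w = (w1 * n2 - w2 * n1) *s m + (m1 * w2 - m2 * w1) *s n"
    unfolding \<Delta>_def by (subst en, subst em, subst ew) (simp add: vec_eq_iff algebra_simps)
  then have "inverse \<Delta> *s (\<Delta> *s w) = inverse \<Delta> *s ((w1 * n2 - w2 * n1) *s m + (m1 * w2 - m2 * w1) *s n)" by simp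
  then have "w = (inverse \<Delta> * (w1 * n2 - w2 * n1)) *s m + (inverse \<Delta> * (m1 * w2 - m2 * w1)) *s n"
    using D by (simp add: vec_eq_iff algebra_simps)
  then show thesis by (rule that)
qed

text \<open>A suitable combination of two independent forms through \<open>p\<close> also vanishes
  at \<open>q\<close>. By symmetry of \<open>dot\<close> this gives both the line joining two points
  and the point common to two lines.\<close>

lemma perp_exists:
  fixes p q :: "'a::field ^ 3"
  assumes p: "p \<noteq> 0"
  obtains w where "w \<noteq> 0" "dot w p = 0" "dot w q = 0"
proof -
  obtain t y z e2 e3 :: "'a ^ 3" where
    d: "dot y p = 0" "dot z p = 0" "dot y e2 = 1" "dot z e2 = 0" "dot z e3 = 1" "dot y e3 = 0"
    using dual_basis[OF p] by metis
  show thesis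
  proof (cases "dot y q = 0")
    case True
    moreover have "y \<noteq> 0" using d(3) by (auto simp: dot_simps)
    ultimately show ?thesis using that d by blast
  next
    case False
    let ?w = "dot z q *s y - dot y q *s z"
    have "dot ?w e3 = - dot y q" using d by (simp add: dot_simps)
    moreover have "dot ?w e3 = 0" if "?w = 0" unfolding that by (rule dot_simps(5))
    ultimately have "?w \<noteq> 0" using False by force
    then show ?thesis using that[of ?w] d by (simp add: dot_simps)
  qed
qed

lemma sub_point_forms:
  assumes "g \<in> forms j"
  shows "sub (\<lambda>i. const (p $ i) * L) g = const (eval g p) * L ^ nat j"
proof -
  have "mono3 m (\<lambda>i. const (p $ i) * L) = const (mono3 m (($) p)) * L ^ nat j"
    if "m \<in> keys g" for m
  proof -
    have "mdeg m = j" using assms that unfolding forms_def by blast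
    from arg_cong[OF this, of nat] have "(\<Sum>i\<in>UNIV. lookup m i) = nat j"
      by (simp only: nat_int)
    then show ?thesis
      by (simp add: power_mult_distrib prod.distrib const_prod const_power flip: power_sum)
  qed
  then have "sub (\<lambda>i. const (p $ i) * L) g = (\<Sum>m\<in>keys g.
      const (lookup g m) * (const (mono3 m (($) p)) * L ^ nat j))"
    unfolding insertion_def by (intro sum.cong) auto
  also have "\<dots> = const (eval g p) * L ^ nat j"
    by (simp add: eval_def const_sum const_mult sum_distrib_right mult.assoc)
  finally show ?thesis .
qed

subsection \<open>Points and lines\<close>

lemma mem_proj_point: "w \<in> proj_point p \<longleftrightarrow> (\<exists>c. w = c *s p)"
  by (auto simp: proj_point_def vec.span_singleton)

lemma proj_point_P2 [simp]: "p \<noteq> 0 \<Longrightarrow> proj_point p \<in> P2"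
  by (auto simp: P2_def)

lemma proj_point_in_line: "p \<noteq> 0 \<Longrightarrow> proj_point p \<in> line_of (lf m) \<longleftrightarrow> dot m p = 0"
proof
  assume "p \<noteq> 0" "proj_point p \<in> line_of (lf m)"
  then have "eval (lf m) p = 0" using mem_proj_point[of p p] vec.scale_one[of p]
    unfolding line_of_def by (metis (mono_tags, lifting) mem_Collect_eq)
  then show "dot m p = 0" by simp
qed (auto simp: line_of_def mem_proj_point dot_simps)

text \<open>With \<open>t\<close> equal to 1 at \<open>p\<close>, replace each \<open>X i\<close> by
  \<open>p $ i\<close> times \<open>lf t\<close>. Every variable changes by a linear form vanishing
  at \<open>p\<close>, hence by a combination of \<open>lf m\<close> and \<open>lf n\<close>, while
  a form \<open>g\<close> becomes \<open>eval g p\<close> times a power of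
  \<open>lf t\<close>.\<close>

lemma point_ideal_eq:
  assumes p: "p \<noteq> 0" and m: "m \<noteq> 0" "dot m p = 0" and n: "\<not> proportional m n" "dot n p = 0"
  shows "point_ideal (proj_point p) = ideal.span {lf m, lf n}"
proof
  have lin: "lf w \<in> ideal.span {lf m, lf n}" if w: "dot w p = 0" for w
  proof -
    obtain \<alpha> \<beta> where "w = \<alpha> *s m + \<beta> *s n" using perp_span[OF p m n w] .
    then have "lf w = const \<alpha> * lf m + const \<beta> * lf n" by (simp add: lf_add lf_scale)
    then show ?thesis by (auto simp: span_pair)
  qed
  obtain t where t: "dot t p = 1" using dual_basis[OF p] by metis
  show "point_ideal (proj_point p) \<subseteq> ideal.span {lf m, lf n}"
    unfolding point_ideal_def
  proof (rule ideal.span_minimal[OF _ ideal.subspace_span], rule subsetI)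
    fix g assume "g \<in> {f. (\<exists>j. f \<in> forms j) \<and> (\<forall>v\<in>proj_point p. eval f v = 0)}"
    moreover have "p \<in> proj_point p" by (simp add: proj_point_def vec.span_base)
    ultimately obtain j where g: "g \<in> forms j" "eval g p = 0" by blast
    have "g - sub (\<lambda>i. const (p $ i) * lf t) g \<in> ideal.span {lf m, lf n}"
    proof (rule diff_sub_in_ideal)
      fix i
      have "X i - sub (\<lambda>i. const (p $ i) * lf t) (X i) = lf (axis i 1 - p $ i *s t)"
        by (simp add: lf_diff lf_scale lf_axis)
      then show "X i - sub (\<lambda>i. const (p $ i) * lf t) (X i) \<in> ideal.span {lf m, lf n}"
        using lin[of "axis i 1 - p $ i *s t"] t by (simp add: dot_simps)
    qed
    then show "g \<in> ideal.span {lf m, lf n}" using sub_point_forms[OF g(1)] g(2) by simp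
  qed
  show "ideal.span {lf m, lf n} \<subseteq> point_ideal (proj_point p)"
    unfolding point_ideal_def
  proof (rule ideal.span_mono, rule subsetI)
    fix g assume "g \<in> {lf m, lf n}"
    then show "g \<in> {f. (\<exists>j. f \<in> forms j) \<and> (\<forall>v\<in>proj_point p. eval f v = 0)}"
      using m n by (auto simp: mem_proj_point dot_simps intro!: exI[of _ 1])
  qed
qed

text \<open>Modulo \<open>x\<close>, each product of \<open>k\<close> elements of
  \<open>(x, y)\<close> is a multiple of \<open>y ^ k\<close>.\<close>

lemma span_insert_ideal_power:
  "ideal.span (insert x (ideal_power (ideal.span {x, y}) k)) = ideal.span {x, y ^ k}"
proof
  have "y ^ k \<in> ideal_power (ideal.span {x, y}) k"
  proof (induction k)
    case (Suc k)
    have "y \<in> ideal.span {x, y}" by (simp add: ideal.span_base)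
    with Suc have "y * y ^ k \<in> ideal.span {g * h | g h. g \<in> ideal.span {x, y} \<and> h \<in> ideal_power (ideal.span {x, y}) k}"
      by (intro ideal.span_base) blast
    then show ?case by simp
  qed simp
  then show "ideal.span {x, y ^ k} \<subseteq> ideal.span (insert x (ideal_power (ideal.span {x, y}) k))"
    by (intro ideal.span_mono) auto
  have "ideal_power (ideal.span {x, y}) k \<subseteq> ideal.span {x, y ^ k}"
  proof (induction k)
    case 0
    have "p = 0 * x + p * y ^ 0" for p :: "'a poly3" by simp
    then show ?case unfolding subset_iff span_pair by blast
  next
    case (Suc k)
    have "g * h \<in> ideal.span {x, y ^ Suc k}"
      if gh: "g \<in> ideal.span {x, y}" "h \<in> ideal_power (ideal.span {x, y}) k" for g h
    proof -
      obtain a b where g: "g = a * x + b * y" using gh(1) by (auto simp: span_pair)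
      have "h \<in> ideal.span {x, y ^ k}" using Suc gh(2) by blast
      then obtain c e where h: "h = c * x + e * y ^ k" by (auto simp: span_pair)
      have "g * h = (a * h + b * y * c) * x + (b * e) * y ^ Suc k"
        unfolding g h by (simp add: algebra_simps)
      then show ?thesis unfolding span_pair by blast
    qed
    then show ?case
      unfolding ideal_power.simps by (intro ideal.span_minimal[OF _ ideal.subspace_span]) blast
  qed
  then show "ideal.span (insert x (ideal_power (ideal.span {x, y}) k)) \<subseteq> ideal.span {x, y ^ k}"
    by (intro ideal.span_minimal[OF _ ideal.subspace_span]) (auto intro: ideal.span_base)
qed

lemma join_form:
  fixes p q :: "'a::field ^ 3"
  assumes "p \<noteq> 0" "q \<noteq> 0"
  obtains w where "join_form (proj_point p) (proj_point q) = lf w" "w \<noteq> 0" "dot w p = 0" "dot w q = 0"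
proof -
  let ?P = "\<lambda>l::'a poly3. l \<in> forms 1 \<and> l \<noteq> 0 \<and> proj_point p \<in> line_of l \<and> proj_point q \<in> line_of l"
  obtain u where u: "u \<noteq> 0" "dot u p = 0" "dot u q = 0" using perp_exists[OF assms(1), of q] .
  then have "?P (lf u)" using assms by (simp add: proj_point_in_line)
  then have *: "?P (join_form (proj_point p) (proj_point q))" unfolding join_form_def by (rule someI)
  then obtain w where "join_form (proj_point p) (proj_point q) = lf w" unfolding forms_1_iff by blast
  with * show thesis using that assms by (simp add: proj_point_in_line)
qed

text \<open>Any line through \<open>p\<close> that misses \<open>q\<close> can serve as the second
  generator beside the join \<open>w\<close>. The join comes from a choice, so \<open>w\<close> is
  obtained once, uniformly in \<open>k\<close>.\<close>

lemma fat_on_join_eq: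
  assumes p: "p \<noteq> 0" and q: "q \<noteq> 0" and n: "dot n p = 0" "dot n q \<noteq> 0"
  obtains w where "w \<noteq> 0" "dot w p = 0" "dot w q = 0" "\<not> proportional w n"
    "\<And>k. fat_on_join (proj_point p) (proj_point q) k = ideal.span {lf w, lf n ^ k}"
    "point_ideal (proj_point p) = ideal.span {lf w, lf n}"
proof -
  obtain w where w: "join_form (proj_point p) (proj_point q) = lf w" "w \<noteq> 0" "dot w p = 0" "dot w q = 0"
    using join_form[OF p q] .
  have np: "\<not> proportional w n" using n(2) w(4) by (auto simp: proportional_def dot_simps)
  have pi: "point_ideal (proj_point p) = ideal.span {lf w, lf n}"
    by (rule point_ideal_eq[OF p w(2,3) np n(1)])
  show thesis
    by (rule that[OF w(2,3,4) np _ pi]) (simp add: fat_on_join_def w(1) pi span_insert_ideal_power)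
qed

lemma is_line_defining_form:
  assumes "is_line L"
  obtains m where "m \<noteq> 0" "defining_form L = lf m" "L = line_of (lf m)"
proof -
  have "\<exists>l. l \<in> forms 1 \<and> l \<noteq> 0 \<and> L = line_of l" using assms by (auto simp: is_line_def)
  then have *: "defining_form L \<in> forms 1 \<and> defining_form L \<noteq> 0 \<and> L = line_of (defining_form L)"
    unfolding defining_form_def by (rule someI_ex)
  then obtain m where m: "defining_form L = lf m" unfolding forms_1_iff by blast
  have "lf m \<noteq> 0" "L = line_of (lf m)" using * unfolding m by blast+
  then show thesis using that[OF _ m] by (metis lf_0)
qed

lemma line_of_scale: "c \<noteq> 0 \<Longrightarrow> line_of (lf (c *s m)) = line_of (lf m)"
  by (simp add: line_of_def dot_simps)

subsection \<open>Derivations with polynomial coefficients\<close>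

text \<open>A vector \<open>s\<close> of polynomials stands for the derivation with these
  coefficients. \<open>app m s\<close> is its value on \<open>lf m\<close>, see
  \<open>der_lf\<close>; \<open>cvec e\<close> is the constant field along \<open>e\<close>, and
  \<open>evec\<close> is the Euler derivation.\<close>

definition app :: "'a::field ^ 3 \<Rightarrow> 'a poly3 ^ 3 \<Rightarrow> 'a poly3" where
  "app m s = (\<Sum>i\<in>UNIV. const (m $ i) * s $ i)"

definition der :: "'a::field poly3 ^ 3 \<Rightarrow> 'a poly3 \<Rightarrow> 'a poly3" where
  "der s p = (\<Sum>i\<in>UNIV. s $ i * pdiff i p)"

definition cvec :: "'a::field ^ 3 \<Rightarrow> 'a poly3 ^ 3" where
  "cvec e = (\<chi> i. const (e $ i))"

definition evec :: "'a::field poly3 ^ 3" where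
  "evec = (\<chi> i. X i)"

lemma app_vec: "app m (s + s') = app m s + app m s'" "app m (s - s') = app m s - app m s'"
  "app m (p *s s) = p * app m s" "app m 0 = 0"
  by (simp_all add: app_def sum_3 algebra_simps)

lemma app_form: "app (m + n) s = app m s + app n s" "app (m - n) s = app m s - app n s"
  "app (c *s m) s = const c * app m s"
  by (simp_all add: app_def sum_3 const_add const_diff const_mult algebra_simps)

lemma app_cvec [simp]: "app m (cvec e) = const (dot m e)"
  by (simp add: app_def cvec_def dot_def const_sum const_mult)

lemma app_evec [simp]: "app m evec = lf m"
  by (simp add: app_def evec_def lf_def)

lemma app_forms: "(\<And>i. s $ i \<in> forms j) \<Longrightarrow> app m s \<in> forms j"
  unfolding app_def by (intro forms_sum forms_const_mult)

lemma der_vec: "der (s + s') p = der s p + der s' p" "der (s - s') p = der s p - der s' p"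
  "der (q *s s) p = q * der s p" "der 0 p = 0"
  by (simp_all add: der_def sum_3 algebra_simps)

lemma der_lf [simp]: "der s (lf m) = app m s"
  by (simp add: der_def app_def mult.commute)

lemma der_mult: "der s (p * q) = der s p * q + p * der s q"
  by (simp add: der_def sum_3 pdiff_mult algebra_simps)

lemma der_1 [simp]: "der s 1 = 0"
  by (simp add: der_def)

lemma syz_iff: "s \<in> syz f \<longleftrightarrow> der s f = 0"
  by (simp add: syz_def der_def)

definition hvec :: "int \<Rightarrow> 'a::field poly3 ^ 3 \<Rightarrow> 'a poly3 ^ 3" where
  "hvec j s = (\<chi> i. hcomp j (s $ i))"

lemma hvec_in_forms [simp]: "hvec j s $ i \<in> forms j"
  by (simp add: hvec_def)

lemma app_hvec: "app m (hvec j s) = hcomp j (app m s)"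
  by (simp add: app_def hvec_def hcomp_sum hcomp_const_mult)

lemma der_hvec: "p \<in> forms e \<Longrightarrow> der (hvec j s) p = hcomp (j + (e - 1)) (der s p)"
  by (simp add: der_def hvec_def hcomp_sum hcomp_mult[OF pdiff_forms])

lemma euler_prod:
  "finite B \<Longrightarrow> der evec (\<Prod>x\<in>B. lf (n x)) = of_nat (card B) * (\<Prod>x\<in>B. lf (n x))"
  by (induction B rule: finite_induct) (simp_all add: der_mult algebra_simps)

lemma prod_dvd_der:
  "finite B \<Longrightarrow> (\<And>x. x \<in> B \<Longrightarrow> lf (n x) dvd app (n x) s) \<Longrightarrow> (\<Prod>x\<in>B. lf (n x)) dvd der s (\<Prod>x\<in>B. lf (n x))"
proof (induction B rule: finite_induct)
  case (insert x B)
  then have "lf (n x) * (\<Prod>x\<in>B. lf (n x)) dvd app (n x) s * (\<Prod>x\<in>B. lf (n x))"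
    "lf (n x) * (\<Prod>x\<in>B. lf (n x)) dvd lf (n x) * der s (\<Prod>x\<in>B. lf (n x))"
    by (simp_all add: mult_dvd_mono)
  then show ?case using insert.hyps by (simp add: der_mult)
qed simp

lemma lf_dvd_prod_iff:
  assumes "finite B" "m \<noteq> 0"
  shows "lf m dvd (\<Prod>x\<in>B. lf (n x)) \<longleftrightarrow> (\<exists>x\<in>B. proportional m (n x))"
proof -
  have "lf m dvd (\<Prod>x\<in>B. lf (n x)) \<longleftrightarrow> (\<exists>x\<in>B. kill m (lf (n x)) = 0)"
    using assms by (simp add: lf_dvd_iff kill_hom)
  then show ?thesis by (simp only: lf_dvd_iff[OF assms(2), symmetric] lf_dvd_lf_iff[OF assms(2)])
qed

section \<open>Coordinates adapted to the point \<open>v\<close>\<close>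

locale coordinates =
  fixes v t y z e2 e3 :: "'a::field ^ 3"
  assumes delta: "\<And>i r. (if i = r then 1 else 0) = v $ i * t $ r + e2 $ i * y $ r + e3 $ i * z $ r"
    and dots: "dot t v = 1" "dot y v = 0" "dot z v = 0" "dot t e2 = 0" "dot y e2 = 1" "dot z e2 = 0"
      "dot t e3 = 0" "dot y e3 = 0" "dot z e3 = 1"
begin

lemma nonzero: "v \<noteq> 0" "y \<noteq> 0" "z \<noteq> 0" "\<not> proportional y z" "\<not> proportional z y"
proof -
  show "y \<noteq> 0" "z \<noteq> 0" using dots by (auto simp: dot_simps)
  show "v \<noteq> 0" using dots dot_simps(4)[of t 0 v] by auto
  show "\<not> proportional y z" "\<not> proportional z y" using dots by (auto simp: dot_simps proportional_def)
qed

lemma vec_expand: "s = app t s *s cvec v + app y s *s cvec e2 + app z s *s cvec e3"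
proof (rule iffD2[OF vec_eq_iff], rule allI)
  fix i
  have "s $ i = (\<Sum>r\<in>UNIV. const (if i = r then 1 else 0) * s $ r)"
    by (simp add: if_distrib[of const] if_distrib[of "\<lambda>x. x * _"] cong: if_cong)
  also have "\<dots> = (app t s *s cvec v + app y s *s cvec e2 + app z s *s cvec e3) $ i"
    unfolding delta by (simp add: app_def cvec_def sum_3 const_add const_mult algebra_simps)
  finally show "s $ i = (app t s *s cvec v + app y s *s cvec e2 + app z s *s cvec e3) $ i" .
qed

lemma der_expand: "der s p = app t s * der (cvec v) p + app y s * der (cvec e2) p + app z s * der (cvec e3) p"
  using arg_cong[OF vec_expand[of s], of "\<lambda>s. der s p"] by (simp only: der_vec)

text \<open>The determinant of \<open>s\<close>, the Euler derivation and \<open>v\<close>.\<close>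

definition phi :: "'a poly3 ^ 3 \<Rightarrow> 'a poly3" where
  "phi s = app y s * lf z - app z s * lf y"

lemma phi_vec: "phi (s + s') = phi s + phi s'" "phi (s - s') = phi s - phi s'"
  "phi (p *s s) = p * phi s" "phi 0 = 0"
  by (simp_all add: phi_def app_vec algebra_simps)

lemma phi_special [simp]: "phi (cvec v) = 0" "phi evec = 0"
  by (simp_all add: phi_def dots mult.commute)

lemma phi_forms: "(\<And>i. s $ i \<in> forms j) \<Longrightarrow> phi s \<in> forms (j + 1)"
  unfolding phi_def by (intro forms_diff forms_mult app_forms lf_in_forms)

lemma phi_hvec: "phi (hvec j s) = hcomp (j + 1) (phi s)"
  using hcomp_mult[OF lf_in_forms, of "j + 1" "app y s" z] hcomp_mult[OF lf_in_forms, of "j + 1" "app z s" y]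
  by (simp add: phi_def app_hvec hcomp_diff)

lemma phi_in_span: "phi s \<in> ideal.span {lf y, lf z}"
proof -
  have "phi s = (- app z s) * lf y + app y s * lf z" by (simp add: phi_def)
  then show ?thesis unfolding span_pair by blast
qed

lemma span_yz_eval: "p \<in> ideal.span {lf y, lf z} \<Longrightarrow> eval p v = 0"
  by (auto simp: span_pair dots)

lemma point_ideal_v: "point_ideal (proj_point v) = ideal.span {lf y, lf z}"
  by (rule point_ideal_eq) (simp_all add: nonzero dots)

end

subsection \<open>Line arrangements\<close>

definition nv :: "('a::field ^ 3) set set \<Rightarrow> 'a ^ 3" where
  "nv L = lin_coeffs (defining_form L)"

lemma nv:
  assumes "is_line L"
  shows "defining_form L = lf (nv L)" "nv L \<noteq> 0" "L = line_of (lf (nv L))"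
proof -
  obtain m where m: "m \<noteq> 0" "defining_form L = lf m" "L = line_of (lf m)"
    using is_line_defining_form[OF assms] .
  have "nv L = m" by (simp add: nv_def m(2))
  then show "defining_form L = lf (nv L)" "nv L \<noteq> 0" "L = line_of (lf (nv L))" using m by simp_all
qed

lemma nv_not_proportional:
  assumes "is_line L" "is_line L'" "L \<noteq> L'"
  shows "\<not> proportional (nv L) (nv L')"
proof
  assume "proportional (nv L) (nv L')"
  then obtain c where c: "nv L' = c *s nv L" by (auto simp: proportional_def)
  then have "c \<noteq> 0" using nv(2)[OF assms(2)] by auto
  then have "line_of (lf (nv L')) = line_of (lf (nv L))" using c line_of_scale by metis
  then show False using assms nv(3) by metis
qed

locale arrangement = coordinates v t y z e2 e3 for v t y z e2 e3 :: "'a::field_char_0 ^ 3" +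
  fixes A :: "('a ^ 3) set set set"
  assumes fin: "finite A" and lines: "\<And>L. L \<in> A \<Longrightarrow> is_line L"
    and nonconcurrent: "\<not> concurrent A"
    and general: "eval (arr_poly A) v \<noteq> 0"
begin

definition f where "f = arr_poly A"
definition d where "d = card A"
text \<open>The Euler factor \<open>d\<close> as a constant polynomial; it is a unit in
  characteristic zero.\<close>

definition dP :: "'a poly3" where "dP = const (of_nat d)"
definition f1 where "f1 = der (cvec v) f"
definition f2 where "f2 = der (cvec e2) f"
definition f3 where "f3 = der (cvec e3) f"

lemma f_prod: "f = (\<Prod>L\<in>A. lf (nv L))"
  unfolding f_def arr_poly_def by (rule prod.cong) (simp_all add: nv(1) lines)

lemma general': "eval f v \<noteq> 0"
  using general by (simp add: f_def)

lemma dot_nv_v: "L \<in> A \<Longrightarrow> dot (nv L) v \<noteq> 0"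
  using general' fin unfolding f_prod by (simp add: eval_prod)

lemma nv_A: "L \<in> A \<Longrightarrow> nv L \<noteq> 0"
  using nv(2) lines by blast

lemma nv_inj: "L \<in> A \<Longrightarrow> L' \<in> A \<Longrightarrow> proportional (nv L) (nv L') \<Longrightarrow> L = L'"
  using nv_not_proportional lines by metis

lemma f_nonzero: "f \<noteq> 0"
  using general' by auto

lemma d_pos: "d > 0"
proof -
  have "A \<noteq> {}"
    using nonconcurrent proj_point_P2[OF nonzero(1)] unfolding concurrent_def by blast
  then show ?thesis using fin by (simp add: d_def card_gt_0_iff)
qed

lemma f_forms: "f \<in> forms (int d)"
  unfolding f_prod d_def by (intro forms_prod fin lf_in_forms)

lemma der_cvec_forms: "p \<in> forms j \<Longrightarrow> der (cvec e) p \<in> forms (j - 1)"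
  unfolding der_def cvec_def by (simp add: forms_sum forms_const_mult pdiff_forms)

lemma f1_forms: "f1 \<in> forms (int d - 1)"
  unfolding f1_def by (intro der_cvec_forms f_forms)

lemma der_f: "der s f = app t s * f1 + app y s * f2 + app z s * f3"
  unfolding f1_def f2_def f3_def by (rule der_expand)

lemma euler: "der evec f = dP * f"
  unfolding f_prod dP_def const_of_nat d_def by (rule euler_prod[OF fin])

lemma euler_coords: "lf t * f1 + lf y * f2 + lf z * f3 = dP * f"
  using euler der_f[of evec] by simp

lemma dP_nonzero: "dP \<noteq> 0"
  using d_pos by (simp add: dP_def)

text \<open>Euler's formula at \<open>v\<close>, where \<open>lf y\<close> and \<open>lf z\<close>
  vanish and \<open>lf t\<close> is 1, gives \<open>d * eval f v\<close>.\<close>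

lemma f1_eval: "eval f1 v \<noteq> 0"
proof -
  have "eval f1 v = of_nat d * eval f v"
    using arg_cong[OF euler_coords, of "\<lambda>p. eval p v"] by (simp add: dots dP_def)
  then show ?thesis using general' d_pos by simp
qed

lemma f1_nonzero: "f1 \<noteq> 0"
  using f1_eval by auto

lemma lf_dvd_eval: "dot m v = 0 \<Longrightarrow> lf m dvd p \<Longrightarrow> eval p v = 0"
  by (auto simp: dvd_def)

lemma split_line:
  assumes "L \<in> A"
  shows "f = lf (nv L) * (\<Prod>L\<in>A - {L}. lf (nv L))"
    "\<not> lf (nv L) dvd (\<Prod>L\<in>A - {L}. lf (nv L))"
proof -
  show "f = lf (nv L) * (\<Prod>L\<in>A - {L}. lf (nv L))"
    unfolding f_prod using assms fin by (simp add: prod.remove)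
  show "\<not> lf (nv L) dvd (\<Prod>L\<in>A - {L}. lf (nv L))"
    using lf_dvd_prod_iff[of "A - {L}" "nv L" nv] fin assms nv_A nv_inj by auto
qed

text \<open>By the Leibniz rule \<open>der s f\<close> is congruent to \<open>app (nv L) s\<close>
  times the product of the other lines modulo \<open>lf (nv L)\<close>, a prime that does not divide
  this product. So every syzygy is tangent to every line.\<close>

lemma line_dvd_app:
  assumes "L \<in> A" "lf (nv L) dvd der s f"
  shows "lf (nv L) dvd app (nv L) s"
proof -
  let ?g = "\<Prod>L\<in>A - {L}. lf (nv L)"
  have "der s f = app (nv L) s * ?g + lf (nv L) * der s ?g"
    using split_line(1)[OF assms(1)] der_mult der_lf by metis
  then have "lf (nv L) dvd app (nv L) s * ?g"
    using assms(2) by (metis dvd_add_left_iff dvd_triv_left)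
  then show ?thesis
    using split_line(2)[OF assms(1)] prime_elem_dvd_mult_iff[OF prime_lf[OF nv_A[OF assms(1)]]] by blast
qed

text \<open>Otherwise the constant field along \<open>v\<close> would be tangent to
  \<open>L\<close>, which means that \<open>v\<close> lies on \<open>L\<close>.\<close>

lemma line_not_dvd_f1: "L \<in> A \<Longrightarrow> \<not> lf (nv L) dvd f1"
proof
  assume "L \<in> A" "lf (nv L) dvd f1"
  then have "lf (nv L) dvd const (dot (nv L) v)"
    using line_dvd_app[of L "cvec v"] by (simp add: f1_def)
  then show False
    using \<open>L \<in> A\<close> nv_A dot_nv_v by (simp add: lf_dvd_iff)
qed

lemma f_dvd_mult_f1: "f dvd f1 * p \<Longrightarrow> f dvd p"
  using prime_prod_strip[where A = A and q = "\<lambda>L. lf (nv L)" and z = f1 and w = p,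
      OF fin prime_lf[OF nv_A] line_not_dvd_f1] by (simp only: f_prod[symmetric])

lemma f1_dvd_mult_f:
  assumes "f1 dvd p * f"
  shows "f1 dvd p"
proof -
  obtain q where q: "p * f = f1 * q" using assms by (auto simp: dvd_def)
  then have "f dvd q" using f_dvd_mult_f1[of q] by (metis dvd_triv_right)
  then obtain q' where "q = f * q'" by (auto simp: dvd_def)
  then have "p * f = (f1 * q') * f" using q by (simp add: mult_ac)
  then have "p = f1 * q'" using f_nonzero mult_right_cancel by blast
  then show ?thesis by simp
qed

section \<open>The kernel of \<open>phi\<close>\<close>

definition theta0 where "theta0 = f1 *s evec - (dP * f) *s cvec v"

lemma theta0_syz: "theta0 \<in> syz f"
  by (simp add: syz_iff theta0_def der_vec euler f1_def mult_ac)

lemma phi_theta0 [simp]: "phi theta0 = 0"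
  by (simp add: theta0_def phi_vec)

lemma theta0_forms: "theta0 $ i \<in> forms (int d)"
proof -
  have "f1 * X i \<in> forms (int d - 1 + 1)" by (intro forms_mult f1_forms X_in_forms)
  then have "f1 * X i \<in> forms (int d)" by simp
  moreover have "dP * f * const (v $ i) \<in> forms (int d)"
    unfolding dP_def by (subst mult.commute) (intro forms_const_mult f_forms)
  ultimately show ?thesis by (simp add: theta0_def evec_def cvec_def forms_diff)
qed

lemma theta0_nonzero: "theta0 \<noteq> 0"
proof
  assume "theta0 = 0"
  then have "app y theta0 = 0" by (simp add: app_vec)
  then have "f1 * lf y = 0" by (simp add: theta0_def app_vec dots)
  then show False using f1_nonzero nonzero by simp
qed

text \<open>A vanishing determinant puts \<open>s\<close> in the span of the Euler derivation and
  \<open>v\<close>, say \<open>s = h *s evec + a *s cvec v\<close>, because \<open>lf y\<close> and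
  \<open>lf z\<close> are coprime. Annihilating \<open>f\<close> gives
  \<open>h * (dP * f) + a * f1 = 0\<close>, and coprimality of \<open>f\<close> and
  \<open>f1\<close> leaves only the multiples of \<open>theta0\<close>.\<close>

lemma kernel_phi:
  assumes s: "s \<in> syz f" and 0: "phi s = 0"
  shows "\<exists>k. s = k *s theta0"
proof -
  have eq: "app y s * lf z = app z s * lf y" using 0 by (simp add: phi_def)
  then have "lf y dvd app y s * lf z" by (metis dvd_triv_right)
  then have "lf y dvd app y s"
    using prime_elem_dvd_mult_iff[OF prime_lf[OF nonzero(2)]] lf_dvd_lf_iff nonzero by blast
  then obtain h where h: "app y s = lf y * h" by (auto simp: dvd_def)
  have "lf y * (h * lf z) = lf y * app z s" using eq h by (simp add: mult_ac)
  then have h': "app z s = h * lf z" using nonzero by simp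
  define a where "a = app t s - h * lf t"
  have "evec = lf t *s cvec v + lf y *s cvec e2 + lf z *s cvec e3" using vec_expand[of evec] by simp
  then have s_eq: "s = h *s evec + a *s cvec v"
    using vec_expand[of s] by (simp add: h h' a_def vec_eq_iff algebra_simps)
  have z: "h * (dP * f) + a * f1 = 0"
    using s arg_cong[OF s_eq, of "\<lambda>s. der s f"] by (simp add: syz_iff der_vec euler f1_def)
  then have "f1 * a = f * (- dP * h)" by (simp add: algebra_simps eq_neg_iff_add_eq_0)
  then have "f dvd f1 * a" by simp
  then obtain k where k: "a = f * k" using f_dvd_mult_f1 by (auto simp: dvd_def)
  define k' where "k' = - const (inverse (of_nat d)) * k"
  have dk: "dP * k' = - k"
    using d_pos by (simp add: k'_def dP_def const_mult_inverse mult.assoc)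
  have "f * (dP * h + k * f1) = 0" using z k by (simp add: algebra_simps)
  then have "dP * h + k * f1 = 0" using f_nonzero by (simp only: mult_eq_0_iff) simp
  then have "dP * h = dP * (f1 * k')" using dk by Groebner_Basis.algebra
  then have "h = f1 * k'" using dP_nonzero by simp
  moreover have "a = - (dP * f) * k'" using k dk by Groebner_Basis.algebra
  ultimately have "s = k' *s theta0"
    using s_eq by (simp add: theta0_def vec_eq_iff algebra_simps)
  then show ?thesis ..
qed

section \<open>The image of \<open>phi\<close>\<close>

lemma der_in_jac: "der s f \<in> jac f"
  unfolding jac_def der_def by (intro ideal.span_sum ideal.span_scale ideal.span_base) simp

text \<open>In the adapted coordinates the Jacobian ideal is generated by \<open>f1\<close>,
  \<open>f2\<close> and \<open>f3\<close>, and \<open>f1\<close> already lies in the ideal on the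
  left of the colon.\<close>

lemma residual_iff:
  assumes "lin_coeffs l = v"
  shows "g \<in> residual A l \<longleftrightarrow> g * f2 \<in> ideal.span {f, f1} \<and> g * f3 \<in> ideal.span {f, f1}"
proof -
  have "pdiff_along l f = f1" by (simp add: pdiff_along_def assms f1_def der_def cvec_def)
  then have res: "residual A l = colon (ideal.span {f, f1}) (jac f)" by (simp add: residual_def f_def)
  show ?thesis
  proof
    assume "g \<in> residual A l"
    then show "g * f2 \<in> ideal.span {f, f1} \<and> g * f3 \<in> ideal.span {f, f1}"
      unfolding res colon_def f2_def f3_def using der_in_jac by blast
  next
    assume g: "g * f2 \<in> ideal.span {f, f1} \<and> g * f3 \<in> ideal.span {f, f1}"
    have "g * h \<in> ideal.span {f, f1}" if "h \<in> jac f" for h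
      using that unfolding jac_def
    proof (induction rule: ideal.span_induct_alt)
      case base
      show ?case by (simp add: ideal.span_zero)
    next
      case (step c h p)
      then obtain i where h: "h = pdiff i f" by blast
      have "h = der (cvec (axis i 1)) f"
        unfolding h der_def cvec_def axis_def by (simp add: if_distrib[of const] if_distrib[of "\<lambda>x. x * _"] cong: if_cong)
      then have "g * h = (g * app t (cvec (axis i 1))) * f1 + app y (cvec (axis i 1)) * (g * f2) + app z (cvec (axis i 1)) * (g * f3)"
        by (simp add: der_f algebra_simps)
      moreover have "\<dots> \<in> ideal.span {f, f1}"
        by (rule ideal.span_add[OF ideal.span_add[OF ideal.span_scale ideal.span_scale[OF conjunct1[OF g]]]
            ideal.span_scale[OF conjunct2[OF g]]]) (simp add: ideal.span_base)
      ultimately have gh: "g * h \<in> ideal.span {f, f1}" by simp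
      have "c * (g * h) + g * p \<in> ideal.span {f, f1}"
        by (rule ideal.span_add[OF ideal.span_scale[OF gh] step(2)])
      then show ?case by (simp add: algebra_simps)
    qed
    then show "g \<in> residual A l" unfolding res colon_def by blast
  qed
qed

text \<open>The syzygy relation and Euler's formula are two linear relations among
  \<open>f1\<close>, \<open>f2\<close>, \<open>f3\<close>. Eliminating \<open>f3\<close> or
  \<open>f2\<close> between them leaves the other one with coefficient \<open>phi s\<close>, up to
  sign.\<close>

lemma phi_syz_residual:
  assumes l: "lin_coeffs l = v" and s: "s \<in> syz f"
  shows "phi s \<in> residual A l"
proof -
  have eq: "app t s * f1 + app y s * f2 + app z s * f3 = 0" using s by (simp add: syz_iff der_f)
  have "phi s * f2 = (- app z s * dP) * f + (app z s * lf t - app t s * lf z) * f1"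
    using eq euler_coords unfolding phi_def by Groebner_Basis.algebra
  moreover have "phi s * f3 = (app y s * dP) * f + (app t s * lf y - app y s * lf t) * f1"
    using eq euler_coords unfolding phi_def by Groebner_Basis.algebra
  ultimately show ?thesis unfolding residual_iff[OF l] span_pair by blast
qed

text \<open>By Euler's formula \<open>e\<close> and \<open>f1\<close> generate the same ideal as
  \<open>f\<close> and \<open>f1\<close>. The aim is \<open>g = a * lf y + a' * lf z\<close> with
  \<open>f1\<close> dividing \<open>a' * f2 - a * f3\<close>, since such \<open>a\<close>,
  \<open>a'\<close> are components of a syzygy with determinant \<open>g\<close>. Expanding
  \<open>g * f2\<close> and \<open>g * f3\<close> gives candidates, and
  \<open>f1(v) \<noteq> 0\<close> together with the vanishing of \<open>g\<close> at
  \<open>v\<close> allows their error to be absorbed.\<close>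

lemma residual_phi_syz:
  assumes l: "lin_coeffs l = v" and g: "g \<in> residual A l" "g \<in> ideal.span {lf y, lf z}"
  shows "\<exists>s\<in>syz f. g = phi s"
proof -
  define e where "e = lf y * f2 + lf z * f3"
  have e: "dP * f = lf t * f1 + e" using euler_coords by (simp add: e_def algebra_simps)
  have f_eq: "f = const (inverse (of_nat d)) * (lf t * f1 + e)"
    using d_pos by (simp add: dP_def const_inverse_mult flip: e)
  obtain a1 b1 a2 b2 where "g * f2 = a1 * f + b1 * f1" "g * f3 = a2 * f + b2 * f1"
    using g(1) unfolding residual_iff[OF l] span_pair by blast
  then have "\<exists>\<alpha> \<beta>. g * f2 = \<alpha> * e + \<beta> * f1" "\<exists>\<alpha> \<beta>. g * f3 = \<alpha> * e + \<beta> * f1"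
  proof -
    let ?c = "const (inverse (of_nat d))"
    assume "g * f2 = a1 * f + b1 * f1" "g * f3 = a2 * f + b2 * f1"
    then have "g * f2 = (a1 * ?c) * e + (a1 * ?c * lf t + b1) * f1" "g * f3 = (a2 * ?c) * e + (a2 * ?c * lf t + b2) * f1"
      using f_eq by Groebner_Basis.algebra+
    then show "\<exists>\<alpha> \<beta>. g * f2 = \<alpha> * e + \<beta> * f1" "\<exists>\<alpha> \<beta>. g * f3 = \<alpha> * e + \<beta> * f1" by blast+
  qed
  then obtain \<alpha> \<beta> \<alpha>' \<beta>' where 2: "g * f2 = \<alpha> * e + \<beta> * f1" and 3: "g * f3 = \<alpha>' * e + \<beta>' * f1" by blast
  \<comment> \<open>\<open>w\<close> is the error of the candidates \<open>\<alpha>\<close> and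
    \<open>\<alpha>'\<close>. The two relations combine to show that \<open>w * e\<close> is a
    multiple of \<open>f1\<close>, hence so is \<open>w\<close>.\<close>
  define w where "w = g - \<alpha> * lf y - \<alpha>' * lf z"
  have we: "w * e = (lf y * \<beta> + lf z * \<beta>') * f1"
    using 2 3 unfolding w_def e_def by Groebner_Basis.algebra
  have "(dP * w) * f = (w * lf t + lf y * \<beta> + lf z * \<beta>') * f1"
    using we e by Groebner_Basis.algebra
  then have "f1 dvd dP * w" using f1_dvd_mult_f by (metis dvd_triv_right)
  then have "f1 dvd w" using d_pos by (simp add: dP_def dvd_const_mult_iff)
  then obtain \<gamma> where \<gamma>: "w = f1 * \<gamma>" by (auto simp: dvd_def)
  have "w \<in> ideal.span {lf y, lf z}"
    unfolding w_def using g(2) by (intro ideal.span_diff ideal.span_scale) (auto intro: ideal.span_base)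
  then have "f1 * \<gamma> \<in> ideal.span {lf y, lf z ^ 1}" using \<gamma> by simp
  moreover have "f1 \<notin> ideal.span {lf y, lf z}" using f1_eval span_yz_eval by blast
  ultimately have "\<gamma> \<in> ideal.span {lf y, lf z ^ 1}"
    using span_power_colon[OF nonzero(2,4)] by blast
  then obtain \<gamma>1 \<gamma>2 where \<gamma>12: "\<gamma> = \<gamma>1 * lf y + \<gamma>2 * lf z" by (auto simp: span_pair)
  \<comment> \<open>Moving \<open>w = f1 * \<gamma>\<close> into the coefficients changes the
    relation with \<open>e\<close> only by multiples of \<open>f1\<close>, which go into
    \<open>b\<close>.\<close>
  define a b a' where "a = \<alpha> + \<gamma>1 * f1" and "b = \<beta> - \<gamma>1 * e" and "a' = \<alpha>' + \<gamma>2 * f1"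
  have g_eq: "g = a * lf y + a' * lf z"
    using \<gamma> \<gamma>12 unfolding w_def a_def a'_def by Groebner_Basis.algebra
  have g2: "g * f2 = a * e + b * f1"
    using 2 unfolding a_def b_def by Groebner_Basis.algebra
  have zb: "lf z * (a' * f2 - a * f3) = b * f1"
    using g2 unfolding g_eq e_def by Groebner_Basis.algebra
  then have "lf z dvd b * f1" by (metis dvd_triv_left)
  moreover have "\<not> lf z dvd f1" using lf_dvd_eval[of z f1] dots f1_eval by blast
  ultimately have "lf z dvd b" using prime_elem_dvd_mult_iff[OF prime_lf[OF nonzero(3)]] by blast
  then obtain b' where "b = lf z * b'" by (auto simp: dvd_def)
  then have "lf z * (a' * f2 - a * f3) = lf z * (b' * f1)" using zb by (simp add: mult_ac)
  then have rel: "a' * f2 - a * f3 = b' * f1" using nonzero by simp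
  define s where "s = a' *s cvec e2 - a *s cvec e3 - b' *s cvec v"
  have s: "app t s = - b'" "app y s = a'" "app z s = - a"
    by (simp_all add: s_def app_vec dots)
  have "der s f = 0" using rel unfolding der_f s by Groebner_Basis.algebra
  moreover have "g = phi s" by (simp add: phi_def s g_eq)
  ultimately show ?thesis by (auto simp: syz_iff)
qed

lemma residual_point_ideal:
  assumes "lin_coeffs l = v"
  shows "residual A l \<inter> point_ideal (dual_point l) = phi ` syz f"
  using phi_syz_residual[OF assms] residual_phi_syz[OF assms] phi_in_span
  by (auto simp: dual_point_def assms point_ideal_v)

end

subsection \<open>Graded divisibility\<close>

lemma hcomp_low_mult:
  assumes p: "\<And>k. k \<ge> i \<Longrightarrow> hcomp k p = 0" and q: "\<And>k. k > j \<Longrightarrow> hcomp k q = 0"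
  shows "hcomp (i + j) (p * q) = 0"
proof (rule poly_mapping_eqI)
  fix m
  have "lookup (p * q) m = 0" if m: "mdeg m = i + j"
  proof (rule ccontr)
    assume "lookup (p * q) m \<noteq> 0"
    then have "m \<in> keys (p * q)" by (simp add: in_keys_iff)
    then obtain a b where ab: "a \<in> keys p" "b \<in> keys q" "m = a + b"
      using keys_mult[of p q] by blast
    have "lookup (hcomp (mdeg a) p) a \<noteq> 0" "lookup (hcomp (mdeg b) q) b \<noteq> 0"
      using ab by (simp_all add: lookup_hcomp in_keys_iff)
    then have "\<not> mdeg a \<ge> i" "\<not> mdeg b > j" using p q by (metis lookup_zero)+
    moreover have "mdeg a + mdeg b = i + j" using m unfolding ab(3) mdeg_add .
    ultimately show False by linarith
  qed
  then show "lookup (hcomp (i + j) (p * q)) m = lookup 0 m"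
    by (simp add: lookup_hcomp del: of_nat_sum)
qed

lemma hcomp_hcomp: "hcomp k (hcomp j p) = (if k = j then hcomp j p else 0)"
  by (rule hcomp_forms[OF hcomp_in_forms])

lemma hcomp_top_mult:
  assumes p: "\<And>k. k > i \<Longrightarrow> hcomp k p = 0" and q: "\<And>k. k > j \<Longrightarrow> hcomp k q = 0"
  shows "hcomp (i + j) (p * q) = hcomp i p * hcomp j q"
proof -
  define p' q' where "p' = p - hcomp i p" and "q' = q - hcomp j q"
  have p': "hcomp k p' = 0" if "k \<ge> i" for k
    using that p[of k] by (auto simp: p'_def hcomp_diff hcomp_hcomp)
  have q': "hcomp k q' = 0" if "k \<ge> j" for k
    using that q[of k] by (auto simp: q'_def hcomp_diff hcomp_hcomp)
  have "hcomp (i + j) (p' * q) = 0" using p' q by (rule hcomp_low_mult)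
  moreover have "hcomp (j + i) (q' * hcomp i p) = 0"
    by (rule hcomp_low_mult[OF q']) (auto simp: hcomp_hcomp)
  moreover have "hcomp (i + j) (hcomp i p * hcomp j q) = hcomp i p * hcomp j q"
    by (simp add: hcomp_forms[OF forms_mult[OF hcomp_in_forms hcomp_in_forms]])
  moreover have "p * q = p' * q + q' * hcomp i p + hcomp i p * hcomp j q"
    by (simp add: p'_def q'_def algebra_simps)
  ultimately show ?thesis by (simp add: hcomp_add add.commute)
qed

lemma hcomp_top_exists:
  assumes "p \<noteq> 0"
  obtains i where "i \<ge> 0" "hcomp i p \<noteq> 0" "\<And>k. k > i \<Longrightarrow> hcomp k p = 0"
proof -
  let ?S = "mdeg ` keys p"
  have in_S: "k \<in> ?S" if k: "hcomp k p \<noteq> 0" for k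
  proof -
    from k obtain m where "lookup (hcomp k p) m \<noteq> 0" by (metis lookup_zero poly_mapping_eqI)
    then have "mdeg m = k" "m \<in> keys p"
      by (simp_all add: lookup_hcomp in_keys_iff split: if_splits del: of_nat_sum)
    then show ?thesis by blast
  qed
  have fin: "finite ?S" by simp
  define S where "S = {k. hcomp k p \<noteq> 0}"
  have S: "finite S" "S \<noteq> {}"
    using in_S finite_subset[OF _ fin, of S] hcomp_nonzero[OF assms] by (auto simp: S_def)
  have 1: "hcomp (Max S) p \<noteq> 0" using Max_in[OF S] by (simp add: S_def)
  have 0: "Max S \<ge> 0"
    using hcomp_nonzero[OF assms] Max_ge[OF S(1)] unfolding S_def by fastforce
  have 2: "hcomp k p = 0" if "k > Max S" for k
    using that Max_ge[OF S(1), of k] unfolding S_def by fastforce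
  show thesis by (rule that[OF 0 1 2])
qed

lemma eq_hcomp_0:
  assumes "\<And>k. k > 0 \<Longrightarrow> hcomp k p = 0"
  shows "p = hcomp 0 p"
proof (rule ccontr)
  assume "p \<noteq> hcomp 0 p"
  then have "p - hcomp 0 p \<noteq> 0" by simp
  then obtain j where "j \<ge> 0" "hcomp j (p - hcomp 0 p) \<noteq> 0" using hcomp_nonzero by blast
  then show False using assms[of j] by (cases "j = 0") (auto simp: hcomp_diff hcomp_hcomp)
qed

lemma S3_span_pair: "x \<in> S3.span {s, t} \<longleftrightarrow> (\<exists>p q. x = p *s s + q *s t)"
proof -
  have "x \<in> S3.span {s, t} \<longleftrightarrow> (\<exists>p. x - p *s s \<in> S3.span {t})"
    by (subst S3.span_breakdown_eq) (rule refl)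
  also have "\<dots> \<longleftrightarrow> (\<exists>p q. x - p *s s = q *s t)"
    by (auto simp: S3.span_singleton)
  also have "\<dots> \<longleftrightarrow> (\<exists>p q. x = p *s s + q *s t)"
    by (simp add: diff_eq_eq add.commute)
  finally show ?thesis .
qed

lemma S3_independent_pair:
  "s \<noteq> t \<and> \<not> S3.dependent {s, t} \<longleftrightarrow> (\<forall>p q. p *s s + q *s t = 0 \<longrightarrow> p = 0 \<and> q = 0)"
  (is "?L \<longleftrightarrow> ?R")
proof -
  have dep: "S3.dependent {s, t} \<longleftrightarrow> (\<exists>u. (\<exists>x\<in>{s, t}. u x \<noteq> 0) \<and> (\<Sum>x\<in>{s, t}. u x *s x) = 0)"
    by (rule S3.dependent_finite) simp
  show ?thesis
proof
  assume L: ?L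
  show ?R
  proof (intro allI impI)
    fix p q assume pq: "p *s s + q *s t = 0"
    let ?u = "\<lambda>x. if x = s then p else q"
    have "(\<Sum>x\<in>{s, t}. ?u x *s x) = 0" using L pq by auto
    then have "(\<exists>x\<in>{s, t}. ?u x \<noteq> 0) \<Longrightarrow> S3.dependent {s, t}"
      unfolding dep by (intro exI[of _ ?u] conjI)
    then have "\<forall>x\<in>{s, t}. ?u x = 0" using L by blast
    then show "p = 0 \<and> q = 0" using L by auto
  qed
next
  assume R: ?R
  have st: "s \<noteq> t"
  proof
    assume "s = t"
    then have "1 *s s + (- 1) *s t = 0" by (simp add: vec_eq_iff)
    then show False using R by fastforce
  qed
  moreover have "\<not> S3.dependent {s, t}"
  proof
    assume "S3.dependent {s, t}"
    then obtain u where u: "\<exists>x\<in>{s, t}. u x \<noteq> 0" "(\<Sum>x\<in>{s, t}. u x *s x) = 0"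
      unfolding dep by (elim exE conjE)
    then have "u s *s s + u t *s t = 0" using st by simp
    then show False using R u(1) by blast
  qed
  ultimately show ?L by blast
qed
qed

section \<open>The Koszul complex of the variables\<close>

lemma prime_X: "prime_elem (X i :: 'a::field poly3)"
  using prime_lf[of "axis i 1 :: 'a ^ 3"] by (simp add: lf_axis)

lemma X_neq_0 [simp]: "X i \<noteq> (0 :: 'a::field poly3)"
  using prime_X[of i] by (auto simp: prime_elem_def)

lemma X_not_dvd_X:
  assumes "i \<noteq> j"
  shows "\<not> X i dvd (X j :: 'a::field poly3)"
proof
  assume "X i dvd (X j :: 'a poly3)"
  then obtain k where "X j = (X i :: 'a poly3) * k" by (rule dvdE)
  then have "eval (X j) (axis j 1) = eval (X i * k) (axis j 1)" by (rule arg_cong)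
  then show False using assms by (simp add: axis_def)
qed

text \<open>Here \<open>kill\<close> sets \<open>X 1\<close> to zero, and the remaining relation
  between \<open>X 2\<close> and \<open>X 3\<close> yields \<open>\<alpha>\<close>. What is lost in
  \<open>Q\<close> and \<open>R\<close> is divisible by \<open>X 1\<close> and yields the other two
  coefficients; cancelling \<open>X 1\<close> then determines \<open>P\<close>.\<close>

lemma koszul:
  fixes P Q R :: "'a::field poly3"
  assumes "X 1 * P + X 2 * Q + X 3 * R = 0"
  obtains \<alpha> \<beta> \<gamma> where "P = X 2 * \<gamma> - X 3 * \<beta>" "Q = X 3 * \<alpha> - X 1 * \<gamma>" "R = X 1 * \<beta> - X 2 * \<alpha>"
proof -
  let ?e = "axis 1 1 :: 'a ^ 3"
  have a1: "?e $ 1 = 1" by (simp add: axis_def)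
  have piv1: "piv ?e = 1" unfolding piv_def by (rule some_equality) (auto simp: axis_def split: if_splits)
  have k1: "kill ?e (X 1) = 0" "kill ?e (X 2) = X 2" "kill ?e (X 3) = X 3"
    using a1 by (simp_all add: kill_X piv1 lf_axis)
  have rel: "X 2 * kill ?e Q + X 3 * kill ?e R = 0"
    using arg_cong[OF assms, of "kill ?e"] by (simp add: kill_hom k1)
  then have "X 2 * kill ?e Q = X 3 * (- kill ?e R)" by (simp add: eq_neg_iff_add_eq_0)
  then have "X 3 dvd X 2 * kill ?e Q" by (metis dvd_triv_left)
  then have "X 3 dvd kill ?e Q" using prime_elem_dvd_mult_iff[OF prime_X[where 'a = 'a]] X_not_dvd_X[of 3 2, where 'a = 'a] by auto
  then obtain \<alpha> where \<alpha>: "kill ?e Q = X 3 * \<alpha>" by (auto simp: dvd_def)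
  then have "X 3 * (X 2 * \<alpha> + kill ?e R) = 0" using rel by Groebner_Basis.algebra
  then have R': "kill ?e R = - X 2 * \<alpha>" using X_neq_0[of 3] by (simp add: eq_neg_iff_add_eq_0 add.commute)
  obtain \<gamma> where \<gamma>: "Q - kill ?e Q = X 1 * \<gamma>" using dvd_diff_kill[of ?e Q] by (auto simp: dvd_def lf_axis)
  obtain \<beta> where \<beta>: "R - kill ?e R = X 1 * \<beta>" using dvd_diff_kill[of ?e R] by (auto simp: dvd_def lf_axis)
  have Q: "Q = X 3 * \<alpha> - X 1 * (- \<gamma>)" using \<gamma> \<alpha> by Groebner_Basis.algebra
  have R: "R = X 1 * \<beta> - X 2 * \<alpha>" using \<beta> R' by Groebner_Basis.algebra
  have "X 1 * (P - (X 2 * (- \<gamma>) - X 3 * \<beta>)) = 0" using assms unfolding Q R by Groebner_Basis.algebra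
  then have "P = X 2 * (- \<gamma>) - X 3 * \<beta>" by simp
  then show thesis using Q R that by blast
qed

section \<open>Saito's criterion and generators of \<open>I\<close>\<close>

context arrangement
begin

text \<open>The ideal \<open>I\<close> of the theorem, by \<open>residual_point_ideal\<close>, in
  the form in which its elements come with syzygies.\<close>

definition II where "II = phi ` syz f"

lemma syz_add: "s \<in> syz f \<Longrightarrow> s' \<in> syz f \<Longrightarrow> s + s' \<in> syz f"
  by (simp add: syz_iff der_vec)

lemma syz_diff: "s \<in> syz f \<Longrightarrow> s' \<in> syz f \<Longrightarrow> s - s' \<in> syz f"
  by (simp add: syz_iff der_vec)

lemma syz_scale: "s \<in> syz f \<Longrightarrow> p *s s \<in> syz f"
  by (simp add: syz_iff der_vec)

lemma II_ideal: "ideal.subspace II"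
  unfolding ideal.subspace_def II_def
proof (intro conjI ballI allI)
  have "0 \<in> syz f" by (simp add: syz_iff der_vec)
  then show "0 \<in> phi ` syz f" using phi_vec(4) by (metis image_eqI)
next
  fix x y' assume "x \<in> phi ` syz f" "y' \<in> phi ` syz f"
  then obtain s s' where "s \<in> syz f" "s' \<in> syz f" "x = phi s" "y' = phi s'" by blast
  then show "x + y' \<in> phi ` syz f"
    by (intro image_eqI[of _ _ "s + s'"]) (simp_all add: phi_vec syz_add)
next
  fix c x assume "x \<in> phi ` syz f"
  then obtain s where "s \<in> syz f" "x = phi s" by blast
  then show "c * x \<in> phi ` syz f"
    by (intro image_eqI[of _ _ "c *s s"]) (simp_all add: phi_vec syz_scale)
qed

text \<open>The ideal \<open>(f, f1)\<close> is contained in the residual; \<open>lf v\<close> is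
  the linear form with coefficient vector \<open>v\<close>.\<close>

lemma in_II: "p \<in> ideal.span {f, f1} \<Longrightarrow> p \<in> ideal.span {lf y, lf z} \<Longrightarrow> p \<in> II"
  unfolding II_def
  using residual_phi_syz[of "lf v" p] residual_iff[of "lf v" p]
    ideal.span_scale[of p "{f, f1}" f2] ideal.span_scale[of p "{f, f1}" f3]
  by (auto simp: mult.commute)

lemma II_elements: "lf y * f \<in> II" "lf z * f \<in> II" "lf y * f1 \<in> II" "lf z * f1 \<in> II"
proof -
  have 1: "f \<in> ideal.span {f, f1}" "f1 \<in> ideal.span {f, f1}" "lf y \<in> ideal.span {lf y, lf z}"
    "lf z \<in> ideal.span {lf y, lf z}" by (simp_all add: ideal.span_base)
  show "lf y * f \<in> II" "lf z * f \<in> II" "lf y * f1 \<in> II" "lf z * f1 \<in> II"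
    using ideal.span_scale[OF 1(1)] ideal.span_scale[OF 1(2)] ideal.span_scale[OF 1(3)] ideal.span_scale[OF 1(4)]
    by (auto intro!: in_II simp: mult.commute[of _ f] mult.commute[of _ f1] simp flip: mult.commute[of f] mult.commute[of f1])
qed

lemma dvd_of_yz:
  assumes "k \<noteq> 0" "k dvd lf y * p" "k dvd lf z * p"
  shows "k dvd p"
proof -
  obtain q q' where q: "lf y * p = k * q" "lf z * p = k * q'" using assms by (auto simp: dvd_def)
  then have "k * (lf z * q) = k * (lf y * q')" by Groebner_Basis.algebra
  then have "lf z * q = lf y * q'" using assms(1) by simp
  then have "lf y dvd lf z * q" by (metis dvd_triv_left)
  then have "lf y dvd q"
    using prime_elem_dvd_mult_iff[OF prime_lf[OF nonzero(2)]] lf_dvd_lf_iff nonzero by blast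
  then obtain r where "q = lf y * r" by (auto simp: dvd_def)
  then have "lf y * p = lf y * (k * r)" using q by (simp add: mult_ac)
  then have "p = k * r" using nonzero by simp
  then show ?thesis by simp
qed

text \<open>A common divisor divides \<open>f\<close> and \<open>f1\<close>, because
  \<open>lf y\<close> and \<open>lf z\<close> are coprime, and these two are coprime as well. This
  turns multipliers of \<open>theta0\<close> into units.\<close>

lemma common_divisor_II:
  assumes "k \<noteq> 0" "\<And>p. p \<in> II \<Longrightarrow> k dvd p"
  shows "k dvd 1"
proof -
  have "k dvd f" "k dvd f1" using dvd_of_yz[OF assms(1)] assms(2) II_elements by blast+
  then obtain q q' where q: "f = k * q" "f1 = k * q'" by (auto simp: dvd_def)
  then have "k * (f1 * q) = k * (f * q')" by Groebner_Basis.algebra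
  then have "f1 * q = f * q'" using assms(1) by simp
  then have "f dvd q" using f_dvd_mult_f1 by (metis dvd_triv_left)
  then obtain r where "q = f * r" by (auto simp: dvd_def)
  then have "f * (k * r) = f * 1" using q by (simp add: mult_ac)
  then have "k * r = 1" using f_nonzero mult_left_cancel by blast
  then show ?thesis by (metis dvd_triv_left)
qed

lemma hvec_syz: "s \<in> syz f \<Longrightarrow> hvec j s \<in> syz f"
  using der_hvec[OF f_forms] by (simp add: syz_iff)

lemma II_hcomp: "p \<in> II \<Longrightarrow> hcomp j p \<in> II"
proof -
  assume "p \<in> II"
  then obtain s where "s \<in> syz f" "p = phi s" by (auto simp: II_def)
  then have "hvec (j - 1) s \<in> syz f" "hcomp j p = phi (hvec (j - 1) s)"
    by (simp_all add: hvec_syz phi_hvec)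
  then show ?thesis by (auto simp: II_def)
qed

lemma II_lift:
  assumes "G \<in> II" "G \<in> forms j"
  obtains tt where "tt \<in> syz f" "\<And>i. tt $ i \<in> forms (j - 1)" "phi tt = G"
proof -
  obtain s where s: "s \<in> syz f" "G = phi s" using assms(1) by (auto simp: II_def)
  have "phi (hvec (j - 1) s) = hcomp j G" by (simp add: phi_hvec s)
  also have "\<dots> = G" using assms(2) by (simp add: hcomp_forms)
  finally show thesis using that[of "hvec (j - 1) s"] hvec_syz s by simp
qed

lemma scale_theta0_cancel: "p *s theta0 = q *s theta0 \<Longrightarrow> p = q"
proof -
  assume eq: "p *s theta0 = q *s theta0"
  obtain i where "theta0 $ i \<noteq> 0" using theta0_nonzero by (auto simp: vec_eq_iff)
  moreover have "p * theta0 $ i = q * theta0 $ i" using arg_cong[OF eq, of "\<lambda>x. x $ i"] by simp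
  ultimately show ?thesis by simp
qed

lemma wedge:
  assumes "s \<in> syz f" "tt \<in> syz f"
  obtains k where "phi tt *s s - phi s *s tt = k *s theta0"
proof -
  have "phi (phi tt *s s - phi s *s tt) = 0" by (simp add: phi_vec)
  then show thesis using kernel_phi[OF syz_diff[OF syz_scale[OF assms(1)] syz_scale[OF assms(2)]]] that by blast
qed

text \<open>\<open>phi\<close> raises degrees by one, so the left side has degree
  \<open>m + n + 1\<close>, while \<open>theta0\<close> has degree \<open>d\<close>; homogeneity is
  obtained by passing to the right component of \<open>k\<close>.\<close>

lemma wedge_forms:
  assumes s: "s \<in> syz f" "\<And>i. s $ i \<in> forms m" and tt: "tt \<in> syz f" "\<And>i. tt $ i \<in> forms n"
  obtains k where "k \<in> forms (m + n + 1 - int d)" "phi tt *s s - phi s *s tt = k *s theta0"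
proof -
  obtain k where k: "phi tt *s s - phi s *s tt = k *s theta0" using wedge[OF s(1) tt(1)] .
  have "(hcomp (m + n + 1 - int d) k *s theta0) $ i = (phi tt *s s - phi s *s tt) $ i" for i
  proof -
    have "phi tt * s $ i \<in> forms (n + 1 + m)" "phi s * tt $ i \<in> forms (m + 1 + n)"
      by (intro forms_mult phi_forms s tt)+
    then have "(phi tt *s s - phi s *s tt) $ i \<in> forms (m + n + 1)"
      by (simp add: forms_diff add_ac)
    then have "k * theta0 $ i \<in> forms (m + n + 1)" unfolding k by simp
    then have "k * theta0 $ i = hcomp (m + n + 1) (k * theta0 $ i)" by (simp add: hcomp_forms)
    also have "\<dots> = hcomp (m + n + 1 - int d) k * theta0 $ i" by (rule hcomp_mult[OF theta0_forms])
    finally show ?thesis unfolding k vector_smult_component by (rule sym)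
  qed
  then have "phi tt *s s - phi s *s tt = hcomp (m + n + 1 - int d) k *s theta0"
    by (simp add: vec_eq_iff)
  then show thesis using that hcomp_in_forms by blast
qed

text \<open>Since \<open>c\<close> is a unit, \<open>theta0\<close> lies in the span of
  \<open>s\<close> and \<open>tt\<close>, so it suffices to move a syzygy \<open>u\<close> into the
  kernel of \<open>phi\<close>. Eliminating \<open>u\<close> from its wedges with \<open>s\<close>
  and \<open>tt\<close> expresses \<open>phi u\<close> through \<open>phi s\<close> and
  \<open>phi tt\<close> and supplies the coefficients. Independence follows by eliminating between a
  relation, its image under \<open>phi\<close>, and the wedge.\<close>

lemma saito:
  assumes s: "s \<in> syz f" and tt: "tt \<in> syz f" and c: "c \<noteq> 0"
    and w: "phi tt *s s - phi s *s tt = const c *s theta0"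
  shows "s \<noteq> tt \<and> \<not> S3.dependent {s, tt}" "S3.span {s, tt} = syz f"
proof -
  let ?F = "phi s" and ?G = "phi tt"
  have wi: "?G * s $ i - ?F * tt $ i = const c * theta0 $ i" for i
    using arg_cong[OF w, of "\<lambda>x. x $ i"] by simp
  show "s \<noteq> tt \<and> \<not> S3.dependent {s, tt}"
    unfolding S3_independent_pair
  proof (intro allI impI)
    fix p q assume pq: "p *s s + q *s tt = 0"
    have pqi: "p * s $ i + q * tt $ i = 0" for i using arg_cong[OF pq, of "\<lambda>x. x $ i"] by simp
    have ph: "p * ?F + q * ?G = 0" using arg_cong[OF pq, of phi] by (simp add: phi_vec)
    have "(p * const c) * theta0 $ i = 0" "(q * const c) * theta0 $ i = 0" for i
      using wi[of i] pqi[of i] ph by Groebner_Basis.algebra+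
    then have "(p * const c) *s theta0 = 0 *s theta0" "(q * const c) *s theta0 = 0 *s theta0"
      by (simp_all add: vec_eq_iff)
    then have "p * const c = 0" "q * const c = 0" using scale_theta0_cancel by blast+
    then show "p = 0 \<and> q = 0" using c by simp
  qed
  show "S3.span {s, tt} = syz f"
  proof
    show "S3.span {s, tt} \<subseteq> syz f"
      using s tt by (auto simp: S3_span_pair syz_add syz_scale)
    show "syz f \<subseteq> S3.span {s, tt}"
    proof
      fix u assume u: "u \<in> syz f"
      let ?H = "phi u" and ?c = "const (inverse c)"
      have cc: "?c * const c = 1" using c by (simp add: const_inverse_left)
      obtain p where "?G *s u - ?H *s tt = p *s theta0" using wedge[OF u tt] .
      then have p: "?G * u $ i - ?H * tt $ i = p * theta0 $ i" for i
        by (metis vector_minus_component vector_smult_component)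
      obtain q where "?F *s u - ?H *s s = q *s theta0" using wedge[OF u s] .
      then have q: "?F * u $ i - ?H * s $ i = q * theta0 $ i" for i
        by (metis vector_minus_component vector_smult_component)
      have "(?H * const c) * theta0 $ i = (?F * p - ?G * q) * theta0 $ i" for i
        using wi[of i] p[of i] q[of i] by Groebner_Basis.algebra
      then have "(?H * const c) *s theta0 = (?F * p - ?G * q) *s theta0"
        unfolding vec_eq_iff vector_smult_component by blast
      then have H: "?H * const c = ?F * p - ?G * q" by (rule scale_theta0_cancel)
      \<comment> \<open>The combination is chosen to have the same image under \<open>phi\<close> as
        \<open>u\<close>.\<close>
      define u' where "u' = u - (?c * p) *s s + (?c * q) *s tt"
      have "phi u' = ?H - ?c * p * ?F + ?c * q * ?G" by (simp add: u'_def phi_vec)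
      also have "\<dots> = 0" using H cc by Groebner_Basis.algebra
      finally have "phi u' = 0" .
      moreover have "u' \<in> syz f" unfolding u'_def by (intro syz_add syz_diff syz_scale u s tt)
      ultimately obtain r where r0: "u' = r *s theta0" using kernel_phi by blast
      have r: "u $ i - ?c * p * s $ i + ?c * q * tt $ i = r * theta0 $ i" for i
        using arg_cong[OF r0[unfolded u'_def], of "\<lambda>x. x $ i"]
        by (simp only: vector_add_component vector_minus_component vector_smult_component)
      have "u $ i = (?c * p + r * ?c * ?G) * s $ i + (- ?c * q - r * ?c * ?F) * tt $ i" for i
        using r[of i] wi[of i] cc by Groebner_Basis.algebra
      then have "u = (?c * p + r * ?c * ?G) *s s + (- ?c * q - r * ?c * ?F) *s tt"
        unfolding vec_eq_iff vector_add_component vector_smult_component by blast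
      then show "u \<in> S3.span {s, tt}" unfolding S3_span_pair by blast
    qed
  qed
qed

text \<open>A syzygy with constant entries is a constant field tangent to every line, so its
  direction is a point on all of them. This gives the bounds \<open>a, b \<ge> 2\<close>.\<close>

lemma syz_degree_pos:
  assumes s: "s \<in> syz f" "\<And>i. s $ i \<in> forms j" "s \<noteq> 0"
  shows "j \<ge> 1"
proof (rule ccontr)
  assume "\<not> j \<ge> 1"
  then consider "j < 0" | "j = 0" by linarith
  then show False
  proof cases
    case 1
    then have "s $ i = 0" for i using s(2)[of i] by (simp add: forms_neg)
    then show False using s(3) by (simp add: vec_eq_iff)
  next
    case 2
    then have "\<forall>i. \<exists>c. s $ i = const c" using s(2) forms_degree_0 by blast
    from choice[OF this] obtain c where c: "\<And>i. s $ i = const (c i)" by blast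
    define e where "e = (\<chi> i. c i)"
    have se: "s = cvec e" by (simp add: cvec_def e_def c vec_eq_iff)
    have "e \<noteq> 0" using s(3) unfolding se by (auto simp: cvec_def vec_eq_iff)
    have "proj_point e \<in> L" if L: "L \<in> A" for L
    proof -
      have "lf (nv L) dvd const (dot (nv L) e)"
        using line_dvd_app[OF L, of s] s(1) by (simp add: syz_iff se)
      then have "dot (nv L) e = 0" using nv_A[OF L] by (simp add: lf_dvd_iff)
      then show ?thesis using nv(3) lines[OF L] proj_point_in_line[OF \<open>e \<noteq> 0\<close>] by metis
    qed
    then show False using nonconcurrent \<open>e \<noteq> 0\<close> unfolding concurrent_def by (metis proj_point_P2)
  qed
qed

lemma arr_poly_f: "arr_poly A = f"
  by (simp add: f_def)

text \<open>Expand \<open>theta0\<close> in the basis and insert it into the wedge of the basis.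
  Independence shows that the multiplier \<open>k\<close> divides both \<open>F\<close> and
  \<open>G\<close>, hence all of \<open>II\<close>, so it is a unit and has degree 0.\<close>

lemma free_imp_generated:
  assumes "free_with_exponents A (a - 1) (b - 1)"
  shows "(\<exists>F G. F \<in> forms a \<and> G \<in> forms b \<and> II = ideal.span {F, G}) \<and> a + b = int d + 1 \<and> a \<ge> 2 \<and> b \<ge> 2"
proof -
  obtain s tt where st: "\<And>i. s $ i \<in> forms (a - 1)" "\<And>i. tt $ i \<in> forms (b - 1)"
    "s \<noteq> tt \<and> \<not> S3.dependent {s, tt}" and span: "S3.span {s, tt} = syz f"
    using assms unfolding free_with_exponents_def arr_poly_f by blast
  have ind: "\<And>p q. p *s s + q *s tt = 0 \<Longrightarrow> p = 0 \<and> q = 0" using st(3) unfolding S3_independent_pair by blast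
  have s: "s \<in> syz f" and tt: "tt \<in> syz f" using span by (auto intro: S3.span_base)
  define F G where "F = phi s" and "G = phi tt"
  have FG: "F \<in> forms a" "G \<in> forms b"
    using phi_forms[of s "a - 1"] phi_forms[of tt "b - 1"] st by (simp_all add: F_def G_def)
  have II_eq: "II = ideal.span {F, G}"
  proof (rule Set.set_eqI)
    fix x
    have "x \<in> II \<longleftrightarrow> (\<exists>u\<in>S3.span {s, tt}. x = phi u)" by (simp only: II_def span image_iff)
    also have "\<dots> \<longleftrightarrow> (\<exists>p q. x = phi (p *s s + q *s tt))" unfolding Bex_def S3_span_pair by blast
    also have "\<dots> \<longleftrightarrow> x \<in> ideal.span {F, G}" by (simp add: span_pair phi_vec F_def G_def)
    finally show "x \<in> II \<longleftrightarrow> x \<in> ideal.span {F, G}" .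
  qed
  obtain k where k: "k \<in> forms (a - 1 + (b - 1) + 1 - int d)" "G *s s - F *s tt = k *s theta0"
    using wedge_forms[of s "a - 1" tt "b - 1"] s tt st unfolding F_def G_def by blast
  obtain p q where pq: "theta0 = p *s s + q *s tt"
    using theta0_syz unfolding span[symmetric] S3_span_pair by blast
  have "(G - k * p) *s s + (- F - k * q) *s tt = (G *s s - F *s tt) - k *s (p *s s + q *s tt)"
    by (simp add: vec_eq_iff algebra_simps)
  also have "\<dots> = 0" using k(2) pq by simp
  finally have "G - k * p = 0 \<and> - F - k * q = 0" by (rule ind)
  then have G: "G = k * p" and F: "F = k * (- q)" by Groebner_Basis.algebra+
  have "k \<noteq> 0"
  proof
    assume "k = 0"
    then have "II = {0}" using F G by (simp add: II_eq)
    then show False using II_elements(1) nonzero f_nonzero by simp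
  qed
  moreover have "k dvd x" if "x \<in> II" for x
    using that unfolding II_eq span_pair F G by auto
  ultimately have "k dvd 1" by (rule common_divisor_II)
  then obtain r where r: "1 = r * k" by (auto simp: dvd_def mult.commute)
  \<comment> \<open>The degree 0 part of \<open>r * k\<close> shows that the form \<open>k\<close>
    has degree at most 0; being nonzero, it has degree at least 0.\<close>
  have "(1::'a poly3) = hcomp 0 (r * k)" using r by (metis hcomp_forms one_in_forms)
  also have "\<dots> = hcomp (0 - (a - 1 + (b - 1) + 1 - int d)) r * k" by (rule hcomp_mult[OF k(1)])
  finally have "hcomp (0 - (a - 1 + (b - 1) + 1 - int d)) r \<noteq> 0" by auto
  then have "\<not> 0 - (a - 1 + (b - 1) + 1 - int d) < 0"
    using hcomp_in_forms forms_neg by (metis singletonD)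
  moreover have "\<not> a - 1 + (b - 1) + 1 - int d < 0"
    using k(1) \<open>k \<noteq> 0\<close> forms_neg by (metis singletonD)
  ultimately have "a + b = int d + 1" by linarith
  moreover have "s \<noteq> 0" using ind[of 1 0] by auto
  moreover have "tt \<noteq> 0" using ind[of 0 1] by auto
  ultimately show ?thesis
    using syz_degree_pos[OF s st(1)] syz_degree_pos[OF tt st(2)] FG II_eq by fastforce
qed

text \<open>The degrees make the multiplier a constant \<open>c\<close>; the issue is
  \<open>c \<noteq> 0\<close>. If \<open>c = 0\<close>, then \<open>s\<close> and \<open>tt\<close>
  are proportional over the fraction field, and so are the lifts \<open>?u\<close> and
  \<open>?u'\<close> of \<open>lf y * f\<close> and \<open>lf z * f\<close>. This makes
  \<open>?u\<close> divisible by \<open>lf y\<close>, and the quotient has determinant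
  \<open>f\<close>, although values of \<open>phi\<close> vanish at \<open>v\<close> and
  \<open>f\<close> does not.\<close>

lemma generated_wedge:
  assumes F: "F \<in> forms a" and G: "G \<in> forms b" and II: "II = ideal.span {F, G}" and ab: "a + b = int d + 1"
  obtains s tt c where "s \<in> syz f" "tt \<in> syz f" "\<And>i. s $ i \<in> forms (a - 1)" "\<And>i. tt $ i \<in> forms (b - 1)"
    "phi s = F" "phi tt = G" "c \<noteq> 0" "phi tt *s s - phi s *s tt = const c *s theta0"
proof -
  have "F \<in> II" "G \<in> II" by (simp_all add: II ideal.span_base)
  then obtain s tt where s: "s \<in> syz f" "\<And>i. s $ i \<in> forms (a - 1)" "phi s = F"
    and tt: "tt \<in> syz f" "\<And>i. tt $ i \<in> forms (b - 1)" "phi tt = G"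
    using II_lift[OF _ F] II_lift[OF _ G] by metis
  obtain k where k: "k \<in> forms (a - 1 + (b - 1) + 1 - int d)" "phi tt *s s - phi s *s tt = k *s theta0"
    using wedge_forms[OF s(1,2) tt(1,2)] .
  then obtain c where c: "k = const c" using ab forms_degree_0[of k] by auto
  obtain p q where pq: "lf y * f = p * F + q * G" using II_elements(1) unfolding II span_pair by blast
  obtain p' q' where pq': "lf z * f = p' * F + q' * G" using II_elements(2) unfolding II span_pair by blast
  let ?u = "p *s s + q *s tt" and ?u' = "p' *s s + q' *s tt"
  have "c \<noteq> 0"
  proof
    assume "c = 0"
    then have "G *s s = F *s tt" using k(2) c s tt by simp
    then have st: "G * s $ i = F * tt $ i" for i by (metis vector_smult_component)
    \<comment> \<open>Stated for general \<open>H\<close> and \<open>w\<close> to cover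
      \<open>F\<close> with \<open>s\<close>, or \<open>G\<close> with \<open>tt\<close> when
      \<open>F = 0\<close>.\<close>
    have contra: False if H: "H \<noteq> 0" and u: "\<And>i. H * ?u $ i = lf y * f * w $ i" "\<And>i. H * ?u' $ i = lf z * f * w $ i" for H and w :: "'a poly3 ^ 3"
    proof -
      have zy: "lf z * ?u $ i = lf y * ?u' $ i" for i
      proof -
        have "H * (lf z * ?u $ i) = H * (lf y * ?u' $ i)" using u[of i] by Groebner_Basis.algebra
        then show ?thesis using H mult_left_cancel by blast
      qed
      have "\<exists>r. ?u $ i = lf y * r" for i
      proof -
        have "lf y dvd lf z * ?u $ i" unfolding zy by simp
        then show ?thesis
          using prime_elem_dvd_mult_iff[OF prime_lf[OF nonzero(2)]] lf_dvd_lf_iff nonzero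
          by (metis dvdE)
      qed
      then obtain r where r: "\<And>i. ?u $ i = lf y * r i" by metis
      have "?u = lf y *s (\<chi> i. r i)" by (simp add: vec_eq_iff r del: vector_add_component)
      then have "phi ?u = lf y * phi (\<chi> i. r i)" by (simp only: phi_vec)
      then have "lf y * f = lf y * phi (\<chi> i. r i)" using pq s tt by (simp add: phi_vec)
      then have "f = phi (\<chi> i. r i)" using nonzero by simp
      then show False using phi_in_span span_yz_eval general' by metis
    qed
    show False
    proof (cases "F = 0")
      case False
      show False
      proof (rule contra[OF False])
        fix i
        show "F * ?u $ i = lf y * f * s $ i" "F * ?u' $ i = lf z * f * s $ i"
          using st[of i] pq pq' unfolding vector_add_component vector_smult_component by Groebner_Basis.algebra+
      qed
    next
      case True
      then have "G \<noteq> 0" using pq nonzero f_nonzero by auto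
      then show False
      proof (rule contra)
        fix i
        show "G * ?u $ i = lf y * f * tt $ i" "G * ?u' $ i = lf z * f * tt $ i"
          using st[of i] pq pq' unfolding vector_add_component vector_smult_component by Groebner_Basis.algebra+
      qed
    qed
  qed
  then show thesis using that s tt k c by blast
qed

section \<open>Saturation of the Jacobian ideal\<close>

lemma jac_iff: "h \<in> jac f \<longleftrightarrow> (\<exists>s. h = der s f)"
proof
  assume "h \<in> jac f"
  then show "\<exists>s. h = der s f"
    unfolding jac_def
  proof (induction rule: ideal.span_induct_alt)
    case base
    have "0 = der 0 f" by (simp add: der_vec)
    then show ?case by blast
  next
    case (step c x p)
    then obtain i s where x: "x = pdiff i f" and p: "p = der s f" by blast
    have "pdiff i f = der (axis i 1) f"
      unfolding der_def axis_def by (simp add: if_distrib[of "\<lambda>x. x * _"] cong: if_cong)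
    then have "c * x + p = der (c *s axis i 1 + s) f" by (simp add: x p der_vec)
    then show ?case by blast
  qed
qed (auto simp: der_in_jac)

text \<open>If \<open>X i * h = der (c i) f\<close>, then the differences
  \<open>X k *s c i - X i *s c k\<close> are syzygies. Their Koszul identity passes to their
  coefficients in the basis by independence, and exactness says how to correct \<open>c i\<close> by
  syzygies so that these differences vanish. The corrected \<open>c 1\<close> is then divisible by
  \<open>X 1\<close>, and the quotient represents \<open>h\<close>.\<close>

lemma saturated_of_basis:
  assumes ind: "\<And>p q. p *s s + q *s tt = 0 \<Longrightarrow> p = 0 \<and> q = 0" and span: "S3.span {s, tt} = syz f"
    and h: "\<And>i. X i * h \<in> jac f"
  shows "h \<in> jac f"
proof -
  have "\<forall>i. \<exists>c. X i * h = der c f" using h jac_iff by blast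
  from choice[OF this] obtain c where c: "\<And>i. X i * h = der (c i) f" by blast
  have wk: "\<exists>p q. X k *s c i - X i *s c k = p *s s + q *s tt" for i k
  proof -
    have "der (X k *s c i - X i *s c k) f = X k * (X i * h) - X i * (X k * h)" by (simp only: der_vec c)
    also have "\<dots> = 0" by Groebner_Basis.algebra
    finally have "X k *s c i - X i *s c k \<in> S3.span {s, tt}" unfolding span syz_iff .
    then show ?thesis unfolding S3_span_pair .
  qed
  obtain p1 q1 where 1: "X 2 *s c 3 - X 3 *s c 2 = p1 *s s + q1 *s tt" using wk by blast
  obtain p2 q2 where 2: "X 3 *s c 1 - X 1 *s c 3 = p2 *s s + q2 *s tt" using wk by blast
  obtain p3 q3 where 3: "X 1 *s c 2 - X 2 *s c 1 = p3 *s s + q3 *s tt" using wk by blast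
  have comp: "X 2 * c 3 $ i - X 3 * c 2 $ i = p1 * s $ i + q1 * tt $ i"
    "X 3 * c 1 $ i - X 1 * c 3 $ i = p2 * s $ i + q2 * tt $ i"
    "X 1 * c 2 $ i - X 2 * c 1 $ i = p3 * s $ i + q3 * tt $ i" for i
    using arg_cong[OF 1, of "\<lambda>x. x $ i"] arg_cong[OF 2, of "\<lambda>x. x $ i"] arg_cong[OF 3, of "\<lambda>x. x $ i"]
    by (simp_all only: vector_add_component vector_minus_component vector_smult_component)
  have "(X 1 * p1 + X 2 * p2 + X 3 * p3) * s $ i + (X 1 * q1 + X 2 * q2 + X 3 * q3) * tt $ i = 0" for i
    using comp[of i] by Groebner_Basis.algebra
  then have "(X 1 * p1 + X 2 * p2 + X 3 * p3) *s s + (X 1 * q1 + X 2 * q2 + X 3 * q3) *s tt = 0"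
    unfolding vec_eq_iff vector_add_component vector_smult_component zero_index by blast
  from ind[OF this] have pq: "X 1 * p1 + X 2 * p2 + X 3 * p3 = 0" "X 1 * q1 + X 2 * q2 + X 3 * q3 = 0" by auto
  obtain \<alpha> \<beta> \<gamma> where p: "p1 = X 2 * \<gamma> - X 3 * \<beta>" "p2 = X 3 * \<alpha> - X 1 * \<gamma>" "p3 = X 1 * \<beta> - X 2 * \<alpha>"
    using koszul[OF pq(1)] .
  obtain \<alpha>' \<beta>' \<gamma>' where q: "q1 = X 2 * \<gamma>' - X 3 * \<beta>'" "q2 = X 3 * \<alpha>' - X 1 * \<gamma>'" "q3 = X 1 * \<beta>' - X 2 * \<alpha>'"
    using koszul[OF pq(2)] .
  \<comment> \<open>Subtracting syzygies leaves \<open>der (c i) f\<close> unchanged.\<close>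
  define c1 where "c1 = c 1 - \<alpha> *s s - \<alpha>' *s tt"
  define c2 where "c2 = c 2 - \<beta> *s s - \<beta>' *s tt"
  have ci: "c1 $ i = c 1 $ i - \<alpha> * s $ i - \<alpha>' * tt $ i" "c2 $ i = c 2 $ i - \<beta> * s $ i - \<beta>' * tt $ i" for i
    by (simp_all only: c1_def c2_def vector_minus_component vector_smult_component)
  have cprop: "X 1 * c2 $ i = X 2 * c1 $ i" for i
    using comp(3)[of i] p(3) q(3) unfolding ci by Groebner_Basis.algebra
  have "\<exists>r. c1 $ i = X 1 * r" for i
  proof -
    have "X 1 dvd X 2 * c1 $ i" using cprop[of i] by (metis dvd_triv_left)
    then have "X 1 dvd c1 $ i" using prime_elem_dvd_mult_iff[OF prime_X[where 'a = 'a]] X_not_dvd_X[of 1 2, where 'a = 'a] by auto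
    then show ?thesis by (auto simp: dvd_def)
  qed
  then have "\<forall>i. \<exists>r. c1 $ i = X 1 * r" by blast
  from choice[OF this] obtain r where r: "\<And>i. c1 $ i = X 1 * r i" by blast
  have "s \<in> syz f" "tt \<in> syz f" unfolding span[symmetric] by (simp_all add: S3.span_base)
  then have st: "der s f = 0" "der tt f = 0" by (simp_all add: syz_iff)
  have "c1 = X 1 *s (\<chi> i. r i)" unfolding vec_eq_iff vector_smult_component using r by simp
  then have "der c1 f = X 1 * der (\<chi> i. r i) f" by (simp only: der_vec)
  moreover have "der c1 f = X 1 * h" unfolding c1_def der_vec c[symmetric] st by simp
  ultimately have "X 1 * h = X 1 * der (\<chi> i. r i) f" by simp
  then have "h = der (\<chi> i. r i) f" by simp
  then show ?thesis unfolding jac_iff by blast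
qed

lemma basis_imp_free:
  assumes st: "s \<noteq> tt \<and> \<not> S3.dependent {s, tt}" and span: "S3.span {s, tt} = syz f"
    and s: "\<And>i. s $ i \<in> forms e" and tt: "\<And>i. tt $ i \<in> forms e'"
  shows "free_with_exponents A e e'"
proof -
  have ind: "\<And>p q. p *s s + q *s tt = 0 \<Longrightarrow> p = 0 \<and> q = 0" using st unfolding S3_independent_pair by blast
  have "g \<in> jac f" if "g \<in> colon (jac f) (ideal_power irrelevant k)" for g k
    using that
  proof (induction k arbitrary: g)
    case 0
    then have "g * 1 \<in> jac f" unfolding colon_def ideal_power.simps by blast
    then show ?case by simp
  next
    case (Suc k)
    \<comment> \<open>One power of the irrelevant ideal is removed at a time, by multiplying with
      the variables only.\<close>
    have "g * h \<in> jac f" if h: "h \<in> ideal_power irrelevant k" for h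
    proof (rule saturated_of_basis[OF ind span])
      fix i
      have "X i \<in> irrelevant" unfolding irrelevant_def by (simp add: ideal.span_base)
      then have "X i * h \<in> ideal_power irrelevant (Suc k)"
        unfolding ideal_power.simps using h by (intro ideal.span_base) blast
      then have "g * (X i * h) \<in> jac f" using Suc.prems unfolding colon_def by blast
      then show "X i * (g * h) \<in> jac f" by (simp add: mult.left_commute)
    qed
    then show ?case by (intro Suc.IH) (simp add: colon_def)
  qed
  moreover have "jac f \<subseteq> colon (jac f) (ideal_power irrelevant 0)"
  proof
    fix g assume "g \<in> jac f"
    then have "h * g \<in> jac f" for h unfolding jac_def by (rule ideal.span_scale)
    then show "g \<in> colon (jac f) (ideal_power irrelevant 0)"
      unfolding colon_def by (simp add: mult.commute)
  qed
  ultimately have "saturated (jac f)" unfolding saturated_def by blast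
  then show ?thesis
    unfolding free_with_exponents_def free_arr_def arr_poly_f using st span s tt by blast
qed

lemma generated_imp_free:
  assumes "F \<in> forms a" "G \<in> forms b" "II = ideal.span {F, G}" "a + b = int d + 1"
  shows "free_with_exponents A (a - 1) (b - 1)"
proof -
  obtain s tt c where st: "s \<in> syz f" "tt \<in> syz f" "\<And>i. s $ i \<in> forms (a - 1)" "\<And>i. tt $ i \<in> forms (b - 1)"
    "phi s = F" "phi tt = G" "c \<noteq> 0" "phi tt *s s - phi s *s tt = const c *s theta0"
    using generated_wedge[OF assms] by blast
  show ?thesis using basis_imp_free saito[OF st(1,2,7,8)] st(3,4) by blast
qed

text \<open>A relation \<open>p * F = q * G\<close> lifts to a syzygy
  \<open>p *s s - q *s tt\<close> in the kernel of \<open>phi\<close>, hence to a multiple of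
  \<open>theta0\<close>, which is \<open>G *s s - F *s tt\<close> up to the unit \<open>c\<close>.
  Comparing coefficients in the basis shows \<open>F dvd q\<close>. If \<open>F = 0\<close>, then
  \<open>G\<close> would be a unit by \<open>common_divisor_II\<close>, but it vanishes at
  \<open>v\<close>.\<close>

lemma hilb_generated:
  assumes F: "F \<in> forms a" and G: "G \<in> forms b" and II: "II = ideal.span {F, G}" and ab: "a + b = int d + 1"
  shows "hilb II j = sdim j - sdim (j - a) - sdim (j - b) + sdim (j - a - b)"
    and "p * F = q * G \<Longrightarrow> F dvd q" and "F \<noteq> 0"
proof -
  obtain s tt c where st: "s \<in> syz f" "tt \<in> syz f" "phi s = F" "phi tt = G" "c \<noteq> 0"
    "phi tt *s s - phi s *s tt = const c *s theta0"
    using generated_wedge[OF assms] by metis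
  have ind: "\<And>p q. p *s s + q *s tt = 0 \<Longrightarrow> p = 0 \<and> q = 0"
    using saito(1)[OF st(1,2,5,6)] unfolding S3_independent_pair by blast
  have coprime: "F dvd q" if pq: "p * F = q * G" for p q
  proof -
    have "phi (p *s s - q *s tt) = 0" using pq by (simp add: phi_vec st)
    then obtain m where m: "p *s s - q *s tt = m *s theta0"
      using kernel_phi[OF syz_diff[OF syz_scale[OF st(1)] syz_scale[OF st(2)]]] by blast
    have c: "const (inverse c) * const c = 1" using st(5) by (simp add: const_inverse_left)
    have "(p - m * const (inverse c) * G) * s $ i + (m * const (inverse c) * F - q) * tt $ i = 0" for i
      using arg_cong[OF m, of "\<lambda>x. x $ i"] arg_cong[OF st(6), of "\<lambda>x. x $ i"] c
      unfolding st vector_minus_component vector_smult_component by Groebner_Basis.algebra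
    then have "(p - m * const (inverse c) * G) *s s + (m * const (inverse c) * F - q) *s tt = 0"
      unfolding vec_eq_iff vector_add_component vector_smult_component zero_index by blast
    from ind[OF this] have "q = F * (m * const (inverse c))" by (simp add: mult.commute)
    then show "F dvd q" by simp
  qed
  then show "p * F = q * G \<Longrightarrow> F dvd q" .
  show F0: "F \<noteq> 0"
  proof
    assume "F = 0"
    then have "G \<noteq> 0" using II_elements(1) nonzero f_nonzero unfolding II span_pair by auto
    have "G dvd x" if "x \<in> II" for x using that \<open>F = 0\<close> unfolding II span_pair by auto
    then have "G dvd 1" using common_divisor_II \<open>G \<noteq> 0\<close> by blast
    then obtain r where "1 = G * r" by (rule dvdE)
    then have "eval 1 v = eval G v * eval r v" by (metis eval_simps(6))
    moreover have "eval G v = 0" using st(4) phi_in_span span_yz_eval by metis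
    ultimately show False by simp
  qed
  have Ij: "II \<inter> forms j = {p * F + q * G | p q. p \<in> forms (j - a) \<and> q \<in> forms (j - b)}"
  proof (intro Set.set_eqI iffI)
    fix x assume "x \<in> II \<inter> forms j"
    then obtain p q where x: "x = p * F + q * G" "x \<in> forms j" unfolding Int_iff II span_pair by blast
    then have "x = hcomp j (p * F + q * G)" by (metis hcomp_forms)
    also have "\<dots> = hcomp (j - a) p * F + hcomp (j - b) q * G"
      by (simp add: hcomp_add hcomp_mult[OF F] hcomp_mult[OF G])
    finally show "x \<in> {p * F + q * G | p q. p \<in> forms (j - a) \<and> q \<in> forms (j - b)}"
      using hcomp_in_forms by blast
  next
    fix x assume "x \<in> {p * F + q * G | p q. p \<in> forms (j - a) \<and> q \<in> forms (j - b)}"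
    then obtain p q where x: "x = p * F + q * G" "p \<in> forms (j - a)" "q \<in> forms (j - b)" by blast
    have "p * F \<in> forms (j - a + a)" "q * G \<in> forms (j - b + b)" by (intro forms_mult x F G)+
    then have "x \<in> forms j" by (simp add: x forms_add)
    then show "x \<in> II \<inter> forms j" using x unfolding Int_iff II span_pair by blast
  qed
  show "hilb II j = sdim j - sdim (j - a) - sdim (j - b) + sdim (j - a - b)"
    by (rule hilb_complete_intersection[OF II_ideal F F0 G Ij coprime])
qed

text \<open>Since \<open>a + b - 3 = d - 2\<close>, the symmetry is
  \<open>sdim_complete_intersection\<close>. Read at negative arguments it gives the eventual value
  \<open>a * b\<close>; read at 0, where the Hilbert function is 1, it gives the last claim.\<close>

lemma generated_symmetric:
  assumes F: "F \<in> forms a" and G: "G \<in> forms b" and II: "II = ideal.span {F, G}" and ab: "a + b = int d + 1"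
    and a2: "a \<ge> 2" and b2: "b \<ge> 2"
  shows "scheme_degree II = a * b" "hilb II (int d - 2 - j) = scheme_degree II - hilb II j"
    "hilb II (int d - 2) = scheme_degree II - 1"
proof -
  note h = hilb_generated(1)[OF F G II ab]
  have sym: "hilb II (int d - 2 - j) = a * b - hilb II j" for j
  proof -
    have e: "int d - 2 - j = a + b - 3 - j" using ab by linarith
    have "hilb II (a + b - 3 - j) = a * b - hilb II j"
      using sdim_complete_intersection[of j a b] unfolding h by linarith
    then show ?thesis unfolding e .
  qed
  have neg: "hilb II j = 0" if "j < 0" for j
    unfolding h using that a2 b2 by (simp add: sdim_def)
  have large: "hilb II j = a * b" if "j \<ge> int d - 1" for j
    using sym[of j] neg[of "int d - 2 - j"] that by simp
  show deg: "scheme_degree II = a * b"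
    unfolding scheme_degree_def
  proof (rule the_equality)
    show "\<exists>j0. \<forall>j\<ge>j0. hilb II j = a * b" using large by blast
  next
    fix n assume "\<exists>j0. \<forall>j\<ge>j0. hilb II j = n"
    then obtain j0 where "\<forall>j\<ge>j0. hilb II j = n" by blast
    then show "n = a * b" using large[of "max j0 (int d - 1)"] by simp
  qed
  show "hilb II (int d - 2 - j) = scheme_degree II - hilb II j" unfolding deg by (rule sym)
  have "hilb II 0 = 1" unfolding h using a2 b2 by (simp add: sdim_def)
  then show "hilb II (int d - 2) = scheme_degree II - 1" using sym[of 0] deg by simp
qed

text \<open>Comparing the expansions of \<open>lf m * w\<close> and \<open>lf n * w\<close> in
  \<open>F\<close> and \<open>G\<close> gives a relation whose \<open>G\<close>-coefficient is
  divisible by \<open>F\<close>. That coefficient has degree \<open>d - b = a - 1\<close>, so it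
  vanishes, and both coefficients of \<open>lf m * w\<close> are divisible by
  \<open>lf m\<close>.\<close>

lemma generated_socle:
  assumes F: "F \<in> forms a" and G: "G \<in> forms b" and II: "II = ideal.span {F, G}" and ab: "a + b = int d + 1"
    and m: "m \<noteq> 0" and n: "\<not> proportional m n"
    and w: "w \<in> forms (int d - 2)" and mw: "lf m * w \<in> II" and nw: "lf n * w \<in> II"
  shows "w \<in> II"
proof -
  have lift: "\<exists>p q. x = p * F + q * G \<and> p \<in> forms (int d - 1 - a) \<and> q \<in> forms (int d - 1 - b)"
    if x12: "x \<in> II" "x \<in> forms (int d - 1)" for x
  proof -
    obtain p q where x: "x = p * F + q * G" using x12(1) unfolding II span_pair by blast
    then have "x = hcomp (int d - 1) (p * F + q * G)" using x12(2) by (metis hcomp_forms)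
    also have "\<dots> = hcomp (int d - 1 - a) p * F + hcomp (int d - 1 - b) q * G"
      by (simp add: hcomp_add hcomp_mult[OF F] hcomp_mult[OF G])
    finally show ?thesis using hcomp_in_forms by blast
  qed
  have deg: "lf m' * w \<in> forms (int d - 1)" for m' using forms_mult[OF lf_in_forms w, of m'] by simp
  obtain p q where pq: "lf m * w = p * F + q * G" "p \<in> forms (int d - 1 - a)" "q \<in> forms (int d - 1 - b)"
    using lift[OF mw deg] by blast
  obtain p' q' where pq': "lf n * w = p' * F + q' * G" "p' \<in> forms (int d - 1 - a)" "q' \<in> forms (int d - 1 - b)"
    using lift[OF nw deg] by blast
  have eq: "(lf n * p - lf m * p') * F = (lf m * q' - lf n * q) * G"
    using pq(1) pq'(1) by Groebner_Basis.algebra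
  then have "F dvd lf m * q' - lf n * q" by (rule hilb_generated(2)[OF F G II ab])
  then obtain r where r: "lf m * q' - lf n * q = r * F" by (auto simp: dvd_def mult.commute)
  have "lf m * q' - lf n * q \<in> forms (1 + (int d - 1 - b))" by (intro forms_diff forms_mult lf_in_forms pq pq')
  then have "lf m * q' - lf n * q \<in> forms (int d - b)" by (simp add: algebra_simps)
  then have "lf m * q' - lf n * q = hcomp (int d - b) (r * F)" using r by (metis hcomp_forms)
  also have "\<dots> = hcomp (int d - b - a) r * F" by (rule hcomp_mult[OF F])
  \<comment> \<open>The degree \<open>d - b - a\<close> is -1.\<close>
  also have "hcomp (int d - b - a) r = 0" 
  proof -
    have neg: "int d - b - a < 0" using ab by simp
    show ?thesis using hcomp_in_forms[of "int d - b - a" r] unfolding forms_neg[OF neg] by (rule singletonD)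
  qed
  finally have q0: "lf m * q' = lf n * q" by simp
  then have "(lf n * p - lf m * p') * F = 0" using eq by simp
  then have p0: "lf m * p' = lf n * p" using hilb_generated(3)[OF F G II ab] by simp
  have div: "\<exists>u. x = lf m * u" if "lf m * x' = lf n * x" for x x'
  proof -
    have "lf m dvd lf n * x" using that by (metis dvd_triv_left)
    then show ?thesis
      using prime_elem_dvd_mult_iff[OF prime_lf[OF m]] lf_dvd_lf_iff[OF m] n by (auto simp: dvd_def)
  qed
  obtain p1 q1 where "p = lf m * p1" "q = lf m * q1" using div[OF p0] div[OF q0] by blast
  then have "lf m * w = lf m * (p1 * F + q1 * G)" using pq(1) by Groebner_Basis.algebra
  then have "w = p1 * F + q1 * G" using m by simp
  then show ?thesis unfolding II span_pair by blast
qed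

text \<open>Cancelling the gcd \<open>H\<close> of \<open>F\<close> and \<open>G\<close> shows that
  the cofactor \<open>F'\<close> divides every entry of \<open>s\<close>. The quotient is a syzygy
  with determinant \<open>H\<close>, so \<open>H\<close> lies in \<open>II\<close>, and minimality
  of \<open>a\<close> leaves no room for a nonconstant \<open>F'\<close>.\<close>

lemma minimal_divides:
  assumes F: "F \<in> forms a" "F \<noteq> 0" and min: "\<And>j. j < a \<Longrightarrow> II \<inter> forms j = {0}"
    and s: "s \<in> syz f" "phi s = F" and st: "\<And>i. G * s $ i = F * tt $ i"
  shows "F dvd G"
proof -
  obtain H F' G' where H: "F = H * F'" "G = H * G'" and strip: "\<And>w. F' dvd G' * w \<Longrightarrow> F' dvd w"
    using ufd_split[OF F(2), of G] by blast
  have nz: "H \<noteq> 0" "F' \<noteq> 0" using F(2) H(1) by auto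
  have "\<exists>r. s $ i = F' * r" for i
  proof -
    have "H * (G' * s $ i) = H * (F' * tt $ i)" using st[of i] H by (simp add: mult.assoc)
    then have "G' * s $ i = F' * tt $ i" using nz by simp
    then have "F' dvd G' * s $ i" by simp
    then show ?thesis using strip by (auto simp: dvd_def)
  qed
  then have "\<forall>i. \<exists>r. s $ i = F' * r" by blast
  from choice[OF this] obtain r where r: "\<And>i. s $ i = F' * r i" by blast
  define s' where "s' = (\<chi> i. r i)"
  have s': "s = F' *s s'" unfolding vec_eq_iff vector_smult_component s'_def using r by simp
  have "F' * der s' f = 0" using s(1) unfolding syz_iff s' der_vec .
  then have "s' \<in> syz f" using nz by (simp add: syz_iff)
  have "F' * phi s' = F' * H" using s(2) H(1) unfolding s' phi_vec by (simp add: mult.commute)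
  then have "phi s' = H" using nz by simp
  then have "H \<in> II" using \<open>s' \<in> syz f\<close> by (auto simp: II_def)
  \<comment> \<open>\<open>H\<close> and \<open>F'\<close> come from unique factorization and are
    not known to be homogeneous, so degrees are compared through top components.\<close>
  have ge: "k \<ge> a" if "hcomp k H \<noteq> 0" for k
    using that II_hcomp[OF \<open>H \<in> II\<close>, of k] min[of k] hcomp_in_forms[of k H] by (metis IntI not_less singletonD)
  obtain i where i: "i \<ge> 0" "hcomp i H \<noteq> 0" "\<And>k. k > i \<Longrightarrow> hcomp k H = 0" using hcomp_top_exists[OF nz(1)] by blast
  obtain j where j: "j \<ge> 0" "hcomp j F' \<noteq> 0" "\<And>k. k > j \<Longrightarrow> hcomp k F' = 0" using hcomp_top_exists[OF nz(2)] by blast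
  have "hcomp (i + j) F \<noteq> 0"
    unfolding H(1) using hcomp_top_mult[OF i(3) j(3)] i(2) j(2) by simp
  then have "i + j = a" using hcomp_forms[OF F(1), of "i + j"] by (simp split: if_splits)
  then have "j = 0" using ge[OF i(2)] j(1) by linarith
  then have "F' = hcomp 0 F'" using eq_hcomp_0[of F'] j(3) by blast
  then obtain c where c: "F' = const c" using forms_degree_0[OF hcomp_in_forms] by metis
  then have "c \<noteq> 0" using nz by auto
  then have "F dvd H * 1" unfolding H(1) c by (intro mult_dvd_mono dvd_refl const_dvd)
  then show "F dvd G" unfolding H(2) by (simp add: dvd_mult2)
qed

lemma sdim_step: "sdim j - sdim (j - 1) = (if j \<ge> 0 then j + 1 else 0)"
proof (cases "j = 0")
  case False
  then show ?thesis
    using sdim_double[of j] sdim_double[of "j - 1"] by (auto simp: algebra_simps split: if_splits)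
qed (simp add: sdim_def)

text \<open>The constant \<open>N\<close> cancels: the contradiction comes from first differences of
  the Hilbert function, which the symmetry exchanges between degrees near \<open>a\<close> and near
  \<open>b\<close>.\<close>

lemma symmetric_imp_free:
  assumes sym: "\<And>j. hilb II (int d - 2 - j) = N - hilb II j"
  shows "\<exists>a b. free_with_exponents A (a - 1) (b - 1)"
proof -
  let ?P = "\<lambda>n. II \<inter> forms (int n) \<noteq> {0}"
  have "lf y * f \<in> forms (1 + int d)" by (intro forms_mult lf_in_forms f_forms)
  then have "lf y * f \<in> II \<inter> forms (int (Suc d))" using II_elements(1) by (simp add: add.commute)
  moreover have "lf y * f \<noteq> 0" using nonzero f_nonzero by simp
  ultimately have "?P (Suc d)" by blast
  then have PL: "?P (LEAST n. ?P n)" by (rule LeastI)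
  define a where "a = int (LEAST n. ?P n)"
  have zero: "0 \<in> II" using II_ideal by (simp add: ideal.subspace_def)
  have min: "II \<inter> forms j = {0}" if "j < a" for j
  proof (cases "j < 0")
    case True
    then show ?thesis using zero by (auto simp: forms_neg)
  next
    case False
    then have "nat j < (LEAST n. ?P n)" using that by (simp add: a_def nat_less_iff)
    then show ?thesis using not_less_Least[of "nat j" ?P] False by simp
  qed
  obtain F where F: "F \<in> II" "F \<in> forms a" "F \<noteq> 0"
    using PL zero forms_0 unfolding a_def by blast
  obtain s where s: "s \<in> syz f" "\<And>i. s $ i \<in> forms (a - 1)" "phi s = F" using II_lift[OF F(1,2)] by blast
  have "s \<noteq> 0" using s(3) F(3) phi_vec(4) by auto
  have a1: "a \<ge> 1" using syz_degree_pos[OF s(1,2) \<open>s \<noteq> 0\<close>] by simp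
  define b where "b = int d + 1 - a"
  have h_small: "hilb II j = sdim j" if "j < a" for j using hilb_trivial min[OF that] .
  \<comment> \<open>Suppose \<open>II\<close> has only multiples of \<open>F\<close> up to degree
    \<open>b\<close>. If \<open>a \<le> b\<close>, the difference from \<open>b - 1\<close> to
    \<open>b\<close> is \<open>a\<close>, but the symmetric one from \<open>a - 3\<close> to
    \<open>a - 2\<close> is \<open>a - 1\<close>. If \<open>a > b\<close>, the difference from
    \<open>a - 2\<close> to \<open>a - 1\<close> is \<open>a\<close>, but the one from
    \<open>b - 2\<close> to \<open>b - 1\<close> is smaller.\<close>
  have "\<exists>j\<le>b. \<exists>G\<in>II \<inter> forms j. \<not> F dvd G"
  proof (rule ccontr)
    assume none: "\<not> ?thesis"
    have h_b: "hilb II j = sdim j - sdim (j - a)" if jb: "j \<le> b" for j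
    proof (rule hilb_principal[OF F(2,3)])
      show "II \<inter> forms j = mult_image F (j - a)"
      proof (intro Set.set_eqI iffI)
        fix x assume x: "x \<in> II \<inter> forms j"
        then obtain q where q: "x = q * F" using none jb by (auto simp: dvd_def mult.commute)
        then have "x = hcomp j (q * F)" using x hcomp_forms[of x j j] by simp
        then have "x = hcomp (j - a) q * F" unfolding hcomp_mult[OF F(2)] .
        then show "x \<in> mult_image F (j - a)" using hcomp_in_forms by blast
      next
        fix x assume "x \<in> mult_image F (j - a)"
        then obtain q where q: "q \<in> forms (j - a)" "x = q * F" by blast
        then have "x \<in> forms j" using forms_mult[OF q(1) F(2)] by simp
        moreover have "x \<in> II" using F(1) II_ideal q(2) by (simp add: ideal.subspace_def)
        ultimately show "x \<in> II \<inter> forms j" by blast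
      qed
    qed
    show False
    proof (cases "a \<le> b")
      case True
      have e: "int d - 2 - (a - 3) = b" "int d - 2 - (a - 2) = b - 1" by (simp_all add: b_def)
      have 1: "hilb II b = N - sdim (a - 3)" using sym[of "a - 3"] h_small[of "a - 3"] e by simp
      have 2: "hilb II (b - 1) = N - sdim (a - 2)" using sym[of "a - 2"] h_small[of "a - 2"] e by simp
      have "sdim b - sdim (b - a) = N - sdim (a - 3)" using 1 h_b[of b] by simp
      moreover have "sdim (b - 1) - sdim (b - 1 - a) = N - sdim (a - 2)" using 2 h_b[of "b - 1"] by simp
      moreover have "sdim b - sdim (b - 1) = b + 1" using sdim_step[of b] True a1 by simp
      moreover have "sdim (b - a) - sdim (b - 1 - a) = b - a + 1" using sdim_step[of "b - a"] True by (simp add: algebra_simps)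
      moreover have "sdim (a - 2) - sdim (a - 3) = a - 1" using sdim_step[of "a - 2"] a1 by (cases "a = 1") auto
      ultimately show False by linarith
    next
      case False
      have e: "int d - 2 - (a - 2) = b - 1" "int d - 2 - (a - 1) = b - 2" by (simp_all add: b_def)
      have "sdim (b - 1) = N - sdim (a - 2)" using sym[of "a - 2"] h_small[of "a - 2"] h_small[of "b - 1"] e False by simp
      moreover have "sdim (b - 2) = N - sdim (a - 1)" using sym[of "a - 1"] h_small[of "a - 1"] h_small[of "b - 2"] e False by simp
      moreover have "sdim (a - 1) - sdim (a - 2) = a" using sdim_step[of "a - 1"] a1 by simp
      moreover have "sdim (b - 1) - sdim (b - 2) < a" using sdim_step[of "b - 1"] a1 False by (simp split: if_splits)
      ultimately show False by linarith
    qed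
  qed
  then obtain j G where G: "j \<le> b" "G \<in> II" "G \<in> forms j" "\<not> F dvd G" by blast
  obtain tt where tt: "tt \<in> syz f" "\<And>i. tt $ i \<in> forms (j - 1)" "phi tt = G" using II_lift[OF G(2,3)] by blast
  obtain k where k: "k \<in> forms (a - 1 + (j - 1) + 1 - int d)" "phi tt *s s - phi s *s tt = k *s theta0"
    using wedge_forms[OF s(1,2) tt(1,2)] by blast
  have "k \<noteq> 0"
  proof
    assume "k = 0"
    then have "G * s $ i = F * tt $ i" for i
      using arg_cong[OF k(2), of "\<lambda>x. x $ i"] s(3) tt(3) by simp
    then show False using minimal_divides[OF F(2,3) min s(1,3)] G(4) by blast
  qed
  \<comment> \<open>The degree \<open>a + j - 1 - d\<close> of \<open>k\<close> is at most 0 because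
    \<open>j \<le> b\<close>, and \<open>k \<noteq> 0\<close> excludes negative values.\<close>
  then have "\<not> a - 1 + (j - 1) + 1 - int d < 0" using k(1) forms_neg by (metis singletonD)
  then have j: "j = b" using G(1) unfolding b_def by linarith
  then have "k \<in> forms 0" using k(1) by (simp add: b_def)
  then obtain c where "k = const c" using forms_degree_0 by blast
  then have "free_with_exponents A (a - 1) (j - 1)"
    using basis_imp_free saito[OF s(1) tt(1), of c] k(2) \<open>k \<noteq> 0\<close> s(2) tt(2) by (metis const_eq_0_iff)
  then show ?thesis by blast
qed

end

section \<open>Uniqueness of intersection points and products of coprime factors\<close>

lemma kill_kill: "m \<noteq> 0 \<Longrightarrow> kill m (kill m p) = kill m p"
  using dvd_diff_kill[of m p] lf_dvd_iff[of m "p - kill m p"] by (simp add: kill_hom)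

lemma dot_commute: "dot m p = dot p m"
  by (simp add: dot_def mult.commute)

lemma point_expand:
  assumes "\<And>i r. (if i = r then 1 else 0) = v $ i * t $ r + e2 $ i * y $ r + e3 $ i * z $ (r::3)"
  shows "p = dot t p *s v + dot y p *s e2 + dot z p *s e3"
proof (rule iffD2[OF vec_eq_iff], rule allI)
  fix i
  have "p $ i = (\<Sum>r\<in>UNIV. if r = i then p $ i else 0)" by simp
  also have "\<dots> = (\<Sum>r\<in>UNIV. (if i = r then 1 else 0) * p $ r)" by (rule sum.cong) auto
  also have "\<dots> = (dot t p *s v + dot y p *s e2 + dot z p *s e3) $ i"
    unfolding assms by (simp add: dot_def sum_3 algebra_simps)
  finally show "p $ i = (dot t p *s v + dot y p *s e2 + dot z p *s e3) $ i" .
qed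

lemma point_unique:
  assumes p: "p \<noteq> 0" and m: "m \<noteq> 0" "dot m p = 0" and n: "\<not> proportional m n" "dot n p = 0"
    and p': "p' \<noteq> 0" "dot m p' = 0" "dot n p' = 0"
  shows "proj_point p' = proj_point p"
proof -
  have perp: "dot u p' = 0" if u: "dot u p = 0" for u
  proof -
    obtain \<alpha> \<beta> where "u = \<alpha> *s m + \<beta> *s n" using perp_span[OF p m n u] .
    then show ?thesis using p' by (simp add: dot_simps)
  qed
  obtain t y z e2 e3 :: "'a ^ 3" where
    delta: "\<And>i r. (if i = r then 1 else 0) = p $ i * t $ r + e2 $ i * y $ r + e3 $ i * z $ r"
    and yz: "dot y p = 0" "dot z p = 0"
    using dual_basis[OF p] by metis
  have "p' = dot t p' *s p"
    using point_expand[OF delta, of p'] perp[OF yz(1)] perp[OF yz(2)] by simp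
  then obtain c where c: "p' = c *s p" by blast
  then have "c \<noteq> 0" using p' by auto
  then have "p = inverse c *s p'" by (simp add: c vec_eq_iff)
  show ?thesis
  proof (intro Set.set_eqI iffI)
    fix x assume "x \<in> proj_point p'"
    then obtain e where "x = e *s p'" by (auto simp: mem_proj_point)
    then have "x = (e * c) *s p" by (simp add: c vec_eq_iff)
    then show "x \<in> proj_point p" by (auto simp: mem_proj_point)
  next
    fix x assume "x \<in> proj_point p"
    then obtain e where "x = e *s p" by (auto simp: mem_proj_point)
    then have "x = (e * inverse c) *s p'" using \<open>c \<noteq> 0\<close> by (simp add: c vec_eq_iff)
    then show "x \<in> proj_point p'" unfolding mem_proj_point by blast
  qed
qed

lemma strip_prod:
  fixes g :: "'b::idom"
  assumes "finite D" "\<And>Q z. Q \<in> D \<Longrightarrow> g dvd G Q * z \<Longrightarrow> g dvd z" "g dvd prod G D * z"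
  shows "g dvd z"
  using assms
proof (induction D arbitrary: z rule: finite_induct)
  case (insert Q D)
  have "g dvd G Q * (prod G D * z)"
    using insert.prems(2) insert.hyps by (simp add: mult.assoc)
  then have *: "g dvd prod G D * z" by (rule insert.prems(1)[OF insertI1])
  show ?case by (rule insert.IH[OF _ *]) (rule insert.prems(1)[OF insertI2])
qed simp

text \<open>The factors will themselves be products of primes, so pairwise coprimality is expressed
  by cancellation.\<close>

lemma prod_dvd_of_strip:
  fixes x :: "'b::idom"
  assumes "finite C" "\<And>P. P \<in> C \<Longrightarrow> G P dvd x"
    "\<And>P P' z. P \<in> C \<Longrightarrow> P' \<in> C \<Longrightarrow> P \<noteq> P' \<Longrightarrow> G P dvd G P' * z \<Longrightarrow> G P dvd z"
  shows "prod G C dvd x"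
  using assms
proof (induction C rule: finite_induct)
  case (insert P C)
  have "prod G C dvd x"
    by (rule insert.IH[OF insert.prems(1)[OF insertI2] insert.prems(2)[OF insertI2 insertI2]])
  then obtain q where q: "x = prod G C * q" by (rule dvdE)
  have "G P dvd prod G C * q" using insert.prems(1)[OF insertI1] unfolding q .
  then have "G P dvd q"
  proof (rule strip_prod[OF insert.hyps(1), rotated])
    fix Q z assume Q: "Q \<in> C" "G P dvd G Q * z"
    have "P \<noteq> Q" using Q(1) insert.hyps(2) by blast
    then show "G P dvd z" by (rule insert.prems(2)[OF insertI1 insertI2[OF Q(1)] _ Q(2)])
  qed
  then show ?case using insert.hyps q by (simp add: mult.commute mult_dvd_mono)
qed simp

lemma lf_prod_dvd:
  assumes B: "finite B" and n0: "\<And>x. x \<in> B \<Longrightarrow> n x \<noteq> 0"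
    and dist: "\<And>x x'. x \<in> B \<Longrightarrow> x' \<in> B \<Longrightarrow> proportional (n x) (n x') \<Longrightarrow> x = x'"
    and dvd: "\<And>x. x \<in> B \<Longrightarrow> lf (n x) dvd u"
  shows "(\<Prod>x\<in>B. lf (n x)) dvd u"
proof (rule prod_dvd_of_strip[OF B dvd])
  fix x x' z assume x: "x \<in> B" "x' \<in> B" "x \<noteq> x'" "lf (n x) dvd lf (n x') * z"
  have "\<not> lf (n x) dvd lf (n x')" using lf_dvd_lf_iff[OF n0[OF x(1)], of "n x'"] dist[OF x(1,2)] x(3) by blast
  then show "lf (n x) dvd z"
    using x(4) prime_elem_dvd_mult_iff[OF prime_lf[OF n0[OF x(1)]]] by simp
qed

section \<open>Local conditions at the singular points\<close>

context arrangement
begin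

lemma mem_line: "L \<in> A \<Longrightarrow> P \<in> L \<longleftrightarrow> P \<in> line_of (lf (nv L))"
  using nv(3)[OF lines] by (rule arg_cong)

lemma in_line_iff: "L \<in> A \<Longrightarrow> p \<noteq> 0 \<Longrightarrow> proj_point p \<in> L \<longleftrightarrow> dot (nv L) p = 0"
  using trans[OF mem_line[of L "proj_point p"] proj_point_in_line[of p "nv L"]] .

lemma point_on_line: "L \<in> A \<Longrightarrow> P \<in> L \<Longrightarrow> \<exists>p. p \<noteq> 0 \<and> P = proj_point p"
  unfolding mem_line by (auto simp: line_of_def P2_def)

lemma mult_at_ge_2: "P \<in> sing_points A \<Longrightarrow> mult_at A P \<ge> 2"
proof -
  assume "P \<in> sing_points A"
  then obtain L L' where L: "L \<in> A" "L' \<in> A" "L \<noteq> L'" "P \<in> L" "P \<in> L'" by (auto simp: sing_points_def)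
  have "card {L, L'} \<le> card {L \<in> A. P \<in> L}" using L fin by (intro card_mono) auto
  then show ?thesis using L(3) by (simp add: mult_at_def)
qed

text \<open>The lines through \<open>P\<close> lie in the pencil spanned by \<open>M\<close> and the
  join \<open>w\<close> of \<open>P\<close> and \<open>v\<close>. Here
  \<open>\<beta> \<noteq> 0\<close> because \<open>v\<close> is on \<open>w\<close> but not on
  \<open>L\<close>; so on \<open>w\<close> all lines through \<open>P\<close> restrict to scalar
  multiples of one form.\<close>

lemma local_data:
  assumes M: "M \<in> A" "P \<in> M"
  obtains p w where "p \<noteq> 0" "P = proj_point p" "w \<noteq> 0" "dot w p = 0" "dot w v = 0" "dot (nv M) p = 0"
    "\<not> proportional w (nv M)"
    "\<And>k. fat_on_join P (proj_point v) k = ideal.span {lf w, lf (nv M) ^ k}"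
    "\<And>L. L \<in> A \<Longrightarrow> P \<in> L \<Longrightarrow> \<exists>\<alpha> \<beta>. \<beta> \<noteq> 0 \<and> nv L = \<alpha> *s w + \<beta> *s nv M"
proof -
  obtain p where p: "p \<noteq> 0" "P = proj_point p" using point_on_line[OF M] by blast
  have mp: "dot (nv M) p = 0" using M p in_line_iff by blast
  obtain w where w: "w \<noteq> 0" "dot w p = 0" "dot w v = 0" "\<not> proportional w (nv M)"
    "\<And>k. fat_on_join (proj_point p) (proj_point v) k = ideal.span {lf w, lf (nv M) ^ k}"
    using fat_on_join_eq[OF p(1) nonzero(1) mp dot_nv_v[OF M(1)]] by metis
  have lin: "\<exists>\<alpha> \<beta>. \<beta> \<noteq> 0 \<and> nv L = \<alpha> *s w + \<beta> *s nv M" if L: "L \<in> A" "P \<in> L" for L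
  proof -
    have "dot (nv L) p = 0" using L p in_line_iff by blast
    then obtain \<alpha> \<beta> where ab: "nv L = \<alpha> *s w + \<beta> *s nv M"
      using perp_span[OF p(1) w(1,2,4) mp] by metis
    then have "dot (nv L) v = \<beta> * dot (nv M) v" by (simp add: dot_simps w)
    then have "\<beta> \<noteq> 0" using dot_nv_v[OF L(1)] by auto
    then show ?thesis using ab by blast
  qed
  show thesis by (rule that[OF p w(1,2,3) mp w(4) w(5)[folded p(2)] lin])
qed

text \<open>Modulo \<open>lf w\<close>, a nonzero multiple of \<open>phi s\<close> is
  \<open>app w s\<close> times a linear form that does not vanish at \<open>p\<close>, and this
  factor cancels because the ideal is primary.\<close>

lemma phi_mem_iff_app_mem:
  assumes p: "p \<noteq> 0" and w: "w \<noteq> 0" "dot w p = 0" "dot w v = 0" and m: "dot m p = 0" "dot m v \<noteq> 0"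
  shows "phi s \<in> ideal.span {lf w, lf m ^ k} \<longleftrightarrow> app w s \<in> ideal.span {lf w, lf m ^ k}" (is "_ \<in> ?J \<longleftrightarrow> _")
proof -
  define \<beta> \<gamma> where "\<beta> = dot w e2" and "\<gamma> = dot w e3"
  have w_eq: "w = \<beta> *s y + \<gamma> *s z"
    using perp_expand[OF delta, of w] w(3) by (simp add: \<beta>_def \<gamma>_def)
  have lw: "lf w = const \<beta> * lf y + const \<gamma> * lf z"
    by (subst w_eq) (simp add: lf_add lf_scale)
  have aw: "app w s = const \<beta> * app y s + const \<gamma> * app z s"
    by (subst w_eq) (simp add: app_form)
  have np: "\<not> proportional w m" using m(2) w(3) by (auto simp: proportional_def dot_simps)
  have J0: "lf w \<in> ?J" by (simp add: ideal.span_base)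
  have evp: "eval x p = 0" if "x \<in> ideal.span {lf w, lf m}" for x
    using that w(2) m(1) by (auto simp: span_pair)
  \<comment> \<open>\<open>m\<close> vanishes at \<open>p\<close> but not at \<open>v\<close>, so
    the two points differ and some line through \<open>v\<close> misses \<open>p\<close>.\<close>
  have pv: "dot y p \<noteq> 0 \<or> dot z p \<noteq> 0"
  proof (rule ccontr)
    assume "\<not> ?thesis"
    then have 0: "dot y p = 0" "dot z p = 0" by auto
    have pe: "p = dot t p *s v" using point_expand[OF delta, of p] by (simp add: 0)
    have "dot m p = dot t p * dot m v" by (subst pe) (simp add: dot_simps)
    then have "dot t p = 0" using m by simp
    then show False using p pe by simp
  qed
  have "\<beta> * dot y p + \<gamma> * dot z p = 0" using w(2) by (subst (asm) w_eq) (simp add: dot_simps)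
  have unit: "x \<in> ?J" if "const c * x \<in> ?J" "c \<noteq> 0" for c x
    using ideal.span_scale[OF that(1), of "const (inverse c)"] that(2) by (simp add: const_inverse_mult)
  have key: "phi s \<in> ?J \<longleftrightarrow> app w s \<in> ?J"
    if eq: "const c * phi s = e * lf w + q * app w s" "c \<noteq> 0" "eval q p \<noteq> 0" for c e q
  proof
    assume "phi s \<in> ?J"
    then have "const c * phi s - e * lf w \<in> ?J" by (intro ideal.span_diff ideal.span_scale J0)
    then have "q * app w s \<in> ?J" using eq(1) by simp
    moreover have "q \<notin> ideal.span {lf w, lf m}" using evp eq(3) by blast
    ultimately show "app w s \<in> ?J" using span_power_colon[OF w(1) np] by blast
  next
    assume "app w s \<in> ?J"
    then have "e * lf w + q * app w s \<in> ?J" by (intro ideal.span_add ideal.span_scale J0)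
    then show "phi s \<in> ?J" using unit eq(1,2) by metis
  qed
  show ?thesis
  proof (cases "\<gamma> = 0")
    case False
    have "dot y p \<noteq> 0" using pv \<open>\<beta> * dot y p + \<gamma> * dot z p = 0\<close> False by auto
    then show ?thesis
      by (intro key[of \<gamma> "app y s" "- lf y"]) (use False in \<open>simp_all add: lw aw phi_def algebra_simps\<close>)
  next
    case True
    then have "\<beta> \<noteq> 0" using w(1) w_eq by auto
    moreover have "dot z p \<noteq> 0" using pv \<open>\<beta> * dot y p + \<gamma> * dot z p = 0\<close> True \<open>\<beta> \<noteq> 0\<close> by auto
    ultimately show ?thesis
      by (intro key[of \<beta> "- app z s" "lf z"]) (simp_all add: lw aw phi_def algebra_simps)
  qed
qed

text \<open>\<open>\<theta> \<mapsto> \<ell> \<theta>(m) - m \<theta>(\<ell>)\<close> depends, up to a scalar, only on the point cut out by \<open>\<ell>\<close> and \<open>m\<close>,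
  so it is divisible by every line through that point to which \<open>\<theta>\<close> is tangent.\<close>

lemma line_dvd_minor:
  assumes "nv L = \<alpha> *s w + \<beta> *s m" "\<beta> \<noteq> 0" "lf (nv L) dvd app (nv L) s"
  shows "lf (nv L) dvd lf w * app m s - lf m * app w s"
proof -
  have "const \<beta> * (lf w * app m s - lf m * app w s) = lf w * app (nv L) s - lf (nv L) * app w s"
    unfolding assms(1) by (simp add: lf_add lf_scale app_form algebra_simps)
  also have "lf (nv L) dvd \<dots>" by (rule dvd_diff[OF dvd_mult[OF assms(3)] dvd_triv_left])
  finally show ?thesis using assms(2) by (simp add: dvd_const_mult_iff)
qed

lemma kill_prod_lines:
  assumes w: "w \<noteq> 0" and B: "finite B" "\<And>L. L \<in> B \<Longrightarrow> \<exists>\<alpha> \<beta>. \<beta> \<noteq> 0 \<and> nv L = \<alpha> *s w + \<beta> *s m"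
  shows "\<exists>c. c \<noteq> 0 \<and> kill w (\<Prod>L\<in>B. lf (nv L)) = const c * kill w (lf m) ^ card B"
  using B
proof (induction B rule: finite_induct)
  case empty
  show ?case by (intro exI[of _ 1]) simp
next
  case (insert L B)
  have "\<exists>c. c \<noteq> 0 \<and> kill w (\<Prod>L\<in>B. lf (nv L)) = const c * kill w (lf m) ^ card B"
    by (rule insert.IH) (rule insert.prems, rule insertI2)
  then obtain c where c: "c \<noteq> 0" "kill w (\<Prod>L\<in>B. lf (nv L)) = const c * kill w (lf m) ^ card B" by blast
  obtain \<alpha> \<beta> where ab: "\<beta> \<noteq> 0" "nv L = \<alpha> *s w + \<beta> *s m" using insert.prems by blast
  have "kill w (lf (nv L)) = const \<beta> * kill w (lf m)"
    using w by (simp add: ab(2) lf_add lf_scale kill_hom kill_self)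
  then have "kill w (\<Prod>L\<in>insert L B. lf (nv L)) = const (\<beta> * c) * kill w (lf m) ^ card (insert L B)"
    using insert.hyps c(2) by (simp add: kill_hom const_mult mult_ac)
  then show ?case using c(1) ab(1) by (intro exI[of _ "\<beta> * c"]) simp
qed

text \<open>All lines through \<open>P\<close> divide the minor \<open>?u\<close>, so its
  restriction to \<open>w\<close> is divisible by the power \<open>mult_at A P\<close> of
  \<open>?K\<close>. That restriction is \<open>?K\<close> times the one of \<open>app w s\<close>
  up to sign, and cancelling \<open>?K\<close> costs one in the exponent.\<close>

lemma phi_in_fat:
  assumes s: "s \<in> syz f" and P: "P \<in> sing_points A"
  shows "phi s \<in> fat_on_join P (proj_point v) (mult_at A P - 1)"
proof -
  obtain M where M: "M \<in> A" "P \<in> M" using P by (auto simp: sing_points_def)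
  obtain p w where l: "p \<noteq> 0" "P = proj_point p" "w \<noteq> 0" "dot w p = 0" "dot w v = 0" "dot (nv M) p = 0"
    "\<not> proportional w (nv M)"
    "\<And>k. fat_on_join P (proj_point v) k = ideal.span {lf w, lf (nv M) ^ k}"
    "\<And>L. L \<in> A \<Longrightarrow> P \<in> L \<Longrightarrow> \<exists>\<alpha> \<beta>. \<beta> \<noteq> 0 \<and> nv L = \<alpha> *s w + \<beta> *s nv M"
    by (rule local_data[OF M]) (rule that)
  let ?m = "nv M" and ?B = "{L \<in> A. P \<in> L}" and ?k = "mult_at A P - 1"
  let ?u = "lf w * app ?m s - lf ?m * app w s" and ?K = "kill w (lf ?m)"
  have card: "card ?B = Suc ?k" using mult_at_ge_2[OF P] by (simp add: mult_at_def)
  have "lf (nv L) dvd ?u" if L: "L \<in> ?B" for L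
  proof -
    obtain \<alpha> \<beta> where "\<beta> \<noteq> 0" "nv L = \<alpha> *s w + \<beta> *s ?m" using l(9) L by blast
    moreover have "lf (nv L) dvd app (nv L) s" using line_dvd_app[of L s] L s by (simp add: syz_iff)
    ultimately show ?thesis using line_dvd_minor by blast
  qed
  then have "(\<Prod>L\<in>?B. lf (nv L)) dvd ?u" using fin by (intro lf_prod_dvd) (simp_all add: nv_A nv_inj)
  then obtain e where e: "?u = (\<Prod>L\<in>?B. lf (nv L)) * e" by (auto simp: dvd_def)
  have finB: "finite ?B" using fin by simp
  have "\<exists>c. c \<noteq> 0 \<and> kill w (\<Prod>L\<in>?B. lf (nv L)) = const c * ?K ^ card ?B"
    by (rule kill_prod_lines[OF l(3) finB]) (rule l(9), simp_all)
  then obtain c where c: "c \<noteq> 0" "kill w (\<Prod>L\<in>?B. lf (nv L)) = const c * ?K ^ card ?B" by blast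
  have "kill w ?u = - (?K * kill w (app w s))" using l(3) by (simp add: kill_hom kill_self)
  moreover have "kill w ?u = const c * ?K ^ Suc ?k * kill w e"
    unfolding e by (simp only: kill_hom(2) c(2) card)
  ultimately have "- (?K * kill w (app w s)) = const c * ?K ^ Suc ?k * kill w e" by (rule trans[OF sym])
  then have "?K * kill w (app w s) = - (const c * ?K ^ Suc ?k * kill w e)" by (metis minus_minus)
  also have "\<dots> = ?K * (?K ^ ?k * (- const c * kill w e))" by (simp add: mult_ac)
  finally have "?K * kill w (app w s) = ?K * (?K ^ ?k * (- const c * kill w e))" .
  moreover have "?K \<noteq> 0" using kill_nonzero[OF l(3,7)] .
  ultimately have "kill w (app w s) = ?K ^ ?k * (- const c * kill w e)" using mult_left_cancel by blast
  then have "app w s \<in> ideal.span {lf w, lf ?m ^ ?k}" unfolding span_power_iff[OF l(3)] by simp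
  then show ?thesis unfolding l(8) using phi_mem_iff_app_mem[OF l(1,3,4,5,6) dot_nv_v[OF M(1)]] by blast
qed

text \<open>Such a derivation maps \<open>f\<close> to a multiple of \<open>f\<close>. Subtracting a
  multiple of the Euler derivation makes it a syzygy, and \<open>phi\<close> does not see the
  change.\<close>

lemma tangent_imp_II:
  assumes tan: "\<And>L. L \<in> A \<Longrightarrow> lf (nv L) dvd app (nv L) s"
  shows "phi s \<in> II"
proof -
  have "f dvd der s f" unfolding f_prod using prod_dvd_der[OF fin tan] .
  then obtain h where h: "der s f = f * h" by (auto simp: dvd_def)
  let ?c = "const (inverse (of_nat d))"
  have c: "?c * dP = (1 :: 'a poly3)" using d_pos by (simp add: dP_def const_inverse_left)
  have "der (s - (?c * h) *s evec) f = f * h - ?c * h * (dP * f)" by (simp add: der_vec h euler)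
  also have "\<dots> = 0" using c by Groebner_Basis.algebra
  finally have "s - (?c * h) *s evec \<in> syz f" by (simp add: syz_iff)
  moreover have "phi (s - (?c * h) *s evec) = phi s" by (simp add: phi_vec)
  ultimately show ?thesis unfolding II_def by (metis imageI)
qed

text \<open>The derivation with given components along \<open>v\<close>, \<open>e2\<close>,
  \<open>e3\<close>. The first one is invisible to \<open>phi\<close>, so \<open>interpolate\<close>
  may choose it freely.\<close>

definition join_vec :: "'a poly3 \<Rightarrow> 'a poly3 \<Rightarrow> 'a poly3 \<Rightarrow> 'a poly3 ^ 3" where
  "join_vec a b c = a *s cvec v + b *s cvec e2 + c *s cvec e3"

lemma app_join_vec: "app m (join_vec a b c) = const (dot m v) * a + const (dot m e2) * b + const (dot m e3) * c"
  by (simp add: join_vec_def app_vec mult.commute)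

lemma phi_join_vec: "phi (join_vec a b c) = b * lf z - c * lf y"
  by (simp add: phi_def app_join_vec dots)

text \<open>The lines in \<open>B\<close> divide the minor, \<open>?u = ?G * e\<close>. On
  \<open>w\<close> the fat point condition shows that \<open>e\<close> vanishes at \<open>P\<close>,
  hence \<open>e = r * lf w + r' * lf (nv M)\<close>. Restriction to \<open>M\<close> leaves a
  common factor \<open>lf w\<close>, whose cancellation gives the claim.\<close>

lemma class_dvd:
  assumes M: "M \<in> A" "P \<in> M" and B: "B \<subseteq> A" "M \<notin> B" "\<And>L. L \<in> B \<Longrightarrow> P \<in> L"
    and fat: "phi s \<in> fat_on_join P (proj_point v) (mult_at A P - 1)"
    and tan: "\<And>L. L \<in> B \<Longrightarrow> lf (nv L) dvd app (nv L) s"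
  shows "(\<Prod>L\<in>B. kill (nv M) (lf (nv L))) dvd kill (nv M) (app (nv M) s)"
proof -
  obtain p w where l: "p \<noteq> 0" "P = proj_point p" "w \<noteq> 0" "dot w p = 0" "dot w v = 0" "dot (nv M) p = 0"
    "\<not> proportional w (nv M)"
    "\<And>k. fat_on_join P (proj_point v) k = ideal.span {lf w, lf (nv M) ^ k}"
    "\<And>L. L \<in> A \<Longrightarrow> P \<in> L \<Longrightarrow> \<exists>\<alpha> \<beta>. \<beta> \<noteq> 0 \<and> nv L = \<alpha> *s w + \<beta> *s nv M"
    by (rule local_data[OF M]) (rule that)
  let ?m = "nv M" and ?k = "mult_at A P - 1"
  let ?u = "lf w * app ?m s - lf ?m * app w s" and ?K = "kill w (lf ?m)" and ?G = "\<Prod>L\<in>B. lf (nv L)"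
  have finB: "finite B" using fin B(1) finite_subset by blast
  \<comment> \<open>\<open>M\<close> passes through \<open>P\<close> and is not in \<open>B\<close>,
    so the exponent in \<open>fat\<close> is at least \<open>card B\<close> and one factor
    \<open>?K\<close> is left over for \<open>e\<close>.\<close>
  have "card (insert M B) \<le> card {L \<in> A. P \<in> L}" using fin M B by (intro card_mono) auto
  then have card: "card B \<le> ?k" using finB B(2) by (simp add: mult_at_def)
  have lin: "\<exists>\<alpha> \<beta>. \<beta> \<noteq> 0 \<and> nv L = \<alpha> *s w + \<beta> *s ?m" if "L \<in> B" for L using l(9) B that by blast
  have "lf (nv L) dvd ?u" if L: "L \<in> B" for L using lin[OF L] line_dvd_minor tan[OF L] by blast
  then have "?G dvd ?u" using finB nv_A[OF subsetD[OF B(1)]] nv_inj[OF subsetD[OF B(1)] subsetD[OF B(1)]]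
    by (intro lf_prod_dvd)
  then obtain e where e: "?u = ?G * e" by (auto simp: dvd_def)
  have "\<exists>c. c \<noteq> 0 \<and> kill w ?G = const c * ?K ^ card B"
    by (rule kill_prod_lines[OF l(3) finB]) (rule lin)
  then obtain c where c: "c \<noteq> 0" "kill w ?G = const c * ?K ^ card B" by blast
  have "app w s \<in> ideal.span {lf w, lf ?m ^ ?k}"
    using fat phi_mem_iff_app_mem[OF l(1,3,4,5,6) dot_nv_v[OF M(1)]] unfolding l(8) by blast
  then obtain q where q: "kill w (app w s) = ?K ^ ?k * q" unfolding span_power_iff[OF l(3)] by (auto simp: dvd_def)
  have K: "?K \<noteq> 0" using kill_nonzero[OF l(3,7)] .
  have "kill w ?u = - (?K * kill w (app w s))" using l(3) by (simp add: kill_hom kill_self)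
  also have "\<dots> = ?K ^ card B * (?K * (- (?K ^ (?k - card B) * q)))"
  proof -
    obtain j where j: "?k = card B + j" using card le_Suc_ex by blast
    show ?thesis unfolding q unfolding j power_add by (simp add: mult_ac)
  qed
  finally have "?K ^ card B * (const c * kill w e) = ?K ^ card B * (?K * (- (?K ^ (?k - card B) * q)))"
    unfolding e kill_hom(2) c(2) by (simp add: mult_ac)
  moreover have "?K ^ card B \<noteq> 0" using K by simp
  ultimately have "const c * kill w e = ?K * (- (?K ^ (?k - card B) * q))"
    using mult_left_cancel by blast
  then have "?K dvd const c * kill w e" by simp
  then have "?K ^ 1 dvd kill w e" using c(1) by (simp add: dvd_const_mult_iff)
  then have "e \<in> ideal.span {lf w, lf ?m ^ 1}" unfolding span_power_iff[OF l(3)] .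
  then obtain r r' where r: "e = r * lf w + r' * lf ?m" by (auto simp: span_pair)
  have m0: "?m \<noteq> 0" using nv_A M by blast
  have kw: "kill ?m (lf w) \<noteq> 0"
  proof (rule kill_nonzero[OF m0])
    show "\<not> proportional ?m w" using l(3,5) dot_nv_v[OF M(1)] by (auto simp: proportional_def dot_simps)
  qed
  have "kill ?m (lf w) * kill ?m (app ?m s) = kill ?m ?u" using m0 by (simp add: kill_hom kill_self)
  also have "\<dots> = kill ?m ?G * (kill ?m r * kill ?m (lf w))"
    unfolding e r using m0 by (simp add: kill_hom kill_self)
  finally have "kill ?m (lf w) * kill ?m (app ?m s) = kill ?m (lf w) * (kill ?m ?G * kill ?m r)" by (simp add: mult_ac)
  then have "kill ?m (app ?m s) = kill ?m ?G * kill ?m r" using kw by simp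
  then show ?thesis by (simp add: kill_hom)
qed

section \<open>Gluing the local conditions\<close>

lemma lines_meet:
  assumes "M \<in> A" "L \<in> A"
  obtains P where "P \<in> M" "P \<in> L"
proof -
  obtain p where p: "p \<noteq> 0" "dot p (nv M) = 0" "dot p (nv L) = 0" using perp_exists[OF nv_A[OF assms(1)]] .
  then show thesis using that[of "proj_point p"] assms by (simp add: in_line_iff dot_commute)
qed

lemma lines_meet_unique:
  assumes "M \<in> A" "L \<in> A" "M \<noteq> L" "P \<in> M" "P \<in> L" "P' \<in> M" "P' \<in> L"
  shows "P' = P"
proof -
  obtain p p' where p: "p \<noteq> 0" "P = proj_point p" "p' \<noteq> 0" "P' = proj_point p'"
    using point_on_line assms by metis
  have "dot (nv M) p = 0" "dot (nv L) p = 0" "dot (nv M) p' = 0" "dot (nv L) p' = 0"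
    using assms p in_line_iff by metis+
  moreover have "\<not> proportional (nv M) (nv L)" using assms nv_inj by blast
  ultimately show ?thesis using point_unique[OF p(1) nv_A[OF assms(1)]] p by metis
qed

text \<open>A derivation with prescribed \<open>phi\<close> is determined up to its \<open>v\<close>-component \<open>a\<close>, so tangency to all lines is a
  Chinese remainder problem for \<open>a\<close>. Adding the lines one at a time, the obstruction on the new line
  splits over its intersection points with the previous ones.\<close>

lemma interpolate:
  assumes B: "finite B" "B \<subseteq> A"
    and fat: "\<And>P. P \<in> sing_points A \<Longrightarrow> b * lf z - c * lf y \<in> fat_on_join P (proj_point v) (mult_at A P - 1)"
  shows "\<exists>a. \<forall>L\<in>B. lf (nv L) dvd app (nv L) (join_vec a b c)"
  using B
proof (induction B rule: finite_induct)
  case (insert M B)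
  then obtain a where a: "\<And>L. L \<in> B \<Longrightarrow> lf (nv L) dvd app (nv L) (join_vec a b c)" by blast
  let ?s = "join_vec a b c" and ?m = "nv M" and ?G = "\<Prod>L\<in>B. lf (nv L)"
  have M: "M \<in> A" and BA: "B \<subseteq> A" using insert by auto
  have m0: "?m \<noteq> 0" using nv_A M by blast
  define pt where "pt L = (SOME P. P \<in> M \<and> P \<in> L)" for L
  have pt: "pt L \<in> M \<and> pt L \<in> L" if "L \<in> A" for L
    unfolding pt_def by (rule someI_ex) (use lines_meet[OF M that] in blast)
  let ?G' = "\<lambda>P. \<Prod>L\<in>{L \<in> B. pt L = P}. kill ?m (lf (nv L))"
  have np: "\<not> proportional ?m (nv L)" if "L \<in> B" for L
    using nv_inj[OF M, of L] that BA insert.hyps by blast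
  have "(\<Prod>P\<in>pt ` B. ?G' P) dvd kill ?m (app ?m ?s)"
  proof (rule prod_dvd_of_strip)
    show "finite (pt ` B)" using insert.hyps(1) by simp
  next
    fix P assume "P \<in> pt ` B"
    then obtain L1 where L1: "L1 \<in> B" "P = pt L1" by blast
    have P: "P \<in> M" "P \<in> L1" using pt L1 BA by auto
    have L1A: "L1 \<in> A" by (rule subsetD[OF BA L1(1)])
    have "M \<noteq> L1" using L1(1) insert.hyps(2) by metis
    then have "P \<in> sing_points A"
      unfolding sing_points_def mem_Collect_eq by (intro bexI[OF bexI[OF _ L1A] M] conjI IntI P)
    then have "phi ?s \<in> fat_on_join P (proj_point v) (mult_at A P - 1)" using fat by (simp add: phi_join_vec)
    then show "?G' P dvd kill ?m (app ?m ?s)"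
      using pt BA insert.hyps a by (intro class_dvd[OF M P(1)]) auto
  next
    fix P P' x assume PP: "P \<in> pt ` B" "P' \<in> pt ` B" "P \<noteq> P'" "?G' P dvd ?G' P' * x"
    show "?G' P dvd x"
    proof (rule prime_prod_strip[OF _ _ _ PP(4)])
      show "finite {L \<in> B. pt L = P}" using insert.hyps(1) by simp
      fix L assume L: "L \<in> {L \<in> B. pt L = P}"
      then have "L \<in> B" by simp
      then show "prime_elem (kill ?m (lf (nv L)))" by (intro prime_kill[OF m0] np)
      \<comment> \<open>If two earlier lines had proportional restrictions to \<open>M\<close>, they
        would meet \<open>M\<close> in the same point.\<close>
      show "\<not> kill ?m (lf (nv L)) dvd ?G' P'"
      proof
        assume dvd: "kill ?m (lf (nv L)) dvd ?G' P'"
        define red where "red L = nv L - (nv L $ piv ?m / ?m $ piv ?m) *s ?m" for L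
        have kl: "kill ?m (lf (nv L)) = lf (red L)" for L unfolding red_def by (rule kill_lf)
        have LB: "L \<in> B" "pt L = P" using L by simp_all
        have r0: "red L \<noteq> 0" using kill_nonzero[OF m0 np[OF LB(1)]] unfolding kl by simp
        have finP: "finite {L \<in> B. pt L = P'}" using insert.hyps(1) by simp
        have "\<exists>L'\<in>{L \<in> B. pt L = P'}. proportional (red L) (red L')"
          using dvd unfolding kl lf_dvd_prod_iff[OF finP r0] .
        then obtain L' where L': "L' \<in> B" "pt L' = P'" "proportional (red L) (red L')" by blast
        have LA: "L \<in> A" "L' \<in> A" by (rule subsetD[OF BA], fact)+
        then obtain e where e: "red L' = e *s red L" using L'(3) unfolding proportional_def by blast
        have P: "P \<in> M" "P \<in> L" using pt[OF LA(1)] LB by simp_all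
        have P': "P' \<in> M" "P' \<in> L'" using pt[OF LA(2)] L' by simp_all
        obtain p where p: "p \<noteq> 0" "P = proj_point p" using point_on_line[OF M P(1)] by blast
        have 0: "dot ?m p = 0" "dot (nv L) p = 0"
          using P in_line_iff[OF M p(1)] in_line_iff[OF LA(1) p(1)] unfolding p(2) by simp_all
        have "dot (red L') p = 0" using 0 unfolding e by (simp add: red_def dot_simps)
        then have "dot (nv L') p = 0" using 0 by (simp add: red_def dot_simps)
        then have "P \<in> L'" using in_line_iff[OF LA(2) p(1)] unfolding p(2) by simp
        moreover have "M \<noteq> L'" using L'(1) insert.hyps(2) by metis
        ultimately have "P' = P" using lines_meet_unique[OF M LA(2)] P(1) P' by metis
        then show False using PP(3) by simp
      qed
    qed
  qed
  also have "(\<Prod>P\<in>pt ` B. ?G' P) = (\<Prod>L\<in>B. kill ?m (lf (nv L)))"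
    using prod.image_gen[OF insert.hyps(1), of "\<lambda>L. kill ?m (lf (nv L))" pt] by simp
  also have "\<dots> = kill ?m ?G" by (simp add: kill_hom)
  finally obtain e where "kill ?m (app ?m ?s) = kill ?m ?G * e" by (auto simp: dvd_def)
  \<comment> \<open>A second restriction fixes both restricted terms and restricts \<open>e\<close>,
    so that \<open>app ?m ?s - ?G * e\<close> is killed.\<close>
  from arg_cong[OF this, of "kill ?m"] have e: "kill ?m (app ?m ?s) = kill ?m ?G * kill ?m e"
    by (simp only: kill_hom(2) kill_kill[OF m0])
  have "kill ?m (app ?m ?s - ?G * e) = 0" by (simp add: kill_hom e)
  then have dM: "lf ?m dvd app ?m ?s - ?G * e" using lf_dvd_iff[OF m0] by blast
  \<comment> \<open>The correction is a multiple of \<open>?G\<close>, so tangency to the earlier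
    lines persists; \<open>?c\<close> scales it to cancel the error on \<open>M\<close>.\<close>
  let ?c = "const (inverse (dot ?m v))"
  have app': "app n (join_vec (a - ?c * (?G * e)) b c) = app n ?s - const (dot n v) * ?c * (?G * e)" for n
    by (simp add: app_join_vec algebra_simps)
  have "lf (nv L) dvd app (nv L) (join_vec (a - ?c * (?G * e)) b c)" if L: "L \<in> insert M B" for L
  proof (cases "L = M")
    case True
    have "const (dot ?m v) * ?c = 1" using dot_nv_v[OF M] by (simp add: const_inverse_right)
    then show ?thesis unfolding True app' using dM by simp
  next
    case False
    then have "lf (nv L) dvd ?G" using L insert.hyps by (intro dvd_prodI) auto
    then show ?thesis unfolding app' using a[of L] L False by (intro dvd_diff dvd_mult dvd_mult2) auto
  qed
  then show ?case by blast
qed simp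

lemma II_iff_fat:
  "g \<in> II \<longleftrightarrow> g \<in> ideal.span {lf y, lf z} \<and>
    (\<forall>P\<in>sing_points A. g \<in> fat_on_join P (proj_point v) (mult_at A P - 1))"
proof
  assume "g \<in> II"
  then show "g \<in> ideal.span {lf y, lf z} \<and> (\<forall>P\<in>sing_points A. g \<in> fat_on_join P (proj_point v) (mult_at A P - 1))"
    using phi_in_span phi_in_fat by (auto simp: II_def)
next
  assume g: "g \<in> ideal.span {lf y, lf z} \<and> (\<forall>P\<in>sing_points A. g \<in> fat_on_join P (proj_point v) (mult_at A P - 1))"
  then obtain c b where "g = c * lf y + b * lf z" by (auto simp: span_pair)
  then have gb: "g = b * lf z - (- c) * lf y" by simp
  obtain a where "\<forall>L\<in>A. lf (nv L) dvd app (nv L) (join_vec a b (- c))"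
    using interpolate[OF fin subset_refl, of b "- c"] g unfolding gb by blast
  then have "phi (join_vec a b (- c)) \<in> II" using tangent_imp_II by blast
  then show "g \<in> II" unfolding phi_join_vec gb .
qed

section \<open>The second half of condition (c)\<close>

lemma fat_ideal: "ideal.subspace (fat_on_join P Q k)"
  unfolding fat_on_join_def by (rule ideal.subspace_span)

lemma ideal_a_socle:
  assumes l: "lin_coeffs l = v" and P: "P \<in> sing_points A"
    and F: "F \<in> forms a" and G: "G \<in> forms b" and II: "II = ideal.span {F, G}" and ab: "a + b = int d + 1"
  shows "(ideal_a A l P \<inter> point_ideal (dual_point l)) \<inter> forms (int d - 2) = II \<inter> forms (int d - 2)"
proof -
  obtain M where M: "M \<in> A" "P \<in> M" using P by (auto simp: sing_points_def)
  obtain p w where w: "p \<noteq> 0" "P = proj_point p" "w \<noteq> 0" "dot w p = 0" "dot w v = 0" "dot (nv M) p = 0"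
    "\<not> proportional w (nv M)"
    "\<And>k. fat_on_join P (proj_point v) k = ideal.span {lf w, lf (nv M) ^ k}"
    by (rule local_data[OF M]) (rule that)
  let ?m = "nv M"
  obtain k where k: "mult_at A P - 1 = Suc k" "mult_at A P - 2 = k"
    using mult_at_ge_2[OF P] by (metis Suc_diff_Suc Suc_1 Suc_le_lessD)
  have dual: "dual_point l = proj_point v" by (simp add: dual_point_def l)
  show ?thesis
  proof (intro Set.set_eqI iffI)
    fix x assume x: "x \<in> II \<inter> forms (int d - 2)"
    have "x \<in> fat_on_join P (proj_point v) (mult_at A P - 1)" using x P II_iff_fat by blast
    then obtain q q' where "x = q * lf w + q' * lf ?m ^ Suc k" unfolding w(8) k span_pair by blast
    then have "x = q * lf w + (q' * lf ?m) * lf ?m ^ k" by (simp add: mult_ac)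
    then have "x \<in> fat_on_join P (proj_point v) (mult_at A P - 2)" unfolding w(8) k span_pair by blast
    then show "x \<in> (ideal_a A l P \<inter> point_ideal (dual_point l)) \<inter> forms (int d - 2)"
      using x II_iff_fat[of x] unfolding ideal_a_def dual point_ideal_v by blast
  next
    fix x assume x: "x \<in> (ideal_a A l P \<inter> point_ideal (dual_point l)) \<inter> forms (int d - 2)"
    have xP: "x \<in> ideal.span {lf w, lf ?m ^ k}" and xQ: "\<And>P'. P' \<in> sing_points A \<Longrightarrow> P' \<noteq> P \<Longrightarrow>
        x \<in> fat_on_join P' (proj_point v) (mult_at A P' - 1)" and xY: "x \<in> ideal.span {lf y, lf z}"
      using x unfolding ideal_a_def dual point_ideal_v w(8) k by auto
    obtain q q' where q: "x = q * lf w + q' * lf ?m ^ k" using xP unfolding span_pair by blast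
    \<comment> \<open>Only the condition at \<open>P\<close> needs one more power; the others
      survive multiplication.\<close>
    have "lf n * x \<in> II" if n: "lf n * x \<in> ideal.span {lf w, lf ?m ^ Suc k}" for n
      unfolding II_iff_fat
    proof (intro conjI ballI)
      show "lf n * x \<in> ideal.span {lf y, lf z}" using xY by (rule ideal.span_scale)
      fix P' assume P': "P' \<in> sing_points A"
      show "lf n * x \<in> fat_on_join P' (proj_point v) (mult_at A P' - 1)"
      proof (cases "P' = P")
        case True
        show ?thesis unfolding True w(8) k by (rule n)
      next
        case False
        show ?thesis by (rule ideal.subspace_scale[OF fat_ideal xQ[OF P' False]])
      qed
    qed
    moreover have "lf w * x \<in> ideal.span {lf w, lf ?m ^ Suc k}"
    proof -
      have "lf w * x = x * lf w + 0 * lf ?m ^ Suc k" by (simp add: mult.commute)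
      then show ?thesis unfolding span_pair by blast
    qed
    moreover have "lf ?m * x \<in> ideal.span {lf w, lf ?m ^ Suc k}"
    proof -
      have "lf ?m * x = (lf ?m * q) * lf w + q' * lf ?m ^ Suc k" unfolding q by (simp add: algebra_simps)
      then show ?thesis unfolding span_pair by blast
    qed
    ultimately have "lf w * x \<in> II" "lf ?m * x \<in> II" by blast+
    then have "x \<in> II" using generated_socle[OF F G II ab w(3,7)] x by blast
    then show "x \<in> II \<inter> forms (int d - 2)" using x by blast
  qed
qed

end

text \<open>On the conic of points \<open>(1, u, u * u)\<close> every nonzero linear form becomes a
  nonzero polynomial in \<open>u\<close>, so finitely many values of \<open>u\<close> are
  excluded.\<close>

lemma exists_nonvanishing:
  fixes n :: "'b \<Rightarrow> 'a::field_char_0 ^ 3"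
  assumes B: "finite B" "\<And>x. x \<in> B \<Longrightarrow> n x \<noteq> 0"
  obtains v where "\<And>x. x \<in> B \<Longrightarrow> dot (n x) v \<noteq> 0"
proof -
  let ?q = "\<lambda>x. [:n x $ 1, n x $ 2, n x $ 3:]"
  have "finite {u. poly (?q x) u = 0}" if "x \<in> B" for x
  proof (rule poly_roots_finite)
    show "?q x \<noteq> 0" using B(2)[OF that] by (auto simp: vec_eq_iff forall_3)
  qed
  then have "finite (\<Union>x\<in>B. {u. poly (?q x) u = 0})" using B(1) by blast
  then obtain u where u: "u \<notin> (\<Union>x\<in>B. {u. poly (?q x) u = 0})"
    using ex_new_if_finite[OF infinite_UNIV_char_0] by blast
  define v :: "'a ^ 3" where "v = vector [1, u, u * u]"
  have "dot (n x) v = poly (?q x) u" for x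
    by (simp add: dot_def sum_3 v_def algebra_simps)
  then show thesis using that[of v] u by auto
qed

section \<open>Assembling the equivalences\<close>

context arrangement
begin

lemma equivalences:
  assumes l: "lin_coeffs l = v"
  shows "free_with_exponents A (a - 1) (b - 1) \<longleftrightarrow>
      (\<exists>F G. F \<in> forms a \<and> G \<in> forms b \<and> II = ideal.span {F, G}) \<and> a + b = int d + 1 \<and> a \<ge> 2 \<and> b \<ge> 2"
    and "(\<exists>a b. free_with_exponents A (a - 1) (b - 1)) \<longleftrightarrow>
      (\<forall>j. hilb II (int d - 2 - j) = scheme_degree II - hilb II j) \<and>
      (\<forall>P\<in>sing_points A. hilb (ideal_a A l P \<inter> point_ideal (dual_point l)) (int d - 2) = scheme_degree II - 1)"
proof -
  show ab: "free_with_exponents A (a - 1) (b - 1) \<longleftrightarrow>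
      (\<exists>F G. F \<in> forms a \<and> G \<in> forms b \<and> II = ideal.span {F, G}) \<and> a + b = int d + 1 \<and> a \<ge> 2 \<and> b \<ge> 2" for a b
    using free_imp_generated generated_imp_free by blast
  show "(\<exists>a b. free_with_exponents A (a - 1) (b - 1)) \<longleftrightarrow>
      (\<forall>j. hilb II (int d - 2 - j) = scheme_degree II - hilb II j) \<and>
      (\<forall>P\<in>sing_points A. hilb (ideal_a A l P \<inter> point_ideal (dual_point l)) (int d - 2) = scheme_degree II - 1)"
    (is "?L \<longleftrightarrow> ?R")
  proof
    assume ?L
    then obtain a b F G where g: "F \<in> forms a" "G \<in> forms b" "II = ideal.span {F, G}" "a + b = int d + 1" "a \<ge> 2" "b \<ge> 2"
      unfolding ab by blast
    have "hilb (ideal_a A l P \<inter> point_ideal (dual_point l)) (int d - 2) = hilb II (int d - 2)"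
      if "P \<in> sing_points A" for P
      unfolding hilb_def ideal_a_socle[OF l that g(1-4)] ..
    then show ?R using generated_symmetric(2,3)[OF g] by simp
  next
    assume ?R
    then show ?L using symmetric_imp_free by blast
  qed
qed

end

theorem theorem10p2:
  fixes A :: "('a::field_char_0 ^ 3) set set set" and d :: nat
  assumes "finite A" and "card A = d"
    and "\<forall>L\<in>A. is_line L"
    and "\<not> concurrent A"
  shows "\<exists>U. zariski_open_linear_forms U \<and> U \<noteq> {} \<and>
    (\<forall>l\<in>U. let I = residual A l \<inter> point_ideal (dual_point l);
        cond_a = (\<lambda>a b :: int. free_with_exponents A (a - 1) (b - 1));
        cond_b = (\<lambda>a b :: int.
          (\<exists>F G. F \<in> forms a \<and> G \<in> forms b \<and> I = ideal.span {F, G}) \<and>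
          a + b = int d + 1 \<and> a \<ge> 2 \<and> b \<ge> 2);
        cond_c =
          ((\<forall>j :: int. hilb I (int d - 2 - j) = scheme_degree I - hilb I j) \<and>
           (\<forall>P\<in>sing_points A.
              hilb (ideal_a A l P \<inter> point_ideal (dual_point l)) (int d - 2)
                = scheme_degree I - 1))
      in (\<forall>a b. cond_a a b \<longleftrightarrow> cond_b a b) \<and>
         ((\<exists>a b. cond_a a b) \<longleftrightarrow> cond_c))"
proof -
  let ?U = "{l \<in> forms 1. eval (arr_poly A) (lin_coeffs l) \<noteq> 0}"
  have f_prod: "arr_poly A = (\<Prod>L\<in>A. lf (nv L))"
    unfolding arr_poly_def by (rule prod.cong) (use assms(3) nv(1) in auto)
  have "zariski_open_linear_forms ?U"
    unfolding zariski_open_linear_forms_def by (rule exI[of _ "{arr_poly A}"]) simp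
  moreover have "?U \<noteq> {}"
  proof -
    obtain v where "\<And>L. L \<in> A \<Longrightarrow> dot (nv L) v \<noteq> 0"
      using exists_nonvanishing[OF assms(1), of nv] nv(2) assms(3) by metis
    then have "eval (arr_poly A) v \<noteq> 0" unfolding f_prod using assms(1) by (simp add: eval_prod)
    then have "lf v \<in> ?U" by simp
    then show ?thesis by blast
  qed
  moreover have "let I = residual A l \<inter> point_ideal (dual_point l);
        cond_a = (\<lambda>a b :: int. free_with_exponents A (a - 1) (b - 1));
        cond_b = (\<lambda>a b :: int.
          (\<exists>F G. F \<in> forms a \<and> G \<in> forms b \<and> I = ideal.span {F, G}) \<and>
          a + b = int d + 1 \<and> a \<ge> 2 \<and> b \<ge> 2);
        cond_c =
          ((\<forall>j :: int. hilb I (int d - 2 - j) = scheme_degree I - hilb I j) \<and>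
           (\<forall>P\<in>sing_points A.
              hilb (ideal_a A l P \<inter> point_ideal (dual_point l)) (int d - 2)
                = scheme_degree I - 1))
      in (\<forall>a b. cond_a a b \<longleftrightarrow> cond_b a b) \<and>
         ((\<exists>a b. cond_a a b) \<longleftrightarrow> cond_c)" if l: "l \<in> ?U" for l
  proof -
    define v where "v = lin_coeffs l"
    have v: "eval (arr_poly A) v \<noteq> 0" using l by (simp add: v_def)
    have "v \<noteq> 0"
    proof
      assume "v = 0"
      moreover have "proj_point (axis 1 1 :: 'a ^ 3) \<in> P2" by (rule proj_point_P2) simp
      \<comment> \<open>The empty arrangement counts as concurrent because the plane has a point. So
        there is a line, and its form would vanish at \<open>v = 0\<close>.\<close>
      then have "A \<noteq> {}" using assms(4) unfolding concurrent_def by blast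
      moreover have "dot m 0 = 0" for m :: "'a ^ 3" by (simp add: dot_def)
      ultimately show False using v assms(1) unfolding f_prod by (auto simp: eval_prod)
    qed
    then obtain t y z e2 e3 :: "'a ^ 3" where dual:
      "\<And>i r. (if i = r then 1 else 0) = v $ i * t $ r + e2 $ i * y $ r + e3 $ i * z $ r"
      "dot t v = 1" "dot y v = 0" "dot z v = 0" "dot t e2 = 0" "dot y e2 = 1" "dot z e2 = 0"
      "dot t e3 = 0" "dot y e3 = 0" "dot z e3 = 1"
      by (rule dual_basis) (rule that)
    interpret arrangement v t y z e2 e3 A
      by unfold_locales (rule dual assms(1,4) v bspec[OF assms(3)] | assumption)+
    have d: "arrangement.d A = d" by (simp add: d_def assms(2))
    have I: "residual A l \<inter> point_ideal (dual_point l) = II"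
      unfolding II_def by (rule residual_point_ideal) (simp add: v_def)
    have lv: "lin_coeffs l = v" by (simp add: v_def)
    show ?thesis
      unfolding Let_def I using equivalences[OF lv] unfolding d by blast
  qed
  ultimately show ?thesis by blast
qed

end
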